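(* Let $1\leq p<2$. Let $\Lambda$ be a nontrivial multiplier on $\mathcal{S}_{p}(\mathcal{X})$ with symbol $\kappa(z)$, $z\in S_p$. Suppose that a bi-infinite sequence $\{T_{k}\}_{k\in\mathbb{Z}}$ of $L^{p}$-tempered distributions on $\mathcal{X}$ satisfies the following conditions: (i) $\Lambda T_{k}=A\,T_{k+1}$ for some $A\in\mathbb{C}\setminus\{0\}$ and for all $k\in\mathbb{Z}$. (ii) For a fixed semi-norm $\nu_{p,m}(\cdot)$ of $\mathcal{S}_{p}(\mathcal{X})$ (with $m\in\mathbb{Z}_+$ independent of $k$) and a constant $M>0$, $|\langle T_{k},\phi\rangle|\leq M\nu_{p,m}(\phi)$ for all $k\in\mathbb{Z}$ and all $\phi\in\mathcal{S}_{p}(\mathcal{X})$. Then the following assertions hold: (a) If $|A|=\max\{|\kappa(z)|:z\in S_{p}\}$ and if the range $\kappa(S_p)$ intersects $\{w\in\mathbb{C}:|w|=|A|\}$ at finitely many distinct points $A_{1},\ldots,A_{j}$, then $T_{0}$ can be uniquely written as $T_{0}=T_{0,1}+T_{0,2}+\cdots+T_{0,j}$ for some $L^{p}$-tempered distributions $T_{0,i}$ on $\mathcal{X}$ satisfying $\Lambda T_{0,i}=A_{i}T_{0,i}$ for all $i=1,\ldots,j$. (b) If $|A|>\max\{|\kappa(z)|:z\in S_{p}\}$, then $T_{0}=0$.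
   Context: Let $q\geq 2$ be an integer and let $\mathcal{X}$ be the homogeneous tree of degree $q+1$ (the connected graph without cycles in which every vertex has $q+1$ neighbours), identified with its set of vertices, with graph distance $d$, counting measure, a fixed reference vertex $o$, and $|x|=d(o,x)$. A function on $\mathcal{X}$ is radial if its value at $x$ depends only on $|x|$; for radial $k$ we write $k(n)$ for its value at vertices with $|x|=n$. For $k$ radial, $f\ast k(x)=\sum_{y\in\mathcal{X}}f(y)k(d(x,y))$. $\mathbb{Z}_+$ is the set of nonnegative integers. For $p\in(1,\infty)$ put $\delta_p=\frac1p-\frac12$; $\delta_1=\frac12$. For $1\le p<2$, $S_p=\{z\in\mathbb{C}:|\Im z|\le|\delta_p|\}$. Boundary and spherical functions: $\Omega$ is the set of infinite geodesic rays $\omega=\{\omega_0,\omega_1,\dots\}$ starting at $\omega_0=o$; for $x\in\mathcal{X}$, $c(x,\omega)$ is the last vertex of the geodesic path from $o$ to $x$ that lies on $\omega$. $\nu$ is the Borel probability measure on $\Omega$ giving mass $(q+1)^{-1}q^{-n+1}$ to each set $\{\omega:|c(x,\omega)|=|x|\}$ with $|x|=n\ge1$ (these sets, for $x\in\mathcal X$, form a basis of the topology). The Poisson kernel is $p(x,\omega)=q^{2|c(x,\omega)|-|x|}$, and the elementary spherical function is $\phi_z(x)=\int_\Omega p^{1/2+iz}(x,\omega)\,d\nu(\omega)$, $z\in\mathbb{C}$ (a radial function). For a radial function $k$, its spherical Fourier transform is $\widehat{k}(z)=\sum_{x\in\mathcal{X}}k(x)\phi_z(x)$. For $1\le p<2$,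 $\mathcal{S}_p(\mathcal{X})$ is the Fréchet space of functions $\phi$ on $\mathcal{X}$ with $\nu_{p,m}(\phi)=\sup_{x\in\mathcal{X}}(1+|x|)^m q^{|x|/p}|\phi(x)|<\infty$ for all $m\in\mathbb{Z}_+$, topologized by these seminorms. An $L^p$-tempered distribution is a continuous linear functional $T:\mathcal{S}_p(\mathcal{X})\to\mathbb{C}$, with action written $\langle T,\phi\rangle$. A multiplier on $\mathcal{S}_p(\mathcal{X})$ with symbol $\kappa$ is an operator $\Lambda\phi=\phi\ast k$ from $\mathcal{S}_p(\mathcal{X})$ to itself, where $k$ is a radial function such that for every $m\in\mathbb{Z}_+$ there is $C_m>0$ with $\nu_{p,m}(\phi\ast k)\le C_m\nu_{p,m}(\phi)$ for all $\phi\in\mathcal{S}_p(\mathcal{X})$; its symbol is $\kappa(z)=\widehat{k}(z)$, $z\in S_p$ (such $k$ lies in $\mathcal S_p(\mathcal X)$, so the series converges on $S_p$). It acts on $L^p$-tempered distributions by $\langle\Lambda T,\phi\rangle=\langle T,\Lambda\phi\rangle$. The multiplier is nontrivial if $\kappa(z)\ne0$ for some $z\in S_p$. *)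

theory Defs
  imports "HOL-Probability.Probability"
begin

text \<open>
  A graph is given by its adjacency relation \<open>adj\<close>; its vertex set is the whole type \<open>'a\<close>.
  The reference vertex is called \<open>v0\<close>.
\<close>

definition homogeneous_tree :: "nat \<Rightarrow> ('a \<Rightarrow> 'a \<Rightarrow> bool) \<Rightarrow> bool" where
  "homogeneous_tree q adj \<longleftrightarrow>
     (\<forall>x y. adj x y \<longrightarrow> adj y x) \<and>
     (\<forall>x. \<not> adj x x) \<and>
     (\<forall>x y. adj\<^sup>*\<^sup>* x y) \<and>
     (\<nexists>vs. 3 \<le> length vs \<and> distinct vs \<and> successively adj vs \<and> adj (last vs) (hd vs)) \<and>
     (\<forall>x. card {y. adj x y} = q + 1)"

definition gdist :: "('a \<Rightarrow> 'a \<Rightarrow> bool) \<Rightarrow> 'a \<Rightarrow> 'a \<Rightarrow> nat" where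
  "gdist adj x y = (LEAST n. (adj ^^ n) x y)"

text \<open>The list of vertices of the geodesic path from \<open>x\<close> to \<open>y\<close>, endpoints included.\<close>

definition geodesic_path :: "('a \<Rightarrow> 'a \<Rightarrow> bool) \<Rightarrow> 'a \<Rightarrow> 'a \<Rightarrow> 'a list" where
  "geodesic_path adj x y =
     (THE vs. successively adj vs \<and> length vs = gdist adj x y + 1 \<and> hd vs = x \<and> last vs = y)"

definition radial :: "('a \<Rightarrow> 'a \<Rightarrow> bool) \<Rightarrow> 'a \<Rightarrow> ('a \<Rightarrow> complex) \<Rightarrow> bool" where
  "radial adj v0 k \<longleftrightarrow> (\<forall>x y. gdist adj v0 x = gdist adj v0 y \<longrightarrow> k x = k y)"

text \<open>The number written \<open>k(n)\<close>, for a radial function \<open>k\<close>.\<close>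

definition radial_value :: "('a \<Rightarrow> 'a \<Rightarrow> bool) \<Rightarrow> 'a \<Rightarrow> ('a \<Rightarrow> complex) \<Rightarrow> nat \<Rightarrow> complex" where
  "radial_value adj v0 k n = (THE c. \<forall>x. gdist adj v0 x = n \<longrightarrow> k x = c)"

definition convolution ::
    "('a \<Rightarrow> 'a \<Rightarrow> bool) \<Rightarrow> 'a \<Rightarrow> ('a \<Rightarrow> complex) \<Rightarrow> ('a \<Rightarrow> complex) \<Rightarrow> 'a \<Rightarrow> complex" where
  "convolution adj v0 f k x = (\<Sum>\<^sub>\<infinity>y\<in>UNIV. f y * radial_value adj v0 k (gdist adj x y))"

subsection \<open>Boundary and spherical functions\<close>

definition boundary :: "('a \<Rightarrow> 'a \<Rightarrow> bool) \<Rightarrow> 'a \<Rightarrow> (nat \<Rightarrow> 'a) set" where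
  "boundary adj v0 = {\<omega>. \<omega> 0 = v0 \<and> (\<forall>m n. m \<le> n \<longrightarrow> gdist adj (\<omega> m) (\<omega> n) = n - m)}"

definition confluence :: "('a \<Rightarrow> 'a \<Rightarrow> bool) \<Rightarrow> 'a \<Rightarrow> 'a \<Rightarrow> (nat \<Rightarrow> 'a) \<Rightarrow> 'a" where
  "confluence adj v0 x \<omega> = last (filter (\<lambda>v. v \<in> range \<omega>) (geodesic_path adj v0 x))"

definition boundary_cylinder :: "('a \<Rightarrow> 'a \<Rightarrow> bool) \<Rightarrow> 'a \<Rightarrow> 'a \<Rightarrow> (nat \<Rightarrow> 'a) set" where
  "boundary_cylinder adj v0 x =
     {\<omega> \<in> boundary adj v0. gdist adj v0 (confluence adj v0 x \<omega>) = gdist adj v0 x}"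

definition boundary_topology :: "('a \<Rightarrow> 'a \<Rightarrow> bool) \<Rightarrow> 'a \<Rightarrow> (nat \<Rightarrow> 'a) topology" where
  "boundary_topology adj v0 = topology_generated_by (range (boundary_cylinder adj v0))"

text \<open>
  The conditions determine the measure uniquely, since the cylinders together with the empty set
  are closed under intersection and generate the Borel sets.
\<close>

definition is_boundary_measure ::
    "nat \<Rightarrow> ('a \<Rightarrow> 'a \<Rightarrow> bool) \<Rightarrow> 'a \<Rightarrow> (nat \<Rightarrow> 'a) measure \<Rightarrow> bool" where
  "is_boundary_measure q adj v0 \<nu> \<longleftrightarrow>
     prob_space \<nu> \<and>
     space \<nu> = boundary adj v0 \<and>
     sets \<nu> = sigma_sets (boundary adj v0) {U. openin (boundary_topology adj v0) U} \<and>
     (\<forall>x n. gdist adj v0 x = n \<and> 1 \<le> n \<longrightarrow>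
        measure \<nu> (boundary_cylinder adj v0 x) = 1 / ((real q + 1) * real q ^ (n - 1)))"

definition poisson_kernel ::
    "nat \<Rightarrow> ('a \<Rightarrow> 'a \<Rightarrow> bool) \<Rightarrow> 'a \<Rightarrow> 'a \<Rightarrow> (nat \<Rightarrow> 'a) \<Rightarrow> real" where
  "poisson_kernel q adj v0 x \<omega> =
     real q powi (2 * int (gdist adj v0 (confluence adj v0 x \<omega>)) - int (gdist adj v0 x))"

definition spherical_function ::
    "nat \<Rightarrow> ('a \<Rightarrow> 'a \<Rightarrow> bool) \<Rightarrow> 'a \<Rightarrow> (nat \<Rightarrow> 'a) measure \<Rightarrow> complex \<Rightarrow> 'a \<Rightarrow> complex" where
  "spherical_function q adj v0 \<nu> z x =
     (\<integral>\<omega>. complex_of_real (poisson_kernel q adj v0 x \<omega>) powr (1/2 + \<i> * z) \<partial>\<nu>)"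

definition spherical_transform ::
    "nat \<Rightarrow> ('a \<Rightarrow> 'a \<Rightarrow> bool) \<Rightarrow> 'a \<Rightarrow> (nat \<Rightarrow> 'a) measure \<Rightarrow> ('a \<Rightarrow> complex) \<Rightarrow> complex \<Rightarrow> complex" where
  "spherical_transform q adj v0 \<nu> k z = (\<Sum>\<^sub>\<infinity>x\<in>UNIV. k x * spherical_function q adj v0 \<nu> z x)"

definition strip :: "real \<Rightarrow> complex set" where
  "strip p = {z. \<bar>Im z\<bar> \<le> \<bar>1/p - 1/2\<bar>}"

subsection \<open>Schwartz spaces and tempered distributions\<close>

definition schwartz_weight ::
    "nat \<Rightarrow> ('a \<Rightarrow> 'a \<Rightarrow> bool) \<Rightarrow> 'a \<Rightarrow> real \<Rightarrow> nat \<Rightarrow> ('a \<Rightarrow> complex) \<Rightarrow> 'a \<Rightarrow> real" where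
  "schwartz_weight q adj v0 p m \<phi> x =
     (1 + real (gdist adj v0 x)) ^ m * real q powr (real (gdist adj v0 x) / p) * cmod (\<phi> x)"

definition schwartz_seminorm ::
    "nat \<Rightarrow> ('a \<Rightarrow> 'a \<Rightarrow> bool) \<Rightarrow> 'a \<Rightarrow> real \<Rightarrow> nat \<Rightarrow> ('a \<Rightarrow> complex) \<Rightarrow> real" where
  "schwartz_seminorm q adj v0 p m \<phi> = (SUP x. schwartz_weight q adj v0 p m \<phi> x)"

definition schwartz_space ::
    "nat \<Rightarrow> ('a \<Rightarrow> 'a \<Rightarrow> bool) \<Rightarrow> 'a \<Rightarrow> real \<Rightarrow> ('a \<Rightarrow> complex) set" where
  "schwartz_space q adj v0 p = {\<phi>. \<forall>m. bdd_above (range (schwartz_weight q adj v0 p m \<phi>))}"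

definition schwartz_topology ::
    "nat \<Rightarrow> ('a \<Rightarrow> 'a \<Rightarrow> bool) \<Rightarrow> 'a \<Rightarrow> real \<Rightarrow> ('a \<Rightarrow> complex) topology" where
  "schwartz_topology q adj v0 p = topology_generated_by
     {{\<psi> \<in> schwartz_space q adj v0 p. schwartz_seminorm q adj v0 p m (\<lambda>x. \<psi> x - \<phi> x) < r} | m \<phi> r.
        \<phi> \<in> schwartz_space q adj v0 p \<and> 0 < r}"

text \<open>
  Distributions are functionals on the Schwartz space only. They are made \<open>extensional\<close>, so that
  two of them are equal as HOL functions iff they agree on the Schwartz space.
\<close>

definition tempered_distributions ::
    "nat \<Rightarrow> ('a \<Rightarrow> 'a \<Rightarrow> bool) \<Rightarrow> 'a \<Rightarrow> real \<Rightarrow> (('a \<Rightarrow> complex) \<Rightarrow> complex) set" where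
  "tempered_distributions q adj v0 p =
     {T \<in> extensional (schwartz_space q adj v0 p).
        (\<forall>\<phi>\<in>schwartz_space q adj v0 p. \<forall>\<psi>\<in>schwartz_space q adj v0 p. \<forall>a b.
           T (\<lambda>x. a * \<phi> x + b * \<psi> x) = a * T \<phi> + b * T \<psi>) \<and>
        continuous_map (schwartz_topology q adj v0 p) euclidean T}"

text \<open>
  The bounds applied to point masses force the kernel \<open>k\<close> into the Schwartz space. Hence all the
  infinite sums occurring here converge absolutely, and the default value of a divergent sum plays
  no role.
\<close>

definition multiplier_with_symbol ::
    "nat \<Rightarrow> ('a \<Rightarrow> 'a \<Rightarrow> bool) \<Rightarrow> 'a \<Rightarrow> (nat \<Rightarrow> 'a) measure \<Rightarrow> real \<Rightarrow>
     (('a \<Rightarrow> complex) \<Rightarrow> 'a \<Rightarrow> complex) \<Rightarrow> (complex \<Rightarrow> complex) \<Rightarrow> bool" where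
  "multiplier_with_symbol q adj v0 \<nu> p \<Lambda> \<kappa> \<longleftrightarrow>
     (\<exists>k. radial adj v0 k \<and>
        (\<forall>\<phi>\<in>schwartz_space q adj v0 p.
           \<Lambda> \<phi> = convolution adj v0 \<phi> k \<and> \<Lambda> \<phi> \<in> schwartz_space q adj v0 p) \<and>
        (\<forall>m. \<exists>C>0. \<forall>\<phi>\<in>schwartz_space q adj v0 p.
           schwartz_seminorm q adj v0 p m (\<Lambda> \<phi>) \<le> C * schwartz_seminorm q adj v0 p m \<phi>) \<and>
        (\<forall>z\<in>strip p. \<kappa> z = spherical_transform q adj v0 \<nu> k z))"

definition dual_action ::
    "nat \<Rightarrow> ('a \<Rightarrow> 'a \<Rightarrow> bool) \<Rightarrow> 'a \<Rightarrow> real \<Rightarrow> (('a \<Rightarrow> complex) \<Rightarrow> 'a \<Rightarrow> complex) \<Rightarrow>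
     (('a \<Rightarrow> complex) \<Rightarrow> complex) \<Rightarrow> ('a \<Rightarrow> complex) \<Rightarrow> complex" where
  "dual_action q adj v0 p \<Lambda> T = (\<lambda>\<phi>\<in>schwartz_space q adj v0 p. T (\<Lambda> \<phi>))"

end

theory Submission
  imports Defs "HOL-Complex_Analysis.Complex_Analysis" "HOL-Library.Nat_Bijection"
begin

text \<open>
  Fix a Schwartz function \<open>\<phi>\<close>. The numbers \<open>u\<^sub>k = \<langle>T\<^sub>k, \<phi>\<rangle>\<close> form a bounded sequence over the
  integers, and it is enough to show that \<open>u\<^sub>k = \<Sum>\<^sub>i c\<^sub>i w\<^sub>i\<^sup>k\<close> for \<open>k \<ge> 0\<close>, where the \<open>w\<^sub>i = A\<^sub>i / A\<close>
  are the values of \<open>\<kappa> / A\<close> on the unit circle. If there are none, then \<open>u\<^sub>0 = 0\<close>. If there are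
  some, Lagrange interpolation at the \<open>w\<^sub>i\<close> recovers \<open>c\<^sub>i = \<langle>T\<^sub>0\<^sub>,\<^sub>i, \<phi>\<rangle>\<close> as a fixed finite combination of
  the \<open>u\<^sub>k\<close>. This makes \<open>T\<^sub>0\<^sub>,\<^sub>i\<close> a tempered distribution and leaves no choice for it.

  The expansion of \<open>u\<close> is Gelfand's theorem on doubly power bounded operators with finite spectrum.
  If \<open>w\<close> is not a value of \<open>\<kappa> / A\<close> on the strip, then \<open>\<Lambda> / A - w\<close> has an inverse \<open>R\<^sub>w\<close>, and the
  bounded sequence \<open>v\<^sub>k = \<langle>T\<^sub>k, R\<^sub>w \<phi>\<rangle>\<close> satisfies \<open>u\<^sub>k = v\<^sub>k\<^sub>+\<^sub>1 - w v\<^sub>k\<close>. Telescoping shows that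
  \<open>- \<Sum>\<^sub>k\<^sub>\<ge>\<^sub>0 u\<^sub>k w\<^sup>-\<^sup>k\<^sup>-\<^sup>1\<close> outside the unit disc and \<open>\<Sum>\<^sub>k\<^sub>\<ge>\<^sub>1 u\<^sub>-\<^sub>k w\<^sup>k\<^sup>-\<^sup>1\<close> inside it are both equal to
  \<open>v\<^sub>0\<close>, so they are pieces of one function that is holomorphic off the points \<open>w\<^sub>i\<close>. The bound
  \<open>O(1 / \<bar>1 - \<bar>w\<bar>\<bar>)\<close> makes these points simple poles, and Liouville's theorem turns the function
  into a sum of partial fractions (\<open>bounded_orbit_finite_spectrum\<close>). A direct estimate of
  \<open>(\<kappa> / A)\<^sup>n Q(\<kappa>)\<close>, with a polynomial \<open>Q\<close> that vanishes at the points \<open>A\<^sub>i\<close>, would not do, because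
  \<open>\<kappa>\<close> may touch the circle to infinite order.

  To construct \<open>R\<^sub>w\<close> the problem is moved from the tree to the integers. Radial convolution operators
  are functions of the normalised adjacency operator \<open>L\<close>, and the Chebyshev operator \<open>C\<^sub>n\<close> with
  symbol \<open>t\<^sup>n + t\<^sup>-\<^sup>n\<close>, \<open>t = q\<^sup>i\<^sup>z\<close>, satisfies \<open>L C\<^sub>n = C\<^sub>n\<^sub>+\<^sub>1 + C\<^sub>n\<^sub>-\<^sub>1\<close>. On the array
  \<open>\<tau>\<^sub>k(n) = \<langle>T\<^sub>k, C\<^sub>n \<phi>\<rangle>\<close> the multiplier \<open>\<Lambda>\<close> acts as convolution with the Laurent coefficients of
  \<open>\<kappa>\<close>. Comparison with the superharmonic weight \<open>q\<^sup>-\<^sup>|\<^sup>x\<^sup>|\<^sup>/\<^sup>p\<close> shows that \<open>C\<^sub>n\<close> has norm at most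
  a polynomial times \<open>q\<^sup>n\<^sup>\<delta>\<close>, \<open>\<delta> = 1/p - 1/2\<close> (\<open>chebT_op_weight_le\<close>), while the Laurent coefficients
  of \<open>\<kappa>\<close> are \<open>q\<^sup>-\<^sup>n\<^sup>\<delta>\<close> times a rapidly decreasing factor. Inverting \<open>\<Lambda> / A - w\<close> then is
  inverting a Laurent series on a closed annulus with control of the coefficients: integrate by parts
  on the two boundary circles (\<open>inverse_coeff_decay\<close>).
\<close>

section \<open>The Carleman transform of a bounded orbit\<close>

text \<open>
  An isolated singularity on the unit circle is controlled although the bound degenerates at the two
  points where a small circle around \<open>e\<close> crosses the unit circle. A polynomial of degree two that is
  small near these two points absorbs the singularity of the bound, and the maximum principle on an
  annulus carries the estimate inwards. This gives a pole of order at most two, and on the radius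
  through \<open>e\<close> the bound excludes order two.
\<close>
lemma unit_circle_growth_imp_simple_pole:
  fixes G :: "complex \<Rightarrow> complex" and e :: complex
  assumes r: "0 < r" and e: "norm e = 1"
    and hol: "G holomorphic_on ball e r - {e}"
    and bound: "\<And>w. norm w \<noteq> 1 \<Longrightarrow> norm (G w) \<le> B / \<bar>1 - norm w\<bar>"
  shows "\<exists>c. ((\<lambda>w. (w - e) * G w) \<longlongrightarrow> c) (at e)"
proof -
  define r0 where "r0 = min r 1 / 2"
  have r0: "0 < r0" "r0 < r" "r0 < 1"
    using r by (auto simp: r0_def)
  have B0: "0 \<le> B" using bound[of 0] norm_ge_zero[of "G 0"] by (simp del: norm_ge_zero)
  \<comment> \<open>For \<open>\<bar>z\<bar> = \<rho>\<close> this is \<open>z (\<bar>e + z\<bar>\<^sup>2 - 1)\<close>, since \<open>cnj z = \<rho>\<^sup>2 / z\<close> there. So \<open>Q \<rho>\<close> cancels the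
    blow-up of the bound on the circle of radius \<open>\<rho>\<close>, and unlike \<open>\<bar>e + z\<bar>\<^sup>2 - 1\<close> it is holomorphic.\<close>
  define Q where "Q = (\<lambda>\<rho> z. cnj e * z^2 + of_real (\<rho>^2) * z + e * of_real (\<rho>^2))"
  have Q_sphere: "norm (Q (norm z) z) = norm z * \<bar>(norm (e + z))\<^sup>2 - 1\<bar>" for z
  proof -
    have "e * cnj e = 1" using complex_norm_square[of e] e by (metis of_real_1 one_power2)
    then have "of_real ((norm (e + z))\<^sup>2 - 1) = (e + z) * cnj (e + z) - e * cnj e"
      using complex_norm_square[of "e + z"] by simp
    also have "\<dots> = e * cnj z + z * cnj e + z * cnj z"
      by (simp add: algebra_simps)
    finally have eq: "of_real ((norm (e + z))\<^sup>2 - 1) = e * cnj z + z * cnj e + z * cnj z" .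
    have "z * of_real ((norm (e + z))\<^sup>2 - 1) = cnj e * z^2 + (z * cnj z) * z + e * (z * cnj z)"
      unfolding eq by (simp add: algebra_simps power2_eq_square)
    also have "\<dots> = Q (norm z) z"
      unfolding complex_norm_square[symmetric] Q_def by simp
    finally show ?thesis by (metis norm_mult norm_of_real)
  qed
  have Q_bound: "norm (Q \<rho> z) \<le> 3" if "0 \<le> \<rho>" "\<rho> \<le> 1" "norm z \<le> 1" for \<rho> z
  proof -
    have "norm (Q \<rho> z) \<le> norm (cnj e * z^2) + norm (of_real (\<rho>^2) * z) + norm (e * of_real (\<rho>^2))"
      unfolding Q_def by (meson norm_triangle_le norm_triangle_mono order_refl)
    also have "\<dots> = (norm z)^2 + \<rho>^2 * norm z + \<rho>^2"
      using e by (simp add: norm_mult norm_power)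
    also have "\<dots> \<le> 1 + 1 * 1 + 1"
      using that by (intro add_mono mult_mono power_le_one) auto
    finally show ?thesis by simp
  qed
  have GQ: "norm (G (e + z) * Q (norm z) z) \<le> 3 * B * norm z" if "norm z \<le> 1" for z
  proof (cases "norm (e + z) = 1")
    case True
    then have "norm (Q (norm z) z) = 0" unfolding Q_sphere by simp
    then show ?thesis using B0 by simp
  next
    case False
    let ?t = "norm (e + z)"
    have t: "?t \<le> 2" using norm_triangle_ineq[of e z] e that by simp
    have "norm (G (e + z) * Q (norm z) z) \<le> B / \<bar>1 - ?t\<bar> * (norm z * \<bar>?t\<^sup>2 - 1\<bar>)"
      unfolding norm_mult Q_sphere by (intro mult_right_mono bound False) auto
    also have "\<bar>?t\<^sup>2 - 1\<bar> = \<bar>1 - ?t\<bar> * (?t + 1)"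
      using abs_mult[of "1 - ?t" "?t + 1"] by (simp add: algebra_simps power2_eq_square abs_minus_commute)
    also have "B / \<bar>1 - ?t\<bar> * (norm z * (\<bar>1 - ?t\<bar> * (?t + 1))) = B * norm z * (?t + 1)"
      using False by simp
    also have "\<dots> \<le> B * norm z * 3"
      using t B0 by (intro mult_left_mono) auto
    finally show ?thesis by (simp add: mult_ac)
  qed
  have contQ: "continuous_on X (Q \<rho>)" for X \<rho>
    unfolding Q_def by (intro continuous_intros)
  have holG: "(\<lambda>z. G (e + z)) holomorphic_on ball 0 r - {0}"
    by (rule holomorphic_on_compose_gen[unfolded o_def, OF _ hol])
       (auto intro!: holomorphic_intros simp: dist_norm)
  have annulus: "norm (G (e + z) * Q \<rho> z * Q r0 z) \<le> 9 * B"
    if \<rho>: "0 < \<rho>" "\<rho> \<le> norm z" and z: "norm z \<le> r0" for z \<rho>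
  proof (rule maximum_modulus_frontier[where f = "\<lambda>z. G (e + z) * Q \<rho> z * Q r0 z"
        and S = "cball 0 r0 - ball 0 \<rho>"])
    have sub: "cball 0 r0 - ball 0 \<rho> \<subseteq> ball 0 r - {0::complex}"
      using \<rho> r0 by auto
    have hol': "(\<lambda>z. G (e + z) * Q \<rho> z * Q r0 z) holomorphic_on cball 0 r0 - ball 0 \<rho>"
      unfolding Q_def by (intro holomorphic_intros holomorphic_on_subset[OF holG sub])
    show "(\<lambda>z. G (e + z) * Q \<rho> z * Q r0 z) holomorphic_on interior (cball 0 r0 - ball 0 \<rho>)"
      using hol' interior_subset by (rule holomorphic_on_subset)
    have cl: "closed (cball 0 r0 - ball (0::complex) \<rho>)" by (intro closed_Diff) auto
    then show "continuous_on (closure (cball 0 r0 - ball 0 \<rho>)) (\<lambda>z. G (e + z) * Q \<rho> z * Q r0 z)"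
      using holomorphic_on_imp_continuous_on[OF hol'] by simp
    show "bounded (cball 0 r0 - ball (0::complex) \<rho>)" using bounded_cball bounded_diff by blast
    show "z \<in> cball 0 r0 - ball 0 \<rho>" using that by auto
    fix x :: complex assume "x \<in> frontier (cball 0 r0 - ball 0 \<rho>)"
    moreover have "ball 0 r0 - cball 0 \<rho> \<subseteq> interior (cball 0 r0 - ball (0::complex) \<rho>)"
      by (rule interior_maximal) auto
    ultimately have x: "x \<in> cball 0 r0 - ball 0 \<rho>" "x \<notin> ball 0 r0 - cball 0 \<rho>"
      using cl by (auto simp: frontier_def simp del: Diff_iff)
    then have x: "norm x = r0 \<or> norm x = \<rho>" "norm x \<le> r0" "\<rho> \<le> norm x"
      by auto
    have "norm (Q r0 x) \<le> 3" "norm (Q \<rho> x) \<le> 3"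
      using x r0(1,3) \<rho> z
      by (intro Q_bound; linarith)+
    moreover have "norm (G (e + x) * Q (norm x) x) \<le> 3 * B"
      using GQ[of x] x r0 B0 mult_left_le[of "norm x" "3 * B"] by auto
    ultimately have *: "norm (G (e + x) * Q (norm x) x) * norm (Q r0 x) \<le> (3 * B) * 3"
        "norm (G (e + x) * Q (norm x) x) * norm (Q \<rho> x) \<le> (3 * B) * 3"
      using B0 by (intro mult_mono; simp)+
    show "norm (G (e + x) * Q \<rho> x * Q r0 x) \<le> 9 * B"
    proof (cases "norm x = r0")
      case True
      then show ?thesis using *(2) by (simp add: norm_mult mult_ac)
    next
      case False
      then show ?thesis using *(1) x(1) by (simp add: norm_mult)
    qed
  qed
  \<comment> \<open>Shrink the inner radius: \<open>Q \<rho> z\<close> tends to \<open>cnj e * z\<^sup>2\<close>.\<close>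
  have limit0: "norm (G (e + z) * (cnj e * z^2) * Q r0 z) \<le> 9 * B" if z: "z \<noteq> 0" "norm z \<le> r0" for z
  proof -
    have "((\<lambda>\<rho>. norm (G (e + z) * Q \<rho> z * Q r0 z))
        \<longlongrightarrow> norm (G (e + z) * Q 0 z * Q r0 z)) (at_right 0)"
      unfolding Q_def by (intro tendsto_intros)
    moreover have "\<forall>\<^sub>F \<rho> in at_right 0. norm (G (e + z) * Q \<rho> z * Q r0 z) \<le> 9 * B"
      using z by (intro eventually_at_rightI[of 0 "norm z"]) (auto intro!: annulus)
    ultimately have "norm (G (e + z) * Q 0 z * Q r0 z) \<le> 9 * B"
      by (intro tendsto_upperbound) auto
    then show ?thesis by (simp add: Q_def)
  qed
  have double: "norm ((w - e)^2 * G w) \<le> 18 * B / r0^2" if w: "w \<noteq> e" "norm (w - e) < r0 / 4" for w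
  proof -
    define z where "z = w - e"
    have z: "z \<noteq> 0" "norm z \<le> r0 / 4" "w = e + z" using w by (auto simp: z_def)
    have "(norm z)^2 \<le> (r0/4)^2" using z by (intro power_mono) auto
    moreover have "(r0/4)^2 = r0^2 / 16" by (simp add: power_divide)
    moreover have "r0^2 * norm z \<le> r0^2 * (1/4)" using z r0 by (intro mult_left_mono) auto
    ultimately have small: "(norm z)^2 + r0^2 * norm z \<le> r0^2 / 2"
      using zero_le_power2[of r0] by linarith
    have "norm (e * of_real (r0^2)) \<le> norm (Q r0 z) + norm (cnj e * z^2 + of_real (r0^2) * z)"
      unfolding Q_def using norm_triangle_ineq4[of "cnj e * z^2 + of_real (r0^2) * z + e * of_real (r0^2)" "cnj e
          * z^2 + of_real (r0^2) * z"]
      by simp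
    also have "norm (cnj e * z^2 + of_real (r0^2) * z) \<le> (norm z)^2 + r0^2 * norm z"
      by (rule order_trans[OF norm_triangle_ineq]) (use e in \<open>simp add: norm_mult norm_power\<close>)
    finally have "r0^2 / 2 \<le> norm (Q r0 z)" using small e by (simp add: norm_mult norm_power)
    then have "norm (G w) * (norm z)^2 * (r0^2 / 2) \<le> norm (G w) * (norm z)^2 * norm (Q r0 z)"
      by (intro mult_left_mono) auto
    also have "\<dots> \<le> 9 * B" using limit0[of z] z r0 e by (simp add: norm_mult norm_power)
    finally show ?thesis using r0 by (simp add: z_def norm_mult norm_power field_simps)
  qed
  have "(\<lambda>w. (w - e)^2 * G w) holomorphic_on ball e r - {e}"
    by (intro holomorphic_intros hol)
  moreover have "\<forall>\<^sub>F w in at e. norm ((w - e)^2 * G w) \<le> 18 * B / r0^2"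
    unfolding eventually_at using r0 double by (intro exI[of _ "r0/4"]) (auto simp: dist_norm)
  ultimately obtain h where h: "h holomorphic_on ball e r" "\<And>w. w \<in> ball e r - {e}
      \<Longrightarrow> h w = (w - e)^2 * G w"
    using holomorphic_on_extend_bounded[of "\<lambda>w. (w - e)^2 * G w" "ball e r" e] r by auto
  have conth: "isCont h e"
    using h(1) r holomorphic_on_imp_continuous_on continuous_on_eq_continuous_at[of "ball e r" h] by auto
  \<comment> \<open>Along the radius \<open>e (1 + x)\<close> the bound reads \<open>B / x\<close>, so that \<open>(w - e)\<^sup>2 G w\<close> is \<open>O(x)\<close>.\<close>
  have he: "h e = 0"
  proof -
    have "((\<lambda>x. h (e + e * of_real x)) \<longlongrightarrow> h (e + e * of_real 0)) (at_right 0)"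
      using conth by (intro isCont_tendsto_compose[of _ h] tendsto_intros) (auto intro!: tendsto_eq_intros)
    moreover have "((\<lambda>x. h (e + e * of_real x)) \<longlongrightarrow> 0) (at_right 0)"
    proof (rule Lim_null_comparison)
      show "((\<lambda>x. B * x) \<longlongrightarrow> 0) (at_right 0)" by (auto intro!: tendsto_eq_intros)
      have "norm (h (e + e * of_real x)) \<le> B * x" if x: "0 < x" "x < r" for x :: real
      proof -
        have "norm (e + e * of_real x) = 1 + x"
          using x norm_mult[of e "1 + of_real x"] e norm_of_real[of "1 + x", where ?'a = complex]
          by (simp add: algebra_simps)
        then have "norm (G (e + e * of_real x)) \<le> B / x"
          using bound[of "e + e * of_real x"] x by simp
        moreover have "e + e * of_real x \<in> ball e r - {e}" using x e by (auto simp: dist_norm norm_mult)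
        ultimately show ?thesis
          using x e h(2)[of "e + e * of_real x"] mult_left_mono[of "norm (G (e + e * of_real x))" "B / x" "x^2"]
          by (simp add: norm_mult norm_power power2_eq_square)
      qed
      then show "\<forall>\<^sub>F x in at_right 0. norm (h (e + e * of_real x)) \<le> B * x"
        using r by (intro eventually_at_rightI[of 0 r]) auto
    qed
    ultimately show ?thesis using tendsto_unique[of "at_right (0::real)"] by fastforce
  qed
  have "(h has_field_derivative deriv h e) (at e)"
    using h(1) r by (intro holomorphic_derivI[of _ "ball e r"]) auto
  then have "((\<lambda>w. (h w - h e) / (w - e)) \<longlongrightarrow> deriv h e) (at e)"
    by (simp add: has_field_derivative_iff)
  moreover have "\<forall>\<^sub>F w in at e. w \<in> ball e r - {e}"
    using eventually_at_in_open[of "ball e r" e] r by simp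
  then have "\<forall>\<^sub>F w in at e. (h w - h e) / (w - e) = (w - e) * G w"
  proof (rule eventually_mono)
    fix w assume w: "w \<in> ball e r - {e}"
    then have "w - e \<noteq> 0" by simp
    then show "(h w - h e) / (w - e) = (w - e) * G w"
      unfolding h(2)[OF w] he by (simp add: power2_eq_square)
  qed
  ultimately have "((\<lambda>w. (w - e) * G w) \<longlongrightarrow> deriv h e) (at e)"
    by (rule Lim_transform_eventually)
  then show ?thesis ..
qed

text \<open>
  Subtracting one principal part at a time removes all singularities, and Liouville's theorem applies
  to what is left.
\<close>
lemma simple_poles_partial_fractions:
  fixes G :: "complex \<Rightarrow> complex"
  assumes "finite E" "G holomorphic_on - E"
    and "\<And>e. e \<in> E \<Longrightarrow> \<exists>c. ((\<lambda>w. (w - e) * G w) \<longlongrightarrow> c)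
        (at e)"
    and "(G \<longlongrightarrow> 0) at_infinity"
  shows "\<exists>c. \<forall>w. w \<notin> E \<longrightarrow> G w = (\<Sum>e\<in>E. c e / (w - e))"
  using assms
proof (induction E arbitrary: G rule: finite_induct)
  case empty
  then show ?case using Liouville_weak_0[of G] by auto
next
  case (insert e E)
  obtain c where c: "((\<lambda>w. (w - e) * G w) \<longlongrightarrow> c) (at e)" using insert.prems(2) by blast
  define H where "H = (\<lambda>w. G w - c / (w - e))"
  have holH: "H holomorphic_on (- E) - {e}"
    unfolding H_def by (intro holomorphic_intros holomorphic_on_subset[OF insert.prems(1)]) auto
  have opE: "open (- E)" using insert.hyps(1) by (simp add: finite_imp_closed open_Compl)
  have "((\<lambda>w. (w - e) * G w - c) \<longlongrightarrow> 0) (at e)" using c by (simp add: LIM_zero)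
  moreover have "\<forall>\<^sub>F w in at e. (w - e) * G w - c = (w - e) * H w"
    unfolding eventually_at H_def by (intro exI[of _ 1]) (auto simp: right_diff_distrib)
  ultimately have "((\<lambda>w. (w - e) * H w) \<longlongrightarrow> 0) (at e)" by (rule Lim_transform_eventually)
  then obtain g where g: "g holomorphic_on - E" "\<And>z. z \<in> - E - {e} \<Longrightarrow> g z = H z"
    using holomorphic_on_extend_lim[OF holH] opE insert.hyps(2) by (auto simp: interior_open)
  have "\<exists>d. \<forall>w. w \<notin> E \<longrightarrow> g w = (\<Sum>e\<in>E. d e / (w - e))"
  proof (rule insert.IH[OF g(1)])
    fix x assume x: "x \<in> E"
    then obtain c1 where c1: "((\<lambda>w. (w - x) * G w) \<longlongrightarrow> c1) (at x)" using insert.prems(2)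
        by blast
    have xe: "x \<noteq> e" using x insert.hyps(2) by auto
    have "((\<lambda>w. (w - x) * G w - (w - x) * (c / (w - e))) \<longlongrightarrow> c1 - (x - x) * (c / (x - e)))
        (at x)"
      using xe by (intro tendsto_intros c1) auto
    moreover have "\<forall>\<^sub>F w in at x. w \<in> - (insert e (E - {x})) \<and> w \<noteq> x"
      using xe insert.hyps(1)
      by (intro eventually_conj eventually_at_in_open' eventually_neq_at_within open_Compl finite_imp_closed) auto
    then have "\<forall>\<^sub>F w in at x. (w - x) * G w - (w - x) * (c / (w - e)) = (w - x) * g w"
      by (rule eventually_mono) (auto simp: g(2) H_def right_diff_distrib)
    ultimately have "((\<lambda>w. (w - x) * g w) \<longlongrightarrow> c1 - (x - x) * (c / (x - e))) (at x)"
      by (rule Lim_transform_eventually)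
    then show "\<exists>c. ((\<lambda>w. (w - x) * g w) \<longlongrightarrow> c) (at x)" ..
  next
    have "((\<lambda>w. G w - c / (w - e)) \<longlongrightarrow> 0 - 0) at_infinity"
    proof (intro tendsto_diff insert.prems(3))
      have "filterlim (\<lambda>w. w - e) at_infinity at_infinity"
        using tendsto_add_filterlim_at_infinity'[OF filterlim_ident tendsto_const[of "-e"]] by simp
      then show "((\<lambda>w. c / (w - e)) \<longlongrightarrow> 0) at_infinity"
        by (rule tendsto_divide_0[OF tendsto_const])
    qed
    moreover have "\<forall>\<^sub>F w in at_infinity. w \<notin> insert e E"
    proof -
      obtain b where "\<And>x. x \<in> insert e E \<Longrightarrow> norm x \<le> b"
        using finite_imp_bounded[of "insert e E"] insert.hyps(1) by (auto simp: bounded_iff)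
      then show ?thesis unfolding eventually_at_infinity by (intro exI[of _ "b + 1"]) force
    qed
    then have "\<forall>\<^sub>F w in at_infinity. G w - c / (w - e) = g w"
      by (rule eventually_mono) (auto simp: g(2) H_def)
    ultimately have "(g \<longlongrightarrow> 0 - 0) at_infinity" by (rule Lim_transform_eventually)
    then show "(g \<longlongrightarrow> 0) at_infinity" by simp
  qed
  then obtain d where d: "\<And>w. w \<notin> E \<Longrightarrow> g w = (\<Sum>e\<in>E. d e / (w - e))" by blast
  show ?case
  proof (intro exI[of _ "d(e := c)"] allI impI)
    fix w assume "w \<notin> insert e E"
    then have "G w = c / (w - e) + (\<Sum>e\<in>E. d e / (w - e))" using g(2)[of w] d[of w] by (auto simp: H_def)
    also have "(\<Sum>e\<in>E. d e / (w - e)) = (\<Sum>x\<in>E. (d(e := c)) x / (w - x))"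
      using insert.hyps(2) by (intro sum.cong) auto
    finally show "G w = (\<Sum>x\<in>insert e E. (d(e := c)) x / (w - x))"
      using insert.hyps by simp
  qed
qed

lemma powser_zero_imp_coeffs_zero:
  fixes d :: "nat \<Rightarrow> complex"
  assumes "\<And>x. x \<noteq> 0 \<Longrightarrow> norm x < 1 \<Longrightarrow> (\<lambda>k. d k * x^k) sums 0"
  shows "d k = 0"
  using assms
proof (induction k arbitrary: d)
  case 0
  then have "((\<lambda>_. 0) \<longlongrightarrow> d 0) (at (0::complex))"
    by (intro powser_limit_0_strong[of 1]) auto
  then show ?case using tendsto_const_iff[of "at (0::complex)" 0 "d 0"] by simp
next
  case (Suc k)
  have "((\<lambda>_. 0) \<longlongrightarrow> d 0) (at (0::complex))"
    using Suc.prems by (intro powser_limit_0_strong[of 1]) auto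
  then have d0: "d 0 = 0" using tendsto_const_iff[of "at (0::complex)" 0 "d 0"] by simp
  show ?case
  proof (rule Suc.IH[of "\<lambda>k. d (Suc k)"])
    fix x :: complex assume x: "x \<noteq> 0" "norm x < 1"
    then have "(\<lambda>k. d (Suc k) * x^Suc k) sums 0"
      using Suc.prems[of x] d0 sums_Suc_iff[of "\<lambda>k. d k * x^k" 0] by simp
    then have "(\<lambda>k. (d (Suc k) * x^Suc k) * (1/x)) sums (0 * (1/x))" by (rule sums_mult2)
    then show "(\<lambda>k. d (Suc k) * x^k) sums 0" using x by simp
  qed
qed

text \<open>
  The scalar form of Gelfand's theorem. The hypothesis on \<open>v\<close> says that \<open>u\<close> is the image of a bounded
  sequence under \<open>shift - w\<close>; it forces both halves of the Carleman transform of \<open>u\<close> to agree with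
  \<open>H\<close>, up to sign, wherever \<open>w \<in> V\<close>.
\<close>
lemma bounded_orbit_finite_spectrum:
  fixes u :: "int \<Rightarrow> complex"
  assumes E: "finite E" "E \<subseteq> sphere 0 1"
    and V: "open V" "{w. 1 \<le> norm w} - E \<subseteq> V" and H: "H holomorphic_on V"
    and u: "\<And>k. norm (u k) \<le> B"
    and resolvent: "\<And>w. w \<in> V \<Longrightarrow>
      \<exists>v. (\<exists>C. \<forall>k. norm (v k) \<le> C) \<and> v 0 = H w
          \<and> (\<forall>k::int. u k = v (k + 1) - w * v k)"
  shows "\<exists>c. \<forall>k. u (int k) = (\<Sum>e\<in>E. c e * e^k)"
proof -
  have B0: "0 \<le> B" using u[of 0] norm_ge_zero order_trans by blast
  have outer: "(\<lambda>k. u (int k) * (1/w)^Suc k) sums (- H w)" if w: "1 < norm w" for w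
  proof -
    have wV: "w \<in> V" using w V(2) E(2) by force
    obtain v C where v: "\<And>k. norm (v k) \<le> C" "v 0 = H w" "\<And>k. u k = v (k + 1) - w * v k"
      using resolvent[OF wV] by blast
    have w0: "w \<noteq> 0" using w by auto
    have part: "(\<Sum>k<n. u (int k) * (1/w)^Suc k) = v (int n) * (1/w)^n - H w" for n
    proof (induction n)
      case (Suc n)
      have "u (int n) * (1/w)^Suc n = v (int (Suc n)) * (1/w)^Suc n - v (int n) * (1/w)^n"
        unfolding v(3)[of "int n"] using w0 by (simp add: field_simps)
      then show ?case using Suc by simp
    qed (simp add: v(2))
    have "(\<lambda>n. v (int n) * (1/w)^n) \<longlonglongrightarrow> 0"
    proof (rule Lim_null_comparison)
      show "\<forall>\<^sub>F n in sequentially. norm (v (int n) * (1/w)^n) \<le> C * norm (1/w)^n"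
        using v(1) by (intro always_eventually allI) (auto simp: norm_mult norm_power intro!: mult_right_mono)
      show "(\<lambda>n. C * norm (1/w)^n) \<longlonglongrightarrow> 0"
        using w by (intro tendsto_mult_right_zero LIMSEQ_power_zero) (auto simp: norm_divide divide_less_eq_1)
    qed
    from tendsto_diff[OF this tendsto_const[of "H w"]]
    show ?thesis unfolding sums_def part by simp
  qed
  have inner: "(\<lambda>k. u (- int k - 1) * w^k) sums H w" if w: "norm w < 1" and wV: "w \<in> V" for w
  proof -
    obtain v C where v: "\<And>k. norm (v k) \<le> C" "v 0 = H w" "\<And>k. u k = v (k + 1) - w * v k"
      using resolvent[OF wV] by blast
    have part: "(\<Sum>k<n. u (- int k - 1) * w^k) = H w - w^n * v (- int n)" for n
    proof (induction n)
      case (Suc n)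
      have e: "- int (Suc n) = - int n - 1" "- int n - 1 + 1 = - int n" by simp_all
      have "u (- int n - 1) * w^n = w^n * v (- int n) - w^Suc n * v (- int (Suc n))"
        unfolding v(3)[of "- int n - 1"] e by (simp add: algebra_simps)
      then show ?case unfolding sum.lessThan_Suc Suc.IH by simp
    qed (simp add: v(2))
    have "(\<lambda>n. w^n * v (- int n)) \<longlonglongrightarrow> 0"
    proof (rule Lim_null_comparison)
      show "\<forall>\<^sub>F n in sequentially. norm (w^n * v (- int n)) \<le> norm w^n * C"
        using v(1) by (intro always_eventually allI) (auto simp: norm_mult norm_power intro!: mult_left_mono)
      show "(\<lambda>n. norm w^n * C) \<longlonglongrightarrow> 0"
        using w by (intro tendsto_mult_left_zero LIMSEQ_power_zero) auto
    qed
    from tendsto_diff[OF tendsto_const[of "H w"] this]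
    show ?thesis unfolding sums_def part by simp
  qed
  define G where "G = (\<lambda>w. if norm w < 1 then (\<Sum>k. u (- int k - 1) * w^k) else H w)"
  have GH: "G w = H w" if "w \<in> V" for w
    using inner[of w] that by (auto simp: G_def sums_iff)
  have summ: "summable (\<lambda>k. u (- int k - 1) * w^k)" if "norm w < 1" for w
    using u that by (intro summable_comparison_test'[OF summable_mult[OF summable_geometric[of "norm w"], of B], of
        0])
      (auto simp: norm_mult norm_power intro!: mult_right_mono)
  have "G holomorphic_on ball 0 1"
    by (rule power_series_holomorphic[of 0 1 "\<lambda>k. u (- int k - 1)"])
       (use summ in \<open>auto simp: G_def dist_norm intro!: summable_sums\<close>)
  moreover have "G holomorphic_on V"
    using H GH by (simp cong: holomorphic_cong)
  ultimately have "G holomorphic_on ball 0 1 \<union> V"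
    using V(1) by (intro holomorphic_on_Un) auto
  then have holG: "G holomorphic_on - E"
    by (rule holomorphic_on_subset) (use V(2) in \<open>auto simp: not_less\<close>)
  have boundG: "norm (G w) \<le> B / \<bar>1 - norm w\<bar>" if w: "norm w \<noteq> 1" for w
  proof (cases "norm w < 1")
    case True
    have "norm (G w) \<le> (\<Sum>k. B * norm w^k)"
      unfolding G_def using True u
      by (auto intro!: norm_suminf_le summable_mult simp: norm_mult norm_power mult_right_mono)
    also have "\<dots> = B / \<bar>1 - norm w\<bar>"
      using True by (simp add: suminf_mult suminf_geometric)
    finally show ?thesis .
  next
    case False
    then have w1: "1 < norm w" using w by simp
    have G: "- G w = (\<Sum>k. u (int k) * (1/w)^Suc k)"
      using outer[OF w1] False by (simp add: G_def sums_iff)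
    let ?q = "norm (1/w)"
    have q: "?q < 1" using w1 by (auto simp: norm_divide divide_less_eq_1)
    have "norm (- G w) \<le> (\<Sum>k. B * ?q * ?q^k)"
      unfolding G using u q
      by (intro norm_suminf_le summable_mult summable_geometric)
         (auto simp: norm_mult norm_power norm_divide power_divide intro!: divide_right_mono)
    also have "\<dots> = B * ?q / (1 - ?q)"
      using q by (subst suminf_mult) (auto simp: suminf_geometric)
    also have "\<dots> = B / \<bar>1 - norm w\<bar>"
    proof -
      have "w \<noteq> 0" using w1 by auto
      then show ?thesis using w1 by (simp add: norm_divide field_simps)
    qed
    finally show ?thesis by simp
  qed
  have "(G \<longlongrightarrow> 0) at_infinity"
  proof (rule Lim_null_comparison)
    show "\<forall>\<^sub>F w in at_infinity. norm (G w) \<le> B / (norm w - 1)"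
      unfolding eventually_at_infinity
    proof (intro exI[of _ 2] allI impI)
      fix w :: complex assume "2 \<le> norm w"
      then show "norm (G w) \<le> B / (norm w - 1)" using boundG[of w] by simp
    qed
    have "filterlim (\<lambda>w::complex. -1 + norm w) at_top at_infinity"
      by (intro filterlim_tendsto_add_at_top[OF tendsto_const] filterlim_norm_at_top)
    then show "((\<lambda>w::complex. B / (norm w - 1)) \<longlongrightarrow> 0) at_infinity"
      by (intro tendsto_divide_0[OF tendsto_const] filterlim_at_top_imp_at_infinity) simp
  qed
  moreover have "\<exists>c. ((\<lambda>w. (w - e) * G w) \<longlongrightarrow> c) (at e)" if e: "e \<in> E" for e
  proof -
    have "open (- (E - {e}))" using E(1) by (intro open_Compl finite_imp_closed) auto
    then obtain r where r: "0 < r" "ball e r \<subseteq> - (E - {e})"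
      using open_contains_ball[of "- (E - {e})"] by auto
    then have "G holomorphic_on ball e r - {e}"
      by (intro holomorphic_on_subset[OF holG]) auto
    then show ?thesis
      using unit_circle_growth_imp_simple_pole[OF r(1) _ _ boundG] e E(2) by (auto simp: dist_norm)
  qed
  ultimately obtain c where c: "\<And>w. w \<notin> E \<Longrightarrow> G w = (\<Sum>e\<in>E. c e / (w - e))"
    using simple_poles_partial_fractions[OF E(1) holG] by blast
  \<comment> \<open>Compare the expansions at infinity of \<open>G\<close> and of its partial fractions.\<close>
  have "u (int k) + (\<Sum>e\<in>E. c e * e^k) = 0" for k
  proof (rule powser_zero_imp_coeffs_zero[where d = "\<lambda>k. u (int k) + (\<Sum>e\<in>E. c e * e^k)"])
    fix x :: complex assume x: "x \<noteq> 0" "norm x < 1"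
    define w where "w = 1/x"
    have w: "1 < norm w" "x = 1/w" "w \<noteq> 0" using x by (auto simp: w_def norm_divide)
    have geo: "(\<lambda>k. c e * e^k * x^Suc k) sums (c e / (w - e))" if e: "e \<in> E" for e
    proof -
      have ex: "norm (e * x) < 1" using e E(2) x by (auto simp: norm_mult)
      then have ex1: "1 - e * x \<noteq> 0" by auto
      have "(\<lambda>k. (c e * x) * (e * x)^k) sums ((c e * x) * (1 / (1 - e * x)))"
        using geometric_sums[OF ex] by (rule sums_mult)
      moreover have "(c e * x) * (1 / (1 - e * x)) = c e / (w - e)"
        using ex1 x by (auto simp: w_def field_simps)
      ultimately show ?thesis by (simp add: power_mult_distrib mult_ac)
    qed
    have "(\<lambda>k. \<Sum>e\<in>E. c e * e^k * x^Suc k) sums (\<Sum>e\<in>E. c e / (w - e))"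
      using geo by (intro sums_sum) auto
    moreover have "w \<notin> E" using w E(2) by force
    moreover have "G w = H w" using w by (simp add: G_def)
    ultimately have "(\<lambda>k. u (int k) * x^Suc k + (\<Sum>e\<in>E. c e * e^k * x^Suc k)) sums (- H w + H w)"
      using outer[OF w(1)] c[of w] by (intro sums_add) (simp_all add: w(2))
    then have "(\<lambda>k. (u (int k) * x^Suc k + (\<Sum>e\<in>E. c e * e^k * x^Suc k)) * (1/x)) sums (0 * (1/x))"
      by (intro sums_mult2) simp
    moreover have "(u (int k) * x^Suc k + (\<Sum>e\<in>E. c e * e^k * x^Suc k)) * (1/x)
      = (u (int k) + (\<Sum>e\<in>E. c e * e^k)) * x^k" for k
      using x by (simp add: sum_distrib_right sum_divide_distrib distrib_right add_divide_distrib mult.assoc)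
    ultimately show "(\<lambda>k. (u (int k) + (\<Sum>e\<in>E. c e * e^k)) * x^k) sums 0" by simp
  qed
  then have "u (int k) = (\<Sum>e\<in>E. - c e * e^k)" for k
    by (simp add: sum_negf eq_neg_iff_add_eq_0)
  then show ?thesis by (intro exI[of _ "\<lambda>e. - c e"]) simp
qed

section \<open>Inverting rapidly decreasing Laurent series\<close>

abbreviation iabs :: "int \<Rightarrow> real" where "iabs l \<equiv> \<bar>real_of_int l\<bar>"

abbreviation pexp :: "nat \<Rightarrow> real \<Rightarrow> int \<Rightarrow> real" where
  "pexp N d l \<equiv> (1 + iabs l) ^ N * exp (d * iabs l)"

abbreviation rdec :: "real \<Rightarrow> nat \<Rightarrow> real \<Rightarrow> int \<Rightarrow> real" where
  "rdec C m d l \<equiv> C * exp (- d * iabs l) / (1 + iabs l) ^ m"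

text \<open>
  These are the coefficients of the Laurent series in \<open>t = e\<^sup>s\<close> that converge on the closed annulus
  \<open>e\<^sup>-\<^sup>d \<le> \<bar>t\<bar> \<le> e\<^sup>d\<close> together with all their derivatives.
\<close>
definition rapid :: "real \<Rightarrow> (int \<Rightarrow> complex) \<Rightarrow> bool" where
  "rapid d f \<longleftrightarrow> (\<forall>m::nat. \<exists>C. \<forall>l. norm (f l) \<le> rdec C m d l)"

text \<open>
  A Laurent series in the variable \<open>t = e\<^sup>s\<close>. The exponential coordinate \<open>s\<close> turns circles into vertical
  lines and the annulus into the convex set \<open>vstrip d\<close>.
\<close>
definition laurent :: "(int \<Rightarrow> complex) \<Rightarrow> complex \<Rightarrow> complex" where
  "laurent f s = (\<Sum>\<^sub>\<infinity>l. f l * exp (of_int l * s))"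

definition vstrip :: "real \<Rightarrow> complex set" where
  "vstrip d = {s. \<bar>Re s\<bar> \<le> d}"

lemma summable_on_nat_inverse_square: "(\<lambda>n::nat. 1 / (1 + real n)^2) summable_on UNIV"
proof -
  have "summable (\<lambda>n. 1 / (1 + real n)^2)"
    using inverse_power_summable[of 2, where ?'a = real] summable_Suc_iff[of "\<lambda>n. inverse (real n ^ 2)"]
    by (simp add: inverse_eq_divide add.commute)
  then show ?thesis by (intro norm_summable_imp_summable_on) simp
qed

lemma summable_on_int_inverse_square:
  "(\<lambda>l::int. 1 / (1 + iabs l)^2) summable_on UNIV"
proof -
  note s = summable_on_nat_inverse_square
  have 1: "(\<lambda>l::int. 1 / (1 + iabs l)^2) summable_on range int"
    by (subst summable_on_reindex) (use s in \<open>auto simp: o_def\<close>)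
  have 2: "(\<lambda>l::int. 1 / (1 + iabs l)^2) summable_on range (\<lambda>n. - int n)"
    by (subst summable_on_reindex) (use s in \<open>auto simp: o_def inj_def\<close>)
  have "(UNIV :: int set) = range int \<union> range (\<lambda>n. - int n)"
    using int_cases2 by (auto simp: image_def) (metis)
  then show ?thesis
    using 1 2 by (metis (no_types, lifting) summable_on_union)
qed

lemma rapid_bound:
  assumes "rapid d f"
  obtains C where "0 \<le> C" "\<And>l. norm (f l) \<le> rdec C m d l"
proof -
  obtain C where C: "\<And>l. norm (f l) \<le> rdec C m d l"
    using assms unfolding rapid_def by blast
  have "0 \<le> C" using C[of 0] norm_ge_zero[of "f 0"] by (simp del: norm_ge_zero)
  then show ?thesis using C that by blast
qed

text \<open>
  Rapidly decreasing coefficients beat every sequence of polynomial growth times \<open>e\<^sup>d\<^sup>|\<^sup>l\<^sup>|\<close>. This is the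
  duality between coefficients and orbits that makes all later pairings absolutely convergent.
\<close>
lemma rapid_times_growth:
  assumes "rapid d f"
  obtains C where "0 \<le> C" "\<And>l. norm (f l) * pexp N d l \<le> C / (1 + iabs l)^2"
proof -
  obtain C where C: "0 \<le> C" "\<And>l. norm (f l) \<le> rdec C (N + 2) d l"
    using rapid_bound[OF assms] by blast
  have "norm (f l) * pexp N d l \<le> C / (1 + iabs l)^2" for l
  proof -
    define t where "t = 1 + iabs l"
    have t: "0 < t" by (simp add: t_def add_pos_nonneg)
    have "norm (f l) * pexp N d l
      \<le> rdec C (N + 2) d l * pexp N d l"
      by (intro mult_right_mono C(2)) auto
    also have "\<dots> = C / (1 + iabs l)^2"
      using t by (simp add: t_def[symmetric] exp_minus power_add divide_simps power2_eq_square)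
    finally show ?thesis .
  qed
  then show ?thesis using C(1) that by blast
qed

lemma rapid_abs_summable:
  assumes "rapid d f" "\<And>l. norm (g l) \<le> C * pexp N d l"
  shows "(\<lambda>l. norm (f l) * norm (g l :: complex)) summable_on UNIV"
proof -
  obtain K where K: "0 \<le> K" "\<And>l. norm (f l) * pexp N d l \<le> K / (1 + iabs l)^2"
    using rapid_times_growth[OF assms(1)] by blast
  have C: "0 \<le> C" using assms(2)[of 0] norm_ge_zero[of "g 0"] by (simp del: norm_ge_zero)
  have "(\<lambda>l::int. (C * K) * (1 / (1 + iabs l)^2)) summable_on UNIV"
    by (intro summable_on_cmult_right summable_on_int_inverse_square)
  then show ?thesis
  proof (rule summable_on_comparison_test)
    fix l :: int
    have "norm (f l) * norm (g l) \<le> norm (f l) * (C * pexp N d l)"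
      by (intro mult_left_mono assms(2)) auto
    also have "\<dots> = C * (norm (f l) * pexp N d l)" by simp
    also have "\<dots> \<le> C * (K / (1 + iabs l)^2)" by (intro mult_left_mono K C)
    finally show "norm (f l) * norm (g l) \<le> (C * K) * (1 / (1 + iabs l)^2)" by simp
  qed auto
qed

lemma rapid_of_int_mult:
  assumes "rapid d f"
  shows "rapid d (\<lambda>l. of_int l * f l)"
  unfolding rapid_def
proof
  fix m
  obtain C where C: "0 \<le> C" "\<And>l. norm (f l) \<le> rdec C (Suc m) d l"
    using rapid_bound[OF assms] by blast
  have "norm (of_int l * f l) \<le> rdec C m d l" for l
  proof -
    have "norm (of_int l * f l) \<le> (1 + iabs l) * (rdec C (Suc m) d l)"
      unfolding norm_mult by (intro mult_mono C) auto
    also have "\<dots> = rdec C m d l"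
      by (auto simp: divide_simps add_nonneg_eq_0_iff)
    finally show ?thesis .
  qed
  then show "\<exists>C. \<forall>l. norm (of_int l * f l) \<le> rdec C m d l"
    by blast
qed

lemma rapid_uminus: "rapid d f \<Longrightarrow> rapid d (\<lambda>l. - f l)"
  by (simp add: rapid_def)

lemma norm_exp_of_int_le:
  assumes "s \<in> vstrip d"
  shows "norm (exp (of_int l * s)) \<le> exp (d * iabs l)"
proof -
  have "real_of_int l * Re s \<le> iabs l * \<bar>Re s\<bar>" by (metis abs_ge_self abs_mult)
  also have "\<dots> \<le> iabs l * d" using assms by (intro mult_left_mono) (auto simp: vstrip_def)
  finally show ?thesis by (simp add: mult.commute)
qed

lemma rapid_summable_exp:
  assumes "rapid d f"
  shows "(\<lambda>l. norm (f l) * exp (d * iabs l)) summable_on UNIV"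
  using rapid_abs_summable[OF assms, of "\<lambda>l. of_real (exp (d * iabs l))" 1 0] by (simp add: norm_exp_eq_Re)

lemma norm_laurent_term_le:
  "s \<in> vstrip d \<Longrightarrow> norm (f l * exp (of_int l * s)) \<le> norm (f l) * exp (d * iabs l)"
  unfolding norm_mult by (intro mult_left_mono norm_exp_of_int_le) auto

lemma laurent_has_sum:
  assumes "rapid d f" "s \<in> vstrip d"
  shows "((\<lambda>l. f l * exp (of_int l * s)) has_sum laurent f s) UNIV"
  unfolding laurent_def
  by (intro has_sum_infsum abs_summable_summable[OF
      Infinite_Sum.abs_summable_on_comparison_test'[OF rapid_summable_exp[OF assms(1)]]]
        norm_laurent_term_le assms(2))

lemma norm_laurent_le:
  assumes "rapid d f" "s \<in> vstrip d"
  shows "norm (laurent f s) \<le> (\<Sum>\<^sub>\<infinity>l. norm (f l) * exp (d * iabs l))"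
  using norm_infsum_le[OF laurent_has_sum[OF assms] has_sum_infsum[OF rapid_summable_exp[OF assms(1)]]]
    norm_laurent_term_le[OF assms(2)] by blast

lemma convex_vstrip: "convex (vstrip d)"
proof -
  have "vstrip d = Re -` {-d..d}" by (auto simp: vstrip_def)
  then show ?thesis using convex_linear_vimage[of Re "{-d..d}"] by (simp add: bounded_linear.linear bounded_linear_Re)
qed

lemma int_sum_as_series: "(f has_sum S) (UNIV :: int set) \<Longrightarrow> (\<lambda>j. f (int_decode j)) sums S"
  by (intro has_sum_imp_sums) (use has_sum_reindex_bij_betw[of int_decode UNIV UNIV f S] bij_int_decode in auto)

text \<open>
  The derivative is taken within the closed strip. The boundary lines have to be included, since the
  sharp decay of coefficients is read off there.
\<close>
lemma laurent_has_field_derivative: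
  assumes f: "rapid d f" and s: "s \<in> vstrip d"
  shows "(laurent f has_field_derivative laurent (\<lambda>l. of_int l * f l) s) (at s within vstrip d)"
proof -
  note f' = rapid_of_int_mult[OF f]
  have "\<exists>g. \<forall>x\<in>vstrip d. (\<lambda>j. f (int_decode j) * exp (of_int (int_decode j) * x)) sums g x
      \<and>
     (g has_field_derivative laurent (\<lambda>l. of_int l * f l) x) (at x within vstrip d)"
  proof (rule has_field_derivative_series[OF convex_vstrip _ _ s])
    show "((\<lambda>x. f (int_decode j) * exp (of_int (int_decode j) * x)) has_field_derivative
       of_int (int_decode j) * f (int_decode j) * exp (of_int (int_decode j) * x)) (at x within vstrip d)" for j x
      by (auto intro!: derivative_eq_intros)
    have "uniform_limit (vstrip d) (\<lambda>n x. \<Sum>i<n. of_int (int_decode i) * f (int_decode i)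
        * exp (of_int (int_decode i) * x))
      (\<lambda>x. \<Sum>i. of_int (int_decode i) * f (int_decode i) * exp (of_int (int_decode i) * x)) sequentially"
    proof (rule Weierstrass_m_test)
      show "summable (\<lambda>j. norm (of_int (int_decode j) * f (int_decode j)) * exp (d * iabs (int_decode j)))"
        using int_sum_as_series[OF has_sum_infsum[OF rapid_summable_exp[OF f']]] by (rule sums_summable)
    qed (use norm_laurent_term_le[of _ d "\<lambda>l. of_int l * f l"] in auto)
    then show "uniform_limit (vstrip d) (\<lambda>n x. \<Sum>i<n. of_int (int_decode i) * f (int_decode i)
        * exp (of_int (int_decode i) * x))
      (laurent (\<lambda>l. of_int l * f l)) sequentially"
      by (rule uniform_limit_cong'[THEN iffD1, rotated -1])
         (use int_sum_as_series[OF laurent_has_sum[OF f']] in \<open>auto simp: sums_iff\<close>)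
    show "summable (\<lambda>j. f (int_decode j) * exp (of_int (int_decode j) * s))"
      using int_sum_as_series[OF laurent_has_sum[OF f s]] by (rule sums_summable)
  qed
  then obtain g where g: "\<And>x. x \<in> vstrip d
      \<Longrightarrow> (\<lambda>j. f (int_decode j) * exp (of_int (int_decode j) * x)) sums g x"
     "\<And>x. x \<in> vstrip d \<Longrightarrow> (g has_field_derivative laurent (\<lambda>l. of_int l * f l) x)
         (at x within vstrip d)"
    by blast
  have "g x = laurent f x" if "x \<in> vstrip d" for x
    using g(1)[OF that] int_sum_as_series[OF laurent_has_sum[OF f that]] sums_unique2 by blast
  then show ?thesis
    using g(2)[OF s] s by (intro has_field_derivative_transform_within[OF g(2)[OF s], of 1]) auto
qed

lemma laurent_periodic: "laurent f (s + of_int j * (2 * of_real pi * \<i>)) = laurent f s"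
proof -
  have "exp (of_int l * (s + of_int j * (2 * of_real pi * \<i>))) = exp (of_int l * s)" for l :: int
    using exp_integer_2pi[of "of_int (l * j)"] by (simp add: distrib_left exp_add mult_ac)
  then show ?thesis by (simp add: laurent_def)
qed

lemma continuous_on_laurent: "rapid d f \<Longrightarrow> continuous_on (vstrip d) (laurent f)"
  by (rule DERIV_continuous_on[OF laurent_has_field_derivative])

text \<open>
  Functions of \<open>(w, s)\<close> that arise by differentiating \<open>1 / (laurent f s - w)\<close> repeatedly in \<open>s\<close>. The
  class is closed under \<open>\<partial>/\<partial>s\<close> and all its members are bounded uniformly in \<open>w\<close> away from the range of
  \<open>laurent f\<close>, so derivatives of every order are bounded without writing them down.
\<close>
inductive symbol_algebra :: "real \<Rightarrow> (int \<Rightarrow> complex) \<Rightarrow>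
    (complex \<Rightarrow> complex \<Rightarrow> complex) \<Rightarrow> bool"
  for d f where
  laurent: "rapid d h \<Longrightarrow> symbol_algebra d f (\<lambda>w. laurent h)"
| resolvent: "symbol_algebra d f (\<lambda>w s. 1 / (laurent f s - w))"
| add: "symbol_algebra d f X \<Longrightarrow> symbol_algebra d f Y
    \<Longrightarrow> symbol_algebra d f (\<lambda>w s. X w s + Y w s)"
| mult: "symbol_algebra d f X \<Longrightarrow> symbol_algebra d f Y
    \<Longrightarrow> symbol_algebra d f (\<lambda>w s. X w s * Y w s)"

lemma symbol_algebra_derivative:
  assumes "symbol_algebra d f X" and f: "rapid d f"
  shows "\<exists>Y. symbol_algebra d f Y \<and>
    (\<forall>w. w \<notin> laurent f ` vstrip d \<longrightarrow>
        (\<forall>s\<in>vstrip d. (X w has_field_derivative Y w s) (at s within vstrip d)))"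
  using assms(1)
proof induction
  case (laurent h)
  then show ?case
    by (intro exI[of _ "\<lambda>w. laurent (\<lambda>l. of_int l * h l)"])
       (auto intro!: symbol_algebra.laurent rapid_of_int_mult laurent_has_field_derivative)
next
  case resolvent
  let ?R = "\<lambda>w s. 1 / (laurent f s - w)"
  let ?Y = "\<lambda>w s. laurent (\<lambda>l. - (of_int l * f l)) s * (?R w s * ?R w s)"
  have neg: "laurent (\<lambda>l. - (of_int l * f l)) s = - laurent (\<lambda>l. of_int l * f l) s" for s
    by (simp add: laurent_def infsum_uminus)
  show ?case
  proof (intro exI[of _ ?Y] conjI allI impI ballI)
    show "symbol_algebra d f ?Y"
      by (intro symbol_algebra.intros rapid_uminus rapid_of_int_mult f)
    fix w s assume w: "w \<notin> laurent f ` vstrip d" and s: "s \<in> vstrip d"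
    have "laurent f s - w \<noteq> 0" using w s by auto
    then show "(?R w has_field_derivative ?Y w s) (at s within vstrip d)"
      unfolding neg
      by (auto intro!: derivative_eq_intros laurent_has_field_derivative[OF f s] simp: field_simps)
  qed
next
  case (add X Y)
  then obtain X' Y' where "symbol_algebra d f X'" "symbol_algebra d f Y'"
    "\<And>w s. w \<notin> laurent f ` vstrip d \<Longrightarrow> s \<in> vstrip d
        \<Longrightarrow> (X w has_field_derivative X' w s) (at s within vstrip d)"
    "\<And>w s. w \<notin> laurent f ` vstrip d \<Longrightarrow> s \<in> vstrip d
        \<Longrightarrow> (Y w has_field_derivative Y' w s) (at s within vstrip d)"
    by blast
  then show ?case
    by (intro exI[of _ "\<lambda>w s. X' w s + Y' w s"]) (auto intro!: symbol_algebra.intros DERIV_add)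
next
  case (mult X Y)
  then obtain X' Y' where "symbol_algebra d f X'" "symbol_algebra d f Y'"
    "\<And>w s. w \<notin> laurent f ` vstrip d \<Longrightarrow> s \<in> vstrip d
        \<Longrightarrow> (X w has_field_derivative X' w s) (at s within vstrip d)"
    "\<And>w s. w \<notin> laurent f ` vstrip d \<Longrightarrow> s \<in> vstrip d
        \<Longrightarrow> (Y w has_field_derivative Y' w s) (at s within vstrip d)"
    by blast
  then show ?case using mult.hyps
    by (intro exI[of _ "\<lambda>w s. X' w s * Y w s + Y' w s * X w s"])
        (auto intro!: symbol_algebra.intros DERIV_mult)
qed

lemma symbol_algebra_bounded:
  assumes "symbol_algebra d f X" "0 < \<epsilon>"
    and B: "\<And>w s. w \<in> B \<Longrightarrow> s \<in> vstrip d
        \<Longrightarrow> \<epsilon> \<le> norm (laurent f s - w)"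
  shows "\<exists>C. \<forall>w\<in>B. \<forall>s\<in>vstrip d. norm (X w s) \<le> C"
  using assms(1)
proof induction
  case (laurent h)
  then show ?case using norm_laurent_le by blast
next
  case resolvent
  have "norm (1 / (laurent f s - w)) \<le> 1 / \<epsilon>" if "w \<in> B" "s \<in> vstrip d" for w s
    using B[OF that] assms(2) by (simp add: norm_divide frac_le)
  then show ?case by blast
next
  case (add X Y)
  then obtain C D where "\<And>w s. w \<in> B \<Longrightarrow> s \<in> vstrip d
      \<Longrightarrow> norm (X w s) \<le> C" "\<And>w s. w \<in> B \<Longrightarrow> s \<in> vstrip d
          \<Longrightarrow> norm (Y w s) \<le> D"
    by blast
  then show ?case by (intro exI[of _ "C + D"]) (auto intro!: norm_triangle_mono)
next
  case (mult X Y)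
  then obtain C D where CD: "\<And>w s. w \<in> B \<Longrightarrow> s \<in> vstrip d
      \<Longrightarrow> norm (X w s) \<le> C" "\<And>w s. w \<in> B \<Longrightarrow> s \<in> vstrip d
          \<Longrightarrow> norm (Y w s) \<le> D"
    by blast
  have "norm (X w s * Y w s) \<le> \<bar>C\<bar> * \<bar>D\<bar>" if "w \<in> B" "s \<in> vstrip d" for w s
    unfolding norm_mult using CD[OF that] by (intro mult_mono) auto
  then show ?case by blast
qed

lemma symbol_algebra_periodic:
  "symbol_algebra d f X \<Longrightarrow> X w (s + 2 * of_real pi * \<i>) = X w s"
  by (induction rule: symbol_algebra.induct) (simp_all add: laurent_periodic[where j = 1, simplified])

text \<open>
  Up to the factor \<open>2 \<pi>\<close> this is the coefficient of \<open>e\<^sup>n\<^sup>s\<close> of \<open>X\<close>, computed on the line \<open>Re s = \<sigma>\<close>.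
\<close>
definition fourier_coeff :: "(complex \<Rightarrow> complex) \<Rightarrow> int \<Rightarrow> real \<Rightarrow>
    complex" where
  "fourier_coeff X n \<sigma> = integral {0..2*pi}
     (\<lambda>\<theta>. X (of_real \<sigma> + \<i> * of_real \<theta>)
         * exp (- of_int n * (of_real \<sigma> + \<i> * of_real \<theta>)))"

lemma vertical_line_in_vstrip: "\<bar>\<sigma>\<bar> \<le> d
    \<Longrightarrow> of_real \<sigma> + \<i> * of_real \<theta> \<in> vstrip d"
  by (simp add: vstrip_def)

lemma continuous_on_vertical_line:
  assumes "continuous_on (vstrip d) X" "\<bar>\<sigma>\<bar> \<le> d"
  shows "continuous_on A (\<lambda>\<theta>. X (of_real \<sigma> + \<i> * of_real \<theta>)
      * exp (- of_int n * (of_real \<sigma> + \<i> * of_real \<theta>)))"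
  by (intro continuous_intros continuous_on_compose2[OF assms(1)])
     (use assms(2) vertical_line_in_vstrip in auto)

lemma integral_combine_fourier_coeff:
  assumes "continuous_on (vstrip d) X" "continuous_on (vstrip d) Y" "\<bar>\<sigma>\<bar> \<le> d"
  shows "integral {0..2*pi} (\<lambda>\<theta>. Y (of_real \<sigma> + \<i> * of_real \<theta>)
      * exp (- of_int n * (of_real \<sigma> + \<i> * of_real \<theta>))
      - of_int n * (X (of_real \<sigma> + \<i> * of_real \<theta>)
          * exp (- of_int n * (of_real \<sigma> + \<i> * of_real \<theta>))))
    = fourier_coeff Y n \<sigma> - of_int n * fourier_coeff X n \<sigma>"
  unfolding fourier_coeff_def
  by (intro integral_unique has_integral_diff has_integral_mult_right integrable_integral
      integrable_continuous_interval continuous_on_vertical_line[OF assms(1,3)]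
          continuous_on_vertical_line[OF assms(2,3)])

text \<open>
  Integration by parts; there is no boundary term because of the period \<open>2 \<pi> \<i>\<close>.
\<close>
lemma fourier_coeff_derivative:
  assumes X: "\<And>s. s \<in> vstrip d \<Longrightarrow> (X has_field_derivative Y s) (at s within vstrip d)"
    and per: "\<And>s. X (s + 2 * of_real pi * \<i>) = X s" and Y: "continuous_on (vstrip d) Y"
    and \<sigma>: "\<bar>\<sigma>\<bar> \<le> d"
  shows "fourier_coeff Y n \<sigma> = of_int n * fourier_coeff X n \<sigma>"
proof -
  define l where "l = (\<lambda>\<theta>::real. of_real \<sigma> + \<i> * of_real \<theta>)"
  define g where "g = (\<lambda>s. X s * exp (- of_int n * s))"
  define g' where "g' = (\<lambda>s. Y s * exp (- of_int n * s) - of_int n * (X s * exp (- of_int n * s)))"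
  have contX: "continuous_on (vstrip d) X"
    using X by (rule DERIV_continuous_on)
  have l: "l \<theta> \<in> vstrip d" for \<theta> using \<sigma> by (simp add: l_def vstrip_def)
  have g: "(g has_field_derivative g' s) (at s within vstrip d)" if "s \<in> vstrip d" for s
    unfolding g_def g'_def using X[OF that] by (auto intro!: derivative_eq_intros simp: algebra_simps)
  have "((\<lambda>\<theta>. g (l \<theta>)) has_vector_derivative \<i> * g' (l \<theta>))
      (at \<theta> within {0..2*pi})" for \<theta>
  proof -
    have "(l has_vector_derivative \<i>) (at \<theta> within {0..2*pi})"
      unfolding l_def by (auto intro!: derivative_eq_intros)
    moreover have "(g has_field_derivative g' (l \<theta>)) (at (l \<theta>) within l ` {0..2*pi})"
      by (rule has_field_derivative_subset[OF g[OF l]]) (use l in auto)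
    ultimately show ?thesis using field_vector_diff_chain_within by (fastforce simp: o_def)
  qed
  then have "((\<lambda>\<theta>. \<i> * g' (l \<theta>)) has_integral (g (l (2*pi)) - g (l 0))) {0..2*pi}"
    by (intro fundamental_theorem_of_calculus) auto
  moreover have "g (l (2*pi)) = g (l 0)"
  proof -
    have "l (2*pi) = l 0 + 2 * of_real pi * \<i>" by (simp add: l_def)
    moreover have "exp (- of_int n * (l 0 + 2 * of_real pi * \<i>)) = exp (- of_int n * l 0)"
      using exp_integer_2pi[of "- of_int n"] by (simp add: distrib_left exp_add mult_ac right_diff_distrib exp_diff)
    ultimately show ?thesis unfolding g_def using per[of "l 0"] by simp
  qed
  ultimately have "((\<lambda>\<theta>. - \<i> * (\<i> * g' (l \<theta>))) has_integral (- \<i> * 0)) {0..2*pi}"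
    by (intro has_integral_mult_right) simp
  then have "integral {0..2*pi} (\<lambda>\<theta>. g' (l \<theta>)) = 0"
    by (intro integral_unique) simp
  moreover have "integral {0..2*pi} (\<lambda>\<theta>. g' (l \<theta>))
      = fourier_coeff Y n \<sigma> - of_int n * fourier_coeff X n \<sigma>"
    unfolding g'_def l_def by (rule integral_combine_fourier_coeff[OF contX Y \<sigma>])
  ultimately show ?thesis by simp
qed

text \<open>
  Independence of the line plays the part of Cauchy's theorem, but it holds up to the boundary of the
  strip: differentiation under the integral sign in \<open>\<sigma>\<close> gives the expression that vanishes by
  integration by parts.
\<close>
lemma fourier_coeff_shift:
  assumes X: "\<And>s. s \<in> vstrip d \<Longrightarrow> (X has_field_derivative Y s) (at s within vstrip d)"
    and per: "\<And>s. X (s + 2 * of_real pi * \<i>) = X s" and Y: "continuous_on (vstrip d) Y"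
    and \<sigma>: "\<bar>\<sigma>\<bar> \<le> d"
  shows "fourier_coeff X n \<sigma> = fourier_coeff X n 0"
proof -
  have contX: "continuous_on (vstrip d) X"
    using X by (rule DERIV_continuous_on)
  define g where "g = (\<lambda>s. X s * exp (- of_int n * s))"
  define g' where "g' = (\<lambda>s. Y s * exp (- of_int n * s) - of_int n * (X s * exp (- of_int n * s)))"
  have g: "(g has_field_derivative g' s) (at s within vstrip d)" if "s \<in> vstrip d" for s
    unfolding g_def g'_def using X[OF that] by (auto intro!: derivative_eq_intros simp: algebra_simps)
  have contg': "continuous_on (vstrip d) g'" unfolding g'_def by (intro continuous_intros contX Y)
  have contg: "continuous_on (vstrip d) g" unfolding g_def by (intro continuous_intros contX)
  have "((\<lambda>\<sigma>. integral (cbox 0 (2*pi))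
      (\<lambda>\<theta>. g (of_real \<sigma> + \<i> * of_real \<theta>))) has_vector_derivative
      integral (cbox 0 (2*pi)) (\<lambda>\<theta>. g' (of_real \<sigma> + \<i> * of_real \<theta>)))
          (at \<sigma> within {-d..d})"
    if "\<sigma> \<in> {-d..d}" for \<sigma>
  proof (rule leibniz_rule_vector_derivative[OF _ _ _ that])
    fix x t :: real assume x: "x \<in> {-d..d}"
    have "((\<lambda>x::real. of_real x + \<i> * of_real t) has_vector_derivative 1) (at x within {-d..d})"
      by (auto intro!: derivative_eq_intros)
    moreover have "(g has_field_derivative g' (of_real x + \<i> * of_real t))
      (at (of_real x + \<i> * of_real t) within (\<lambda>x. of_real x + \<i> * of_real t) ` {-d..d})"
      by (rule has_field_derivative_subset[OF g]) (use x in \<open>auto simp: vstrip_def\<close>)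
    ultimately show "((\<lambda>x. g (of_real x + \<i> * of_real t)) has_vector_derivative g'
        (of_real x + \<i> * of_real t)) (at x within {-d..d})"
      using field_vector_diff_chain_within by (fastforce simp: o_def)
  next
    fix x assume "x \<in> {-d..d}"
    then show "(\<lambda>\<theta>. g (of_real x + \<i> * of_real \<theta>)) integrable_on cbox 0 (2*pi)"
      by (intro integrable_continuous continuous_on_compose2[OF contg] continuous_intros) (auto simp: vstrip_def)
  next
    show "continuous_on ({-d..d} \<times> cbox 0 (2*pi)) (\<lambda>(x, t). g' (of_real x + \<i> * of_real t))"
      unfolding split_beta by (intro continuous_on_compose2[OF contg'] continuous_intros) (auto simp: vstrip_def)
  qed auto
  moreover have "integral (cbox 0 (2*pi)) (\<lambda>\<theta>. g' (of_real \<sigma> + \<i> * of_real \<theta>)) = 0"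
      if "\<sigma> \<in> {-d..d}" for \<sigma>
  proof -
    have \<sigma>: "\<bar>\<sigma>\<bar> \<le> d" using that by auto
    have "integral {0..2*pi} (\<lambda>\<theta>. g' (of_real \<sigma> + \<i> * of_real \<theta>))
        = fourier_coeff Y n \<sigma> - of_int n * fourier_coeff X n \<sigma>"
      unfolding g'_def by (rule integral_combine_fourier_coeff[OF contX Y \<sigma>])
    then show ?thesis using fourier_coeff_derivative[OF X per Y \<sigma>] by simp
  qed
  ultimately have "((\<lambda>\<sigma>. fourier_coeff X n \<sigma>) has_vector_derivative 0)
      (at \<sigma> within {-d..d})" if "\<sigma> \<in> {-d..d}" for \<sigma>
    using that unfolding fourier_coeff_def g_def by simp
  then obtain c where "\<And>x. x \<in> {-d..d} \<Longrightarrow> fourier_coeff X n x = c"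
    using has_vector_derivative_zero_constant[of "{-d..d}" "fourier_coeff X n"] by auto
  moreover have "\<sigma> \<in> {-d..d}" "0 \<in> {-d..d}" using \<sigma> by auto
  ultimately show ?thesis by metis
qed

lemma symbol_algebra_continuous:
  assumes "symbol_algebra d f X" "rapid d f" "w \<notin> laurent f ` vstrip d"
  shows "continuous_on (vstrip d) (X w)"
  using symbol_algebra_derivative[OF assms(1,2)] assms(3) DERIV_continuous_on by blast

lemma symbol_algebra_coeff_shift:
  assumes "symbol_algebra d f X" "rapid d f" "w \<notin> laurent f ` vstrip d" "\<bar>\<sigma>\<bar> \<le> d"
  shows "fourier_coeff (X w) n \<sigma> = fourier_coeff (X w) n 0"
proof -
  obtain Y where Y: "symbol_algebra d f Y"
    "\<And>s. s\<in>vstrip d \<Longrightarrow> (X w has_field_derivative Y w s) (at s within vstrip d)"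
    using symbol_algebra_derivative[OF assms(1,2)] assms(3) by blast
  show ?thesis
    by (rule fourier_coeff_shift[OF Y(2) symbol_algebra_periodic[OF assms(1)]
        symbol_algebra_continuous[OF Y(1) assms(2,3)] assms(4)])
qed

lemma symbol_algebra_iterated_derivative:
  assumes X: "symbol_algebra d f X" and f: "rapid d f"
  shows "\<exists>Y. symbol_algebra d f Y
      \<and> (\<forall>w n \<sigma>. w \<notin> laurent f ` vstrip d \<longrightarrow> \<bar>\<sigma>\<bar>
          \<le> d \<longrightarrow>
    fourier_coeff (Y w) n \<sigma> = of_int n ^ m * fourier_coeff (X w) n \<sigma>)"
proof (induction m)
  case 0
  then show ?case using X by (intro exI[of _ X]) auto
next
  case (Suc m)
  then obtain Y where Y: "symbol_algebra d f Y"
    "\<And>w n \<sigma>. w \<notin> laurent f ` vstrip d \<Longrightarrow> \<bar>\<sigma>\<bar> \<le> d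
        \<Longrightarrow> fourier_coeff (Y w) n \<sigma> = of_int n ^ m * fourier_coeff (X w) n \<sigma>"
    by blast
  obtain Z where Z: "symbol_algebra d f Z"
    "\<And>w s. w \<notin> laurent f ` vstrip d \<Longrightarrow> s\<in>vstrip d
        \<Longrightarrow> (Y w has_field_derivative Z w s) (at s within vstrip d)"
    using symbol_algebra_derivative[OF Y(1) f] by blast
  have "fourier_coeff (Z w) n \<sigma> = of_int n ^ Suc m * fourier_coeff (X w) n \<sigma>"
    if w: "w \<notin> laurent f ` vstrip d" and \<sigma>: "\<bar>\<sigma>\<bar> \<le> d" for w n \<sigma>
    using fourier_coeff_derivative[OF Z(2)[OF w] symbol_algebra_periodic[OF Y(1)]
        symbol_algebra_continuous[OF Z(1) f w] \<sigma>] Y(2)[OF w \<sigma>]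
    by simp
  then show ?case using Z(1) by blast
qed

lemma norm_fourier_coeff_le:
  assumes X: "continuous_on (vstrip d) X" and \<sigma>: "\<bar>\<sigma>\<bar> \<le> d"
      and C: "\<And>s. s \<in> vstrip d \<Longrightarrow> norm (X s) \<le> C"
  shows "norm (fourier_coeff X n \<sigma>) \<le> 2 * pi * C * exp (- real_of_int n * \<sigma>)"
proof -
  have "norm (fourier_coeff X n \<sigma>) \<le> C * exp (- real_of_int n * \<sigma>) * (2 * pi - 0)"
    unfolding fourier_coeff_def
  proof (rule integral_bound)
    fix t
    have "norm (X (of_real \<sigma> + \<i> * of_real t)) \<le> C" using C vertical_line_in_vstrip[OF \<sigma>]
        by blast
    then show "norm (X (of_real \<sigma> + \<i> * of_real t)
        * exp (- of_int n * (of_real \<sigma> + \<i> * of_real t))) \<le> C * exp (- real_of_int n * \<sigma>)"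
      by (simp add: norm_mult mult_right_mono)
  next
    show "continuous_on {0..2*pi} (\<lambda>t. X (of_real \<sigma> + \<i> * of_real t)
        * exp (- of_int n * (of_real \<sigma> + \<i> * of_real t)))"
      by (rule continuous_on_vertical_line[OF X \<sigma>])
  qed simp
  then show ?thesis by (simp add: mult_ac)
qed

definition inverse_coeff :: "(int \<Rightarrow> complex) \<Rightarrow> complex \<Rightarrow> int \<Rightarrow>
    complex" where
  "inverse_coeff f w n = fourier_coeff (\<lambda>s. 1 / (laurent f s - w)) n 0 / (2 * of_real pi)"

text \<open>
  Compute the coefficient on the boundary line \<open>Re s = \<plusminus> d\<close> that favours the sign of \<open>n\<close>; this gives the
  factor \<open>e\<^sup>-\<^sup>d\<^sup>|\<^sup>n\<^sup>|\<close>. Every integration by parts gains one power of \<open>n\<close>. The constant is uniform over a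
  set of \<open>w\<close> at positive distance from the range, which is needed for holomorphy in \<open>w\<close>.
\<close>
lemma inverse_coeff_decay:
  assumes f: "rapid d f" and d: "0 \<le> d" and \<epsilon>: "0 < \<epsilon>"
    and B: "\<And>w s. w \<in> B \<Longrightarrow> s \<in> vstrip d
        \<Longrightarrow> \<epsilon> \<le> norm (laurent f s - w)"
  shows "\<exists>C. \<forall>w\<in>B. \<forall>n. norm (inverse_coeff f w n) \<le> rdec C m d n"
proof -
  let ?R = "\<lambda>w s. 1 / (laurent f s - w)"
  have R: "symbol_algebra d f ?R" by (rule symbol_algebra.resolvent)
  have Bw: "w \<notin> laurent f ` vstrip d" if "w \<in> B" for w
    using B[OF that] \<epsilon> by fastforce
  obtain Y where Y: "symbol_algebra d f Y"
    "\<And>w n \<sigma>. w \<notin> laurent f ` vstrip d \<Longrightarrow> \<bar>\<sigma>\<bar> \<le> d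
        \<Longrightarrow> fourier_coeff (Y w) n \<sigma> = of_int n ^ m * fourier_coeff (?R w) n \<sigma>"
    using symbol_algebra_iterated_derivative[OF R f] by blast
  have "\<exists>C. \<forall>w\<in>B. \<forall>s\<in>vstrip d. norm (?R w s) \<le> C"
    by (rule symbol_algebra_bounded[OF R \<epsilon>]) (rule B)
  then obtain C0 where C0: "\<And>w s. w \<in> B \<Longrightarrow> s \<in> vstrip d
      \<Longrightarrow> norm (?R w s) \<le> C0"
    by blast
  have "\<exists>C. \<forall>w\<in>B. \<forall>s\<in>vstrip d. norm (Y w s) \<le> C"
    by (rule symbol_algebra_bounded[OF Y(1) \<epsilon>]) (rule B)
  then obtain C1 where C1: "\<And>w s. w \<in> B \<Longrightarrow> s \<in> vstrip d
      \<Longrightarrow> norm (Y w s) \<le> C1"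
    by blast
  have "norm (inverse_coeff f w n) \<le> 2^m * (C0 + C1) * exp (- d * iabs n) / (1 + iabs n) ^ m"
    if w: "w \<in> B" for w n
  proof -
    \<comment> \<open>On this line \<open>\<bar>e\<^sup>-\<^sup>n\<^sup>s\<bar> = e\<^sup>-\<^sup>d\<^sup>|\<^sup>n\<^sup>|\<close>.\<close>
    define \<sigma> where "\<sigma> = (if n < 0 then - d else d)"
    have \<sigma>: "\<bar>\<sigma>\<bar> \<le> d" "real_of_int n * \<sigma> = d * iabs n" using d
        by (auto simp: \<sigma>_def)
    let ?a = "fourier_coeff (?R w) n 0" and ?e = "exp (- d * iabs n)"
    have a: "?a = fourier_coeff (?R w) n \<sigma>"
      using symbol_algebra_coeff_shift[OF R f Bw[OF w] \<sigma>(1)] by simp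
    have 0: "norm ?a \<le> 2 * pi * C0 * ?e"
      unfolding a using norm_fourier_coeff_le[OF symbol_algebra_continuous[OF R f Bw[OF w]] \<sigma>(1) C0[OF w], of
          n] \<sigma>(2) by simp
    have 1: "iabs n^m * norm ?a \<le> 2 * pi * C1 * ?e"
      unfolding a using norm_fourier_coeff_le[OF symbol_algebra_continuous[OF Y(1) f Bw[OF w]] \<sigma>(1) C1[OF w],
          of n] \<sigma>(2)
        Y(2)[OF Bw[OF w] \<sigma>(1)] by (simp add: norm_mult norm_power)
    have "(1 + iabs n)^m \<le> 2^m * (1 + iabs n^m)"
    proof (cases "n = 0")
      case False
      then have "1 \<le> iabs n" by linarith
      then have "(1 + iabs n)^m \<le> (2 * iabs n)^m" by (intro power_mono) auto
      also have "\<dots> = 2^m * iabs n^m" by (rule power_mult_distrib)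
      also have "\<dots> \<le> 2^m * (1 + iabs n^m)" by (intro mult_left_mono) auto
      finally show ?thesis .
    next
      case True
      have "(1::real) \<le> 2^m * 1" by simp
      also have "\<dots> \<le> 2^m * (1 + iabs n^m)" by (intro mult_left_mono) auto
      finally show ?thesis using True by simp
    qed
    then have "norm ?a * (1 + iabs n)^m \<le> norm ?a * (2^m * (1 + iabs n^m))"
      by (intro mult_left_mono) auto
    also have "\<dots> = 2^m * (norm ?a + iabs n^m * norm ?a)" by (simp add: algebra_simps)
    also have "\<dots> \<le> 2^m * (2 * pi * C0 * ?e + 2 * pi * C1 * ?e)"
      by (intro mult_left_mono add_mono 0 1) auto
    finally have "norm ?a * (1 + iabs n)^m \<le> 2 * pi * (2^m * (C0 + C1) * ?e)"
      by (simp add: algebra_simps)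
    moreover have "0 < (1 + iabs n)^m" by (intro zero_less_power) auto
    moreover have "norm (inverse_coeff f w n) = norm ?a / (2 * pi)"
      by (simp add: inverse_coeff_def norm_divide norm_mult)
    ultimately show ?thesis
      by (simp add: pos_le_divide_eq pos_divide_le_eq mult.commute mult.left_commute)
  qed
  then show ?thesis by blast
qed

lemma has_sum_fourier_integral:
  assumes f: "rapid d f" "0 \<le> d" and h: "continuous_on {0..2*pi} h"
  shows "((\<lambda>l. f l * integral {0..2*pi}
      (\<lambda>\<theta>. h \<theta> * exp (of_int l * (\<i> * of_real \<theta>)))) has_sum
     integral {0..2*pi} (\<lambda>\<theta>. h \<theta> * laurent f (\<i> * of_real \<theta>))) UNIV"
proof -
  have v: "\<i> * of_real \<theta> \<in> vstrip d" for \<theta> using f(2) by (simp add: vstrip_def)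
  obtain M where "\<forall>x\<in>h ` {0..2*pi}. norm x \<le> M"
    using compact_imp_bounded[OF compact_continuous_image[OF h compact_Icc]] unfolding bounded_iff ..
  then have M: "norm (h \<theta>) \<le> M" if "\<theta> \<in> {0..2*pi}" for \<theta>
    using that by blast
  have M0: "0 \<le> M" using M[of 0] norm_ge_zero[of "h 0"] by (simp del: norm_ge_zero)
  have "uniform_limit {0..2*pi} (\<lambda>L \<theta>. \<Sum>l\<in>L. h \<theta>
      * (f l * exp (of_int l * (\<i> * of_real \<theta>))))
     (\<lambda>\<theta>. h \<theta> * laurent f (\<i> * of_real \<theta>)) (finite_subsets_at_top UNIV)"
  proof (rule Weierstrass_m_test_general'[where M = "\<lambda>l. M * (norm (f l) * exp (d * iabs l))"])
    fix l \<theta> assume "\<theta> \<in> {0..2*pi}"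
    then show "norm (h \<theta> * (f l * exp (of_int l * (\<i> * of_real \<theta>))))
        \<le> M * (norm (f l) * exp (d * iabs l))"
      unfolding norm_mult[of "h \<theta>"] by (intro mult_mono M norm_laurent_term_le v M0) auto
  next
    fix \<theta>
    show "((\<lambda>l. h \<theta> * (f l * exp (of_int l * (\<i> * of_real \<theta>))))
        has_sum h \<theta> * laurent f (\<i> * of_real \<theta>)) UNIV"
      by (rule has_sum_cmult_right[OF laurent_has_sum[OF f(1) v]])
  next
    show "(\<lambda>l. M * (norm (f l) * exp (d * iabs l))) summable_on UNIV"
      by (rule summable_on_cmult_right[OF rapid_summable_exp[OF f(1)]])
  qed
  then obtain I J where IJ: "\<And>L. ((\<lambda>\<theta>. \<Sum>l\<in>L. h \<theta>
      * (f l * exp (of_int l * (\<i> * of_real \<theta>)))) has_integral I L) {0..2*pi}"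
    "((\<lambda>\<theta>. h \<theta> * laurent f (\<i> * of_real \<theta>)) has_integral J) {0..2*pi}"
        "(I \<longlongrightarrow> J) (finite_subsets_at_top UNIV)"
    by (rule uniform_limit_integral) (auto intro!: continuous_intros h)
  have "I L = (\<Sum>l\<in>L. f l * integral {0..2*pi}
      (\<lambda>\<theta>. h \<theta> * exp (of_int l * (\<i> * of_real \<theta>))))" if "finite L" for L
  proof -
    have "((\<lambda>\<theta>. \<Sum>l\<in>L. f l * (h \<theta> * exp (of_int l * (\<i> * of_real \<theta>))))
        has_integral
      (\<Sum>l\<in>L. f l * integral {0..2*pi}
          (\<lambda>\<theta>. h \<theta> * exp (of_int l * (\<i> * of_real \<theta>))))) {0..2*pi}"
      by (intro has_integral_sum that has_integral_mult_right integrable_integral integrable_continuous_interval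
          continuous_intros h)
    then show ?thesis using IJ(1)[of L] by (simp add: mult_ac has_integral_unique)
  qed
  then have "\<forall>\<^sub>F L in finite_subsets_at_top UNIV. I L
      = (\<Sum>l\<in>L. f l * integral {0..2*pi}
          (\<lambda>\<theta>. h \<theta> * exp (of_int l * (\<i> * of_real \<theta>))))"
    by (intro eventually_finite_subsets_at_top_weakI) auto
  from tendsto_cong[OF this] show ?thesis unfolding has_sum_def using IJ(2,3) integral_unique by blast
qed

text \<open>
  The coefficients of \<open>1 / (laurent f - w)\<close> form a convolution inverse of \<open>f - w \<delta>\<close>. Integrating the
  pointwise identity against characters gives this directly, with no inversion theorem for Fourier
  series.
\<close>
lemma inverse_coeff_convolution:
  assumes f: "rapid d f" "0 \<le> d" and w: "w \<notin> laurent f ` vstrip d"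
  shows "((\<lambda>l. f l * inverse_coeff f w (n - l)) has_sum (of_bool (n = 0) + w * inverse_coeff f w n)) UNIV"
proof -
  define h where "h = (\<lambda>\<theta>. 1 / (laurent f (\<i> * of_real \<theta>) - w)
      * exp (- of_int n * (\<i> * of_real \<theta>)))"
  have R: "symbol_algebra d f (\<lambda>w s. 1 / (laurent f s - w))" by (rule symbol_algebra.resolvent)
  have d: "\<bar>0\<bar> \<le> d" using f(2) by simp
  have h: "continuous_on {0..2*pi} h"
    using continuous_on_vertical_line[OF symbol_algebra_continuous[OF R f(1) w] d] unfolding h_def by simp
  have c1: "integral {0..2*pi} (\<lambda>\<theta>. h \<theta> * exp (of_int l * (\<i> * of_real \<theta>)))
      = 2 * of_real pi * inverse_coeff f w (n - l)" for l
  proof -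
    have "exp (- of_int n * x) * exp (of_int l * x) = exp (- of_int (n - l) * (of_real 0 + x))" for x :: complex
      unfolding mult_exp_exp by (simp add: left_diff_distrib)
    then show ?thesis
      unfolding inverse_coeff_def h_def fourier_coeff_def by (simp only: mult.assoc) simp
  qed
  have e: "integral {0..2*pi} (\<lambda>\<theta>. exp (- of_int n * (\<i> * of_real \<theta>)))
      = 2 * of_real pi * of_bool (n = 0)"
  proof (cases "n = 0")
    case False
    have "fourier_coeff (\<lambda>_. 0) n 0 = of_int n * fourier_coeff (\<lambda>_. 1) n 0"
      by (rule fourier_coeff_derivative[where d = d]) (use d in auto)
    then show ?thesis using False by (simp add: fourier_coeff_def)
  qed (simp add: scaleR_conv_of_real)
  have "h \<theta> * laurent f (\<i> * of_real \<theta>)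
      = exp (- of_int n * (\<i> * of_real \<theta>)) + w * h \<theta>" for \<theta>
  proof -
    have "laurent f (\<i> * of_real \<theta>) - w \<noteq> 0" using w f(2) by (auto simp: vstrip_def)
    then show ?thesis by (simp add: h_def field_simps)
  qed
  then have "integral {0..2*pi} (\<lambda>\<theta>. h \<theta> * laurent f (\<i> * of_real \<theta>))
     = integral {0..2*pi} (\<lambda>\<theta>. exp (- of_int n * (\<i> * of_real \<theta>))) + w
         * integral {0..2*pi} h"
    by (simp del: exp_minus)
       (intro integral_unique has_integral_add has_integral_mult_right integrable_integral
        integrable_continuous_interval continuous_intros h)
  also have "integral {0..2*pi} h = 2 * of_real pi * inverse_coeff f w n" using c1[of 0] by simp
  finally have "((\<lambda>l. f l * (2 * of_real pi * inverse_coeff f w (n - l))) has_sum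
     (2 * of_real pi * (of_bool (n = 0) + w * inverse_coeff f w n))) UNIV"
    using has_sum_fourier_integral[OF f h] unfolding c1 e by (simp add: algebra_simps)
  note has_sum_cmult_right[OF this, of "1 / (2 * of_real pi)"]
  moreover have "1 / (2 * of_real pi) * (f l * (2 * of_real pi * inverse_coeff f w (n - l)))
      = f l * inverse_coeff f w (n - l)" for l
    by simp
  moreover have "1 / (2 * of_real pi) * (2 * of_real pi * x) = x" for x :: complex by simp
  ultimately show ?thesis by (simp only:)
qed

text \<open>
  By periodicity a compact rectangle already has the same image.
\<close>
lemma compact_laurent_image:
  assumes "rapid d f"
  shows "compact (laurent f ` vstrip d)"
proof -
  define Q where "Q = {s. Re s \<in> {-d..d} \<and> Im s \<in> {0..2*pi}}"
  have "Q = cbox (Complex (-d) 0) (Complex d (2*pi))" by (auto simp: Q_def in_cbox_complex_iff)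
  then have "compact Q" by simp
  have "laurent f s \<in> laurent f ` Q" if s: "s \<in> vstrip d" for s
  proof -
    define k where "k = \<lfloor>Im s / (2*pi)\<rfloor>"
    define s' where "s' = s + of_int (- k) * (2 * of_real pi * \<i>)"
    have "laurent f s' = laurent f s" unfolding s'_def by (rule laurent_periodic)
    moreover have "real_of_int k * (2*pi) \<le> Im s" "Im s \<le> real_of_int k * (2*pi) + 2*pi"
      using floor_divide_lower[of "2*pi" "Im s"] floor_divide_upper[of "2*pi" "Im s"]
      by (simp_all add: k_def distrib_right)
    then have "s' \<in> Q" using s by (auto simp: s'_def Q_def vstrip_def)
    ultimately show ?thesis by (metis imageI)
  qed
  moreover have "Q \<subseteq> vstrip d" by (auto simp: Q_def vstrip_def)
  ultimately have "laurent f ` vstrip d = laurent f ` Q" by blast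
  then show ?thesis
    using compact_continuous_image[OF continuous_on_subset[OF continuous_on_laurent[OF assms] \<open>Q \<subseteq>
        vstrip d\<close>] \<open>compact Q\<close>]
    by simp
qed

lemma laurent_divide:
  assumes "rapid d f" "s \<in> vstrip d"
  shows "laurent (\<lambda>l. f l / A) s = laurent f s / A"
proof -
  have "((\<lambda>l. 1 / A * (f l * exp (of_int l * s))) has_sum 1 / A * laurent f s) UNIV"
    by (rule has_sum_cmult_right[OF laurent_has_sum[OF assms]])
  then show ?thesis by (simp add: laurent_def infsumI)
qed

lemma rapid_divide:
  assumes "rapid d f"
  shows "rapid d (\<lambda>l. f l / A)"
  unfolding rapid_def
proof
  fix m
  obtain C where C: "\<And>l. norm (f l) \<le> rdec C m d l"
    using rapid_bound[OF assms] by metis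
  have "norm (f l / A) \<le> rdec (C / norm A) m d l" for l
    using divide_right_mono[OF C[of l] norm_ge_zero[of A]] by (simp add: norm_divide mult_ac)
  then show "\<exists>C. \<forall>l. norm (f l / A) \<le> rdec C m d l" by blast
qed

section \<open>Orbits of sequences with exponential weight\<close>

lemma rapid_inverse_coeff:
  assumes f: "rapid d f" "0 \<le> d" and w: "w \<notin> laurent f ` vstrip d"
  shows "rapid d (inverse_coeff f w)"
proof -
  have "open (- (laurent f ` vstrip d))"
    by (rule open_Compl[OF compact_imp_closed[OF compact_laurent_image[OF f(1)]]])
  moreover have "w \<in> - (laurent f ` vstrip d)" using w by simp
  ultimately obtain \<epsilon> where \<epsilon>: "0 < \<epsilon>" "ball w \<epsilon> \<subseteq>
      - (laurent f ` vstrip d)"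
    using openE by blast
  have far: "\<epsilon> \<le> norm (laurent f s - w')" if "w' \<in> {w}" "s \<in> vstrip d" for w' s
  proof (rule ccontr)
    assume "\<not> ?thesis"
    moreover have "w' = w" using that(1) by simp
    ultimately have "norm (w - laurent f s) < \<epsilon>" by (simp add: norm_minus_commute[of w])
    then have "laurent f s \<in> ball w \<epsilon>" unfolding mem_ball dist_norm .
    from subsetD[OF \<epsilon>(2) this] have "laurent f s \<notin> laurent f ` vstrip d" by (rule ComplD)
    then show False using that(2) by simp
  qed
  show ?thesis
    unfolding rapid_def
  proof
    fix m
    have "\<exists>C. \<forall>w'\<in>{w}. \<forall>n. norm (inverse_coeff f w' n) \<le> rdec C m d n"
      using far by (rule inverse_coeff_decay[OF f \<epsilon>(1)])
    then show "\<exists>C. \<forall>n. norm (inverse_coeff f w n) \<le> rdec C m d n"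
      by blast
  qed
qed

lemma growth_add_le:
  assumes "0 \<le> d"
  shows "pexp N d (n + l)
    \<le> pexp N d n * pexp N d l"
proof -
  have t: "iabs (n + l) \<le> iabs n + iabs l" by simp
  have "1 + iabs (n + l) \<le> (1 + iabs n) * (1 + iabs l)"
  proof -
    have "(1 + iabs n) * (1 + iabs l) = 1 + iabs n + iabs l + iabs n * iabs l"
      by (simp add: algebra_simps)
    moreover have "0 \<le> iabs n * iabs l" by simp
    ultimately show ?thesis using t by linarith
  qed
  then have "(1 + iabs (n + l)) ^ N \<le> ((1 + iabs n) * (1 + iabs l)) ^ N"
    by (intro power_mono) auto
  moreover have "exp (d * iabs (n + l)) \<le> exp (d * iabs n) * exp (d * iabs l)"
    unfolding mult_exp_exp exp_le_cancel_iff using mult_left_mono[OF t assms] unfolding distrib_left .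
  ultimately have "pexp N d (n + l)
    \<le> ((1 + iabs n) * (1 + iabs l)) ^ N * (exp (d * iabs n) * exp (d * iabs l))"
    by (intro mult_mono) auto
  then show ?thesis unfolding power_mult_distrib by (simp only: mult_ac)
qed

lemma rapid_has_sum:
  assumes "rapid d f" "\<And>l. norm (g l) \<le> C * pexp N d l"
  shows "((\<lambda>l. f l * g l) has_sum (\<Sum>\<^sub>\<infinity>l. f l * g l)) UNIV"
  using has_sum_infsum[OF Infinite_Sum.abs_summable_summable, of "\<lambda>l. f l * g l"] rapid_abs_summable[OF assms]
  unfolding norm_mult by blast

lemma summable_on_product_nonneg:
  fixes a :: "'i \<Rightarrow> real" and b :: "'j \<Rightarrow> real"
  assumes "a summable_on A" "b summable_on B" "\<And>x. 0 \<le> a x" "\<And>y. 0 \<le> b y"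
  shows "(\<lambda>(x, y). a x * b y) summable_on A \<times> B"
proof (rule summable_on_SigmaI)
  fix x
  show "((\<lambda>y. case (x, y) of (x, y) \<Rightarrow> a x * b y) has_sum a x * infsum b B) B"
    using has_sum_cmult_right[OF has_sum_infsum[OF assms(2)]] by simp
qed (use assms in \<open>auto intro!: summable_on_cmult_left\<close>)

text \<open>
  If convolution with \<open>f\<close> moves \<open>\<tau> k\<close> to \<open>\<tau> (k + 1)\<close>, pairing with the inverse of \<open>f - w \<delta>\<close> solves the
  equation \<open>u\<^sub>k = v\<^sub>k\<^sub>+\<^sub>1 - w v\<^sub>k\<close> for \<open>u\<^sub>k = \<tau> k 0\<close>.
\<close>
lemma resolvent_pairing:
  fixes \<tau> :: "int \<Rightarrow> int \<Rightarrow> complex"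
  assumes f: "rapid d f" "0 \<le> d" and w: "w \<notin> laurent f ` vstrip d"
    and \<tau>: "\<And>n. norm (\<tau> k n) \<le> C * pexp N d n"
      "\<And>n. norm (\<tau> (k + 1) n) \<le> C * pexp N d n"
    and rec: "\<And>n. ((\<lambda>l. f l * \<tau> k (n + l)) has_sum \<tau> (k + 1) n) UNIV"
  shows "\<tau> k 0 = (\<Sum>\<^sub>\<infinity>n. inverse_coeff f w n * \<tau> (k + 1) n) - w
      * (\<Sum>\<^sub>\<infinity>n. inverse_coeff f w n * \<tau> k n)"
proof -
  define a where "a = inverse_coeff f w"
  have a: "rapid d a" unfolding a_def by (rule rapid_inverse_coeff[OF f w])
  have C0: "0 \<le> C" using \<tau>(1)[of 0] norm_ge_zero[of "\<tau> k 0"] by (simp del: norm_ge_zero)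
  define G where "G = (\<lambda>n::int. pexp N d n)"
  define g where "g = (\<lambda>(n, l). a n * (f l * \<tau> k (n + l)))"
  have G0: "0 \<le> G n" for n by (simp add: G_def)
  have bound: "norm (complex_of_real (G n)) \<le> 1 * pexp N d n" for n
    unfolding norm_of_real abs_of_nonneg[OF G0] by (simp add: G_def)
  have sum1: "(\<lambda>n. norm (a n) * G n) summable_on UNIV"
    using rapid_abs_summable[OF a bound] G0 by (simp add: abs_of_nonneg)
  have sum2: "(\<lambda>n. norm (f n) * G n) summable_on UNIV"
    using rapid_abs_summable[OF f(1) bound] G0 by (simp add: abs_of_nonneg)
  have "(\<lambda>x. C * (case x of (n,l) \<Rightarrow> (norm (a n) * G n) * (norm (f l) * G l))) summable_on UNIV
      \<times> UNIV"
    by (intro summable_on_cmult_right summable_on_product_nonneg sum1 sum2) (use G0 in auto)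
  then have "(\<lambda>x. norm (g x)) summable_on UNIV \<times> UNIV"
  proof (rule Infinite_Sum.abs_summable_on_comparison_test')
    fix x :: "int \<times> int"
    obtain n l where x: "x = (n, l)" by fastforce
    have "norm (\<tau> k (n + l)) \<le> C * (G n * G l)"
      using \<tau>(1)[of "n + l"] mult_left_mono[OF growth_add_le[OF f(2), of n l N] C0] unfolding G_def by linarith
    then have "norm (a n * f l) * norm (\<tau> k (n + l)) \<le> norm (a n * f l) * (C * (G n * G l))"
      by (intro mult_left_mono) auto
    then show "norm (g x) \<le> C * (case x of (n,l) \<Rightarrow> (norm (a n) * G n) * (norm (f l) * G l))"
      by (simp add: x g_def norm_mult mult_ac)
  qed
  then have S: "(g has_sum S) (UNIV \<times> UNIV)" if "S = infsum g (UNIV \<times> UNIV)" for S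
    unfolding that by (rule has_sum_infsum[OF Infinite_Sum.abs_summable_summable])
  define S where "S = infsum g (UNIV \<times> UNIV)"
  note S = S[OF S_def]
  have "((\<lambda>n. a n * \<tau> (k + 1) n) has_sum S) UNIV"
    using S by (rule has_sum_Sigma') (auto simp: g_def intro!: has_sum_cmult_right rec)
  then have S1: "S = (\<Sum>\<^sub>\<infinity>n. a n * \<tau> (k + 1) n)" by (simp add: infsumI)
  have S': "((\<lambda>(j, l). g (j - l, l)) has_sum S) (UNIV \<times> UNIV)"
    using S has_sum_reindex_bij_witness[of "UNIV \<times> UNIV" "\<lambda>(j, l). (j - l, l)" "\<lambda>(n, l).
        (n + l, l)"
        "UNIV \<times> UNIV" "\<lambda>(j, l). g (j - l, l)" g S S] by auto
  have S2: "((\<lambda>j. (of_bool (j = 0) + w * a j) * \<tau> k j) has_sum S) UNIV"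
    using S'
  proof (rule has_sum_Sigma')
    fix j :: int
    show "((\<lambda>l. case (j, l) of (j, l) \<Rightarrow> g (j - l, l))
        has_sum (of_bool (j = 0) + w * a j) * \<tau> k j) UNIV"
      using has_sum_cmult_left[OF inverse_coeff_convolution[OF f w, of j], of "\<tau> k j"]
      by (simp add: g_def a_def mult_ac)
  qed
  have "((\<lambda>j. w * (a j * \<tau> k j)) has_sum w * (\<Sum>\<^sub>\<infinity>n. a n * \<tau> k n)) UNIV"
    by (rule has_sum_cmult_right[OF rapid_has_sum[OF a \<tau>(1)]])
  moreover have "((\<lambda>j. of_bool (j = 0) * \<tau> k j) has_sum \<tau> k 0) UNIV"
    using has_sum_finite_neutralI[of "{0::int}" UNIV "\<lambda>j. of_bool (j = 0) * \<tau> k j"] by simp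
  ultimately have "((\<lambda>j. w * (a j * \<tau> k j) + of_bool (j = 0) * \<tau> k j)
      has_sum (w * (\<Sum>\<^sub>\<infinity>n. a n * \<tau> k n) + \<tau> k 0)) UNIV"
    by (rule has_sum_add)
  then have "((\<lambda>j. (of_bool (j = 0) + w * a j) * \<tau> k j)
      has_sum (w * (\<Sum>\<^sub>\<infinity>n. a n * \<tau> k n) + \<tau> k 0)) UNIV"
    by (simp add: distrib_right add.commute mult.assoc)
  then have "S = w * (\<Sum>\<^sub>\<infinity>n. a n * \<tau> k n) + \<tau> k 0" using S2 has_sum_unique by blast
  then show ?thesis using S1 by (simp add: a_def)
qed

text \<open>
  Each coefficient is an integral that depends holomorphically on \<open>w\<close>, and \<open>inverse_coeff_decay\<close> gives
  locally uniform convergence.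
\<close>
lemma resolvent_pairing_holomorphic:
  fixes t :: "int \<Rightarrow> complex"
  assumes f: "rapid d f" "0 \<le> d"
    and t: "\<And>n. norm (t n) \<le> C * pexp N d n"
  shows "(\<lambda>w. \<Sum>\<^sub>\<infinity>n. inverse_coeff f w n * t n) holomorphic_on - (laurent f ` vstrip d)"
proof -
  define V where "V = - (laurent f ` vstrip d)"
  have "open V" unfolding V_def by (rule open_Compl[OF compact_imp_closed[OF compact_laurent_image[OF f(1)]]])
  have C0: "0 \<le> C" using t[of 0] norm_ge_zero[of "t 0"] by (simp del: norm_ge_zero)
  have v: "\<i> * of_real \<theta> \<in> vstrip d" for \<theta> using f(2) by (simp add: vstrip_def)
  have coeff: "(\<lambda>w. inverse_coeff f w n) holomorphic_on U" if U: "U \<subseteq> V" "convex U" for U n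
  proof -
    have nz: "laurent f (\<i> * of_real \<theta>) - w \<noteq> 0" if "w \<in> U" for w \<theta>
      using U(1) that v by (auto simp: V_def)
    have contL: "continuous_on A (\<lambda>x. laurent f (\<i> * of_real (g x)))" if "continuous_on A g"
        for A :: "'z::topological_space set" and g
      by (intro continuous_on_compose2[OF continuous_on_laurent[OF f(1)]] continuous_intros that) (use v in auto)
    have "(\<lambda>w. integral (cbox 0 (2*pi))
        (\<lambda>\<theta>. 1 / (laurent f (\<i> * of_real \<theta>) - w)
            * exp (- of_int n * (\<i> * of_real \<theta>)))) holomorphic_on U"
    proof (rule leibniz_rule_holomorphic[where fx
        = "\<lambda>w \<theta>. 1 / (laurent f (\<i> * of_real \<theta>) - w)^2
            * exp (- of_int n * (\<i> * of_real \<theta>))"])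
      fix w and \<theta> :: real assume "w \<in> U"
      then show "((\<lambda>w. 1 / (laurent f (\<i> * of_real \<theta>) - w)
          * exp (- of_int n * (\<i> * of_real \<theta>))) has_field_derivative
        1 / (laurent f (\<i> * of_real \<theta>) - w)^2 * exp (- of_int n * (\<i> * of_real \<theta>)))
            (at w within U)"
        using nz by (auto intro!: derivative_eq_intros simp: power2_eq_square)
    next
      fix w assume "w \<in> U"
      then show "(\<lambda>\<theta>. 1 / (laurent f (\<i> * of_real \<theta>) - w)
          * exp (- of_int n * (\<i> * of_real \<theta>))) integrable_on cbox 0 (2*pi)"
        using nz by (intro integrable_continuous continuous_intros contL) auto
    next
      show "continuous_on (U \<times> cbox 0 (2*pi))
          (\<lambda>(w, \<theta>). 1 / (laurent f (\<i> * of_real \<theta>) - w)^2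
              * exp (- of_int n * (\<i> * of_real \<theta>)))"
        unfolding split_beta using nz by (intro continuous_intros contL) auto
    qed (rule U(2))
    then show ?thesis unfolding inverse_coeff_def fourier_coeff_def by (intro holomorphic_intros) simp_all
  qed
  have "(\<lambda>w. \<Sum>\<^sub>\<infinity>n. inverse_coeff f w n * t n) field_differentiable (at w0)"
      if w0: "w0 \<in> V" for w0
  proof -
    obtain r where r: "0 < r" "ball w0 r \<subseteq> V" using \<open>open V\<close> w0 openE by blast
    define B where "B = cball w0 (r/2)"
    have BV: "B \<subseteq> V" using r by (auto simp: B_def)
    have far: "r/2 \<le> norm (laurent f s - w)" if "w \<in> B" "s \<in> vstrip d" for w s
    proof (rule ccontr)
      assume "\<not> ?thesis"
      then have "dist w0 (laurent f s) < r"
        using that(1) dist_triangle[of w0 "laurent f s" w] by (simp add: B_def dist_norm norm_minus_commute)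
      then have "laurent f s \<in> V" using r(2) by (simp add: subset_iff)
      then show False using that(2) by (simp add: V_def)
    qed
    have "\<exists>K. \<forall>w\<in>B. \<forall>n. norm (inverse_coeff f w n) \<le> rdec K (N + 2) d n"
      by (rule inverse_coeff_decay[OF f _ far]) (use r in auto)
    then obtain K where K: "\<And>w n. w \<in> B
        \<Longrightarrow> norm (inverse_coeff f w n) \<le> rdec K (N + 2) d n"
      by blast
    have ul: "uniform_limit B (\<lambda>L w. \<Sum>n\<in>L. inverse_coeff f w n * t n)
        (\<lambda>w. \<Sum>\<^sub>\<infinity>n. inverse_coeff f w n * t n) (finite_subsets_at_top UNIV)"
    proof (rule Weierstrass_m_test_general)
      show "(\<lambda>n::int. (K * C) * (1 / (1 + iabs n)^2)) summable_on UNIV"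
        by (intro summable_on_cmult_right summable_on_int_inverse_square)
      fix n w assume w: "w \<in> B"
      define s where "s = 1 + iabs n"
      have s: "0 < s" by (simp add: s_def add_pos_nonneg)
      have "norm (inverse_coeff f w n * t n)
          \<le> (K * exp (- d * iabs n) / s ^ (N + 2)) * (C * (s ^ N * exp (d * iabs n)))"
        unfolding norm_mult s_def using order_trans[OF norm_ge_zero K[OF w]]
        by (intro mult_mono K w t) auto
      also have "\<dots> = (K * C) * (1 / s^2)"
        using s by (simp add: exp_minus power_add divide_simps power2_eq_square)
      finally show "norm (inverse_coeff f w n * t n) \<le> (K * C) * (1 / (1 + iabs n)^2)" by (simp add: s_def)
    qed
    have "(\<lambda>w. \<Sum>n\<in>L. inverse_coeff f w n * t n) holomorphic_on B" for L
      by (intro holomorphic_intros coeff BV) (simp add: B_def)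
    then have "\<forall>\<^sub>F L in finite_subsets_at_top UNIV. continuous_on (cball w0 (r/2))
        (\<lambda>w. \<Sum>n\<in>L. inverse_coeff f w n * t n)
      \<and> (\<lambda>w. \<Sum>n\<in>L. inverse_coeff f w n * t n) holomorphic_on ball w0 (r/2)"
      unfolding B_def
      by (intro always_eventually allI conjI holomorphic_on_imp_continuous_on)
         (blast, meson ball_subset_cball holomorphic_on_subset)
    then have "(\<lambda>w. \<Sum>\<^sub>\<infinity>n. inverse_coeff f w n * t n) holomorphic_on ball w0 (r/2)"
      using holomorphic_uniform_limit[OF _ ul[unfolded B_def]] by simp
    then show ?thesis using r(1) holomorphic_on_imp_differentiable_at[of _ "ball w0 (r/2)" w0] by simp
  qed
  then show ?thesis
    unfolding holomorphic_on_def V_def using field_differentiable_at_within by blast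
qed

text \<open>
  The passage from bounded scalar orbits to arrays: the second index of \<open>\<tau>\<close> is what makes the
  resolvent of the shift in \<open>k\<close> available.
\<close>
theorem weighted_orbit_finite_spectrum:
  fixes \<tau> :: "int \<Rightarrow> int \<Rightarrow> complex"
  assumes f: "rapid d f" "0 \<le> d"
    and \<tau>: "\<And>k n. norm (\<tau> k n) \<le> C * pexp N d n"
    and rec: "\<And>k n. ((\<lambda>l. f l * \<tau> k (n + l)) has_sum \<tau> (k + 1) n) UNIV"
    and disc: "laurent f ` vstrip d \<subseteq> cball 0 1"
    and E: "finite E" "laurent f ` vstrip d \<inter> sphere 0 1 \<subseteq> E" "E \<subseteq> sphere 0 1"
  shows "\<exists>c. \<forall>k. \<tau> (int k) 0 = (\<Sum>e\<in>E. c e * e^k)"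
proof -
  define V where "V = - (laurent f ` vstrip d)"
  define v where "v = (\<lambda>w k. \<Sum>\<^sub>\<infinity>n. inverse_coeff f w n * \<tau> k n)"
  show ?thesis
  proof (rule bounded_orbit_finite_spectrum[where V = V and H = "\<lambda>w. v w 0" and B = C])
    show "open V" unfolding V_def by (rule open_Compl[OF compact_imp_closed[OF compact_laurent_image[OF f(1)]]])
    show "{w. 1 \<le> norm w} - E \<subseteq> V" using disc E(2) by (force simp: V_def)
    show "(\<lambda>w. v w 0) holomorphic_on V"
      unfolding V_def v_def by (rule resolvent_pairing_holomorphic[OF f \<tau>])
    show "norm (\<tau> k 0) \<le> C" for k using \<tau>[of k 0] by simp
    fix w assume "w \<in> V"
    then have w: "w \<notin> laurent f ` vstrip d" by (simp add: V_def)
    have "\<tau> k 0 = v w (k + 1) - w * v w k" for k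
      unfolding v_def by (rule resolvent_pairing[where \<tau> = \<tau>, OF f w \<tau> \<tau> rec])
    moreover have "\<exists>D. \<forall>k. norm (v w k) \<le> D"
    proof -
      let ?G = "\<lambda>n::int. C * pexp N d n"
      have C0: "0 \<le> C" using \<tau>[of 0 0] norm_ge_zero[of "\<tau> 0 0"] by (simp del: norm_ge_zero)
      have G0: "0 \<le> ?G n" for n using C0 by simp
      have "norm (complex_of_real (?G n)) \<le> C * pexp N d n" for n
        unfolding norm_of_real abs_of_nonneg[OF G0] by simp
      from rapid_abs_summable[OF rapid_inverse_coeff[OF f w] this]
      have S: "(\<lambda>n. norm (inverse_coeff f w n) * ?G n) summable_on UNIV"
        unfolding norm_of_real abs_of_nonneg[OF G0] .
      have "norm (v w k) \<le> (\<Sum>\<^sub>\<infinity>n. norm (inverse_coeff f w n) * ?G n)" for k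
        unfolding v_def
        by (rule norm_infsum_le[OF rapid_has_sum[OF rapid_inverse_coeff[OF f w] \<tau>] has_sum_infsum[OF S]])
           (auto simp: norm_mult intro!: mult_left_mono \<tau>)
      then show ?thesis by blast
    qed
    ultimately show "\<exists>v'. (\<exists>D. \<forall>k. norm (v' k) \<le> D) \<and> v' 0 = v w 0
        \<and> (\<forall>k. \<tau> k 0 = v' (k + 1) - w * v' k)"
      by (intro exI[of _ "v w"]) simp
  qed (use E in auto)
qed

section \<open>From radial coefficients to Laurent coefficients\<close>

text \<open>
  The coefficient of \<open>t\<^sup>l\<close> in \<open>t\<^sup>r + t\<^sup>-\<^sup>r + \<beta> (t\<^sup>r\<^sup>-\<^sup>2 + \<dots> + t\<^sup>2\<^sup>-\<^sup>r)\<close>, or in \<open>1\<close> if \<open>r = 0\<close>. With \<open>\<beta> = 1 - 1/q\<close> this is the symbol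
  of the normalised sphere operator of radius \<open>r\<close>.
\<close>
definition expansion_coeff :: "real \<Rightarrow> nat \<Rightarrow> int \<Rightarrow> real" where
  "expansion_coeff \<beta> r l = (if l \<in> (\<lambda>i. int r - 2 * int i) ` {..r} then
      if \<bar>l\<bar> = int r then 1 else \<beta> else 0)"

text \<open>
  The Laurent coefficients of a radial kernel whose coefficients with respect to the normalised sphere
  operators are \<open>b\<close>; on the tree this is the Abel transform.
\<close>
definition abel_transform :: "real \<Rightarrow> (nat \<Rightarrow> complex) \<Rightarrow> int \<Rightarrow> complex"
    where
  "abel_transform \<beta> b l = (\<Sum>\<^sub>\<infinity>r. b r * of_real (expansion_coeff \<beta> r l))"

lemma expansion_coeff_eq_0: "int r < \<bar>l\<bar> \<Longrightarrow> expansion_coeff \<beta> r l = 0"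
  by (auto simp: expansion_coeff_def)

lemma abs_expansion_coeff_le: "0 \<le> \<beta> \<Longrightarrow> \<beta> \<le> 1
    \<Longrightarrow> \<bar>expansion_coeff \<beta> r l\<bar> \<le> 1"
  by (auto simp: expansion_coeff_def)

lemma sum_expansion_coeff:
  fixes g :: "int \<Rightarrow> complex"
  shows "((\<lambda>l. of_real (expansion_coeff \<beta> r l) * g l) has_sum
    (\<Sum>i\<le>r. of_real (if i = 0 \<or> i = r then 1 else \<beta>) * g (int r - 2 * int i))) UNIV"
proof (rule has_sum_finite_neutralI[of "(\<lambda>i. int r - 2 * int i) ` {..r}"])
  have "inj_on (\<lambda>i. int r - 2 * int i) {..r}" by (auto intro: inj_onI)
  then have "(\<Sum>l\<in>(\<lambda>i. int r - 2 * int i) ` {..r}. of_real (expansion_coeff \<beta> r l) * g l)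
     = (\<Sum>i\<le>r. of_real (expansion_coeff \<beta> r (int r - 2 * int i)) * g (int r - 2 * int i))"
    by (simp add: sum.reindex)
  also have "\<dots> = (\<Sum>i\<le>r. of_real (if i = 0 \<or> i = r then 1 else \<beta>) * g (int r - 2 * int i))"
  proof (intro sum.cong refl)
    fix i assume i: "i \<in> {..r}"
    then have "\<bar>int r - 2 * int i\<bar> = int r \<longleftrightarrow> i = 0 \<or> i = r" by auto
    then show "of_real (expansion_coeff \<beta> r (int r - 2 * int i)) * g (int r - 2 * int i)
      = of_real (if i = 0 \<or> i = r then 1 else \<beta>) * g (int r - 2 * int i)"
      using i by (simp add: expansion_coeff_def)
  qed
  finally show "(\<Sum>i\<le>r. of_real (if i = 0 \<or> i = r then 1 else \<beta>) * g (int r - 2 * int i))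
     = (\<Sum>l\<in>(\<lambda>i. int r - 2 * int i) ` {..r}. of_real (expansion_coeff \<beta> r l) * g l)" by simp
qed (auto simp: expansion_coeff_def)

lemma rapid_abel_transform:
  assumes \<beta>: "0 \<le> \<beta>" "\<beta> \<le> 1" and d: "0 \<le> d"
    and b: "\<And>m. \<exists>C. \<forall>r. norm (b r) \<le> C * exp (- d * real r) / (1 + real r) ^ m"
  shows "rapid d (abel_transform \<beta> b)"
  unfolding rapid_def
proof
  fix m
  obtain C where C: "\<And>r. norm (b r) \<le> C * exp (- d * real r) / (1 + real r) ^ (m + 2)"
    using b by blast
  have C0: "0 \<le> C" using C[of 0] norm_ge_zero[of "b 0"] by (simp del: norm_ge_zero)
  define K where "K = (\<Sum>\<^sub>\<infinity>r::nat. 1 / (1 + real r)^2)"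
  have "norm (abel_transform \<beta> b l) \<le> rdec (C * K) m d l" for l
  proof -
    define E where "E = rdec C m d l"
    have E0: "0 \<le> E" using C0 by (simp add: E_def)
    have bound: "norm (b r * of_real (expansion_coeff \<beta> r l)) \<le> E * (1 / (1 + real r)^2)" for r
    proof (cases "int r < \<bar>l\<bar>")
      case True
      then show ?thesis using E0 by (simp add: expansion_coeff_eq_0)
    next
      case False
      then have lr: "iabs l \<le> real r" by linarith
      have "norm (b r * of_real (expansion_coeff \<beta> r l)) \<le> norm (b r) * 1"
        unfolding norm_mult norm_of_real by (intro mult_left_mono abs_expansion_coeff_le \<beta>) auto
      also have "\<dots> \<le> C * exp (- d * real r) / (1 + real r) ^ (m + 2)" using C[of r] by simp
      also have "\<dots> = (C * exp (- d * real r) / (1 + real r) ^ m) * (1 / (1 + real r)^2)"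
        by (simp add: power_add power2_eq_square)
      also have "\<dots> \<le> E * (1 / (1 + real r)^2)"
        unfolding E_def using lr d C0
        by (intro mult_right_mono frac_le mult_left_mono power_mono) (auto intro!: mult_left_mono)
      finally show ?thesis .
    qed
    have S: "(\<lambda>r::nat. E * (1 / (1 + real r)^2)) summable_on UNIV"
      by (intro summable_on_cmult_right summable_on_nat_inverse_square)
    then have "(\<lambda>r. norm (b r * of_real (expansion_coeff \<beta> r l))) summable_on UNIV"
      by (rule Infinite_Sum.abs_summable_on_comparison_test') (rule bound)
    then have "((\<lambda>r. b r * of_real (expansion_coeff \<beta> r l)) has_sum abel_transform \<beta> b l) UNIV"
      unfolding abel_transform_def by (rule has_sum_infsum[OF Infinite_Sum.abs_summable_summable])
    from norm_infsum_le[OF this has_sum_infsum[OF S] bound]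
    have "norm (abel_transform \<beta> b l) \<le> (\<Sum>\<^sub>\<infinity>r::nat. E * (1 / (1 + real r)^2))" .
    also have "\<dots> = E * K"
      unfolding K_def by (rule infsum_cmult_right) (use summable_on_nat_inverse_square in simp)
    finally show ?thesis by (simp add: E_def mult_ac)
  qed
  then show "\<exists>C. \<forall>l. norm (abel_transform \<beta> b l) \<le> rdec C m d l"
    by blast
qed

text \<open>
  Both sides are the same double series, summed in the two orders. As \<open>\<bar>l\<bar> \<le> r\<close> on the support of the
  expansion coefficients, the decay of \<open>b r\<close> pays for the growth of \<open>g l\<close> and for both summations.
\<close>
lemma abel_transform_pairing:
  assumes \<beta>: "0 \<le> \<beta>" "\<beta> \<le> 1" and d: "0 \<le> d"
    and b: "\<And>m. \<exists>C. \<forall>r. norm (b r) \<le> C * exp (- d * real r) / (1 + real r) ^ m"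
    and g: "\<And>l. norm (g l) \<le> D * pexp N d l"
    and S: "((\<lambda>r. b r * (\<Sum>i\<le>r. of_real (if i = 0 \<or> i = r then 1 else \<beta>)
        * g (int r - 2 * int i))) has_sum S) UNIV"
  shows "((\<lambda>l. abel_transform \<beta> b l * g l) has_sum S) UNIV"
proof -
  obtain C where C: "\<And>r. norm (b r) \<le> C * exp (- d * real r) / (1 + real r) ^ (N + 4)"
    using b by blast
  have C0: "0 \<le> C" using C[of 0] norm_ge_zero[of "b 0"] by (simp del: norm_ge_zero)
  have D0: "0 \<le> D" using g[of 0] norm_ge_zero[of "g 0"] by (simp del: norm_ge_zero)
  define h where "h = (\<lambda>(r, l). b r * (of_real (expansion_coeff \<beta> r l) * g l))"
  have "(\<lambda>x. (C * D) * (case x of (r::nat, l::int) \<Rightarrow> (1 / (1 + real r)^2) * (1 / (1 + iabs l)^2)))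
      summable_on UNIV \<times> UNIV"
    by (intro summable_on_cmult_right summable_on_product_nonneg summable_on_nat_inverse_square
        summable_on_int_inverse_square) auto
  then have "(\<lambda>x. norm (h x)) summable_on UNIV \<times> UNIV"
  proof (rule Infinite_Sum.abs_summable_on_comparison_test')
    fix x :: "nat \<times> int"
    obtain r l where x: "x = (r, l)" by fastforce
    show "norm (h x) \<le> (C * D) * (case x of (r::nat, l::int) \<Rightarrow> (1 / (1 + real r)^2)
        * (1 / (1 + iabs l)^2))"
    proof (cases "int r < \<bar>l\<bar>")
      case True
      then show ?thesis using C0 D0 by (simp add: x h_def expansion_coeff_eq_0)
    next
      case False
      define s where "s = 1 + real r"
      define t where "t = 1 + iabs l"
      have ts: "0 < s" "0 < t" "t \<le> s" using False by (auto simp: s_def t_def add_pos_nonneg)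
      have e: "exp (d * iabs l) \<le> exp (d * real r)" using ts(3) d by (simp add: s_def t_def mult_left_mono)
      have "norm (h x) \<le> norm (b r) * (1 * norm (g l))"
        unfolding x h_def prod.case norm_mult norm_of_real
        by (intro mult_left_mono mult_right_mono abs_expansion_coeff_le \<beta>) auto
      also have "\<dots> \<le> (C * exp (- d * real r) / s ^ (N + 4)) * (1 * (D * (s ^ N * exp (d * real r))))"
      proof (intro mult_mono)
        have "norm (g l) \<le> D * (t ^ N * exp (d * iabs l))" using g[of l] by (simp add: t_def)
        also have "\<dots> \<le> D * (s ^ N * exp (d * real r))"
          using ts e D0 by (intro mult_left_mono mult_mono power_mono) auto
        finally show "norm (g l) \<le> D * (s ^ N * exp (d * real r))" .
      qed (use C[of r] C0 ts in \<open>auto simp: s_def\<close>)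
      also have "\<dots> = (C * D) * (1 / s ^ 2 * (1 / s ^ 2))"
        using ts by (simp add: exp_minus power_add divide_simps eval_nat_numeral)
      also have "\<dots> \<le> (C * D) * (1 / s ^ 2 * (1 / t ^ 2))"
        using ts C0 D0 by (intro mult_left_mono frac_le power_mono) auto
      finally show ?thesis by (simp add: x s_def t_def)
    qed
  qed
  then have h: "(h has_sum infsum h (UNIV \<times> UNIV)) (UNIV \<times> UNIV)"
    by (rule has_sum_infsum[OF Infinite_Sum.abs_summable_summable])
  have "((\<lambda>r. b r * (\<Sum>i\<le>r. of_real (if i = 0 \<or> i = r then 1 else \<beta>)
      * g (int r - 2 * int i))) has_sum infsum h (UNIV \<times> UNIV)) UNIV"
    using h
  proof (rule has_sum_Sigma')
    fix r :: nat
    show "((\<lambda>l. h (r, l)) has_sum b r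
        * (\<Sum>i\<le>r. of_real (if i = 0 \<or> i = r then 1 else \<beta>) * g (int r - 2 * int i))) UNIV"
      unfolding h_def prod.case by (rule has_sum_cmult_right[OF sum_expansion_coeff])
  qed
  then have S': "infsum h (UNIV \<times> UNIV) = S" using S has_sum_unique by blast
  have "((\<lambda>(l, r). h (r, l)) has_sum S) (UNIV \<times> UNIV)"
    using h unfolding S' by (rule has_sum_swap[THEN iffD1])
  then show ?thesis
  proof (rule has_sum_Sigma')
    fix l :: int
    obtain C1 where C1: "\<And>r. norm (b r) \<le> C1 * exp (- d * real r) / (1 + real r) ^ 2" using b by blast
    have "(\<lambda>r::nat. C1 * (1 / (1 + real r)^2)) summable_on UNIV"
      by (intro summable_on_cmult_right summable_on_nat_inverse_square)
    then have "(\<lambda>r. norm (b r * of_real (expansion_coeff \<beta> r l))) summable_on UNIV"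
    proof (rule Infinite_Sum.abs_summable_on_comparison_test')
      fix r
      have C10: "0 \<le> C1" using C1[of 0] norm_ge_zero[of "b 0"] by (simp del: norm_ge_zero)
      have "norm (b r * of_real (expansion_coeff \<beta> r l)) \<le> norm (b r) * 1"
        unfolding norm_mult norm_of_real by (intro mult_left_mono abs_expansion_coeff_le \<beta>) auto
      also have "\<dots> \<le> C1 * exp (- d * real r) / (1 + real r) ^ 2" using C1[of r] by simp
      also have "\<dots> \<le> C1 * 1 / (1 + real r) ^ 2"
        using C10 d by (intro divide_right_mono mult_left_mono) auto
      finally show "norm (b r * of_real (expansion_coeff \<beta> r l)) \<le> C1 * (1 / (1 + real r)^2)" by simp
    qed
    then have "((\<lambda>r. b r * of_real (expansion_coeff \<beta> r l)) has_sum abel_transform \<beta> b l) UNIV"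
      unfolding abel_transform_def by (rule has_sum_infsum[OF Infinite_Sum.abs_summable_summable])
    from has_sum_cmult_left[OF this, of "g l"]
    show "((\<lambda>r. case (l, r) of (l, r) \<Rightarrow> h (r, l)) has_sum abel_transform \<beta> b l * g l) UNIV"
      by (simp add: h_def mult.assoc)
  qed
qed

section \<open>Distances in a homogeneous tree\<close>

locale hom_tree =
  fixes q :: nat and adj :: "'a \<Rightarrow> 'a \<Rightarrow> bool"
  assumes tree: "homogeneous_tree q adj" and q_ge_2: "2 \<le> q"
begin

abbreviation tdist :: "'a \<Rightarrow> 'a \<Rightarrow> nat" where "tdist \<equiv> gdist adj"

lemma adj_sym: "adj x y \<Longrightarrow> adj y x"
  and adj_irrefl: "\<not> adj x x"
  and connected: "adj\<^sup>*\<^sup>* x y"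
  and acyclic: "\<not> (3 \<le> length vs \<and> distinct vs \<and> successively adj vs \<and> adj (last vs) (hd vs))"
  and degree: "card {y. adj x y} = q + 1"
  using tree unfolding homogeneous_tree_def by blast+

lemma finite_neighbours: "finite {y. adj x y}"
  using degree[of x] card.infinite by fastforce

lemma walk_of_length_dist: "(adj ^^ tdist x y) x y"
  unfolding gdist_def using rtranclp_imp_relpowp[OF connected] by (rule LeastI_ex)

lemma dist_le: "(adj ^^ n) x y \<Longrightarrow> tdist x y \<le> n"
  unfolding gdist_def by (rule Least_le)

lemma dist_self [simp]: "tdist x x = 0"
  using dist_le[of 0 x x] by simp

lemma dist_eq_0_iff [simp]: "tdist x y = 0 \<longleftrightarrow> x = y"
  using walk_of_length_dist[of x y] by auto

lemma walk_sym: "(adj ^^ n) x y \<Longrightarrow> (adj ^^ n) y x"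
proof (induction n arbitrary: y)
  case (Suc n)
  then obtain z where "(adj ^^ n) x z" "adj z y" by auto
  then show ?case using Suc.IH adj_sym relpowp_Suc_I2 by metis
qed auto

lemma dist_sym: "tdist x y = tdist y x"
  by (meson dist_le walk_sym walk_of_length_dist antisym)

lemma dist_triangle: "tdist x z \<le> tdist x y + tdist y z"
  using walk_of_length_dist[of x y] walk_of_length_dist[of y z]
  by (intro dist_le) (auto simp: relpowp_add)

lemma dist_eq_1_iff: "tdist x y = 1 \<longleftrightarrow> adj x y"
proof
  assume "tdist x y = 1"
  then show "adj x y" using walk_of_length_dist[of x y] by (simp only: relpowp_1)
next
  assume xy: "adj x y"
  then have "tdist x y \<le> 1" by (intro dist_le) (simp only: relpowp_1)
  moreover have "x \<noteq> y" using xy adj_irrefl by auto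
  ultimately show "tdist x y = 1" using dist_eq_0_iff[of x y] by linarith
qed

lemma dist_adj_le: "adj x y \<Longrightarrow> tdist v y \<le> Suc (tdist v x)"
  using dist_triangle[of v y x] dist_eq_1_iff[of x y] by simp

lemma geodesic:
  obtains w where "w 0 = v" "w (tdist v x) = x" "\<And>i. i < tdist v x \<Longrightarrow> adj (w i) (w (Suc i))"
    "\<And>i. i \<le> tdist v x \<Longrightarrow> tdist v (w i) = i"
proof -
  obtain w where w: "w 0 = v" "w (tdist v x) = x" "\<And>i. i < tdist v x \<Longrightarrow> adj (w i) (w (Suc i))"
    using walk_of_length_dist[of v x] unfolding relpowp_fun_conv by blast
  have le: "tdist v (w i) \<le> i" if "i \<le> tdist v x" for i
    using that
  proof (induction i)
    case (Suc i)
    then show ?case using dist_adj_le[OF w(3)[of i], of v] by simp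
  qed (simp add: w(1))
  have "tdist (w i) x \<le> tdist v x - i" if "i \<le> tdist v x" for i
    using that
  proof (induction "tdist v x - i" arbitrary: i)
    case 0
    then show ?case using w(2) by simp
  next
    case (Suc k)
    then have i: "i < tdist v x" by simp
    then have "tdist (w (Suc i)) x \<le> tdist v x - Suc i" using Suc by simp
    moreover have "tdist (w i) x \<le> Suc (tdist (w (Suc i)) x)"
      using dist_triangle[of "w i" x "w (Suc i)"] w(3)[OF i] dist_eq_1_iff[of "w i" "w (Suc i)"] by simp
    ultimately show ?case using i by simp
  qed
  note ge = this
  have "tdist v (w i) = i" if "i \<le> tdist v x" for i
    using le[OF that] ge[OF that] dist_triangle[of v x "w i"] that by linarith
  then show ?thesis using that w by blast
qed

text \<open>
  A shortest closed piece of the walk has length at least three, by irreflexivity and the absence of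
  backtracking, and it visits no vertex twice. So it would be a cycle.
\<close>
lemma nonbacktracking_walk_not_closed:
  assumes adj: "\<And>i. i < N \<Longrightarrow> adj (w i) (w (Suc i))"
    and nb: "\<And>i. Suc (Suc i) \<le> N \<Longrightarrow> w i \<noteq> w (Suc (Suc i))" and N: "0 < N"
  shows "w 0 \<noteq> w N"
proof
  assume closed: "w 0 = w N"
  define P where "P = (\<lambda>k. 0 < k \<and> (\<exists>i. i + k \<le> N \<and> w i = w (i + k)))"
  have "P N" using closed N by (auto simp: P_def)
  define k where "k = (LEAST k. P k)"
  have "P k" unfolding k_def using \<open>P N\<close> by (rule LeastI)
  then obtain i where i: "0 < k" "i + k \<le> N" "w i = w (i + k)" by (auto simp: P_def)
  have minimal: "\<not> P j" if "j < k" for j using that not_less_Least unfolding k_def by blast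
  have "k \<noteq> 1"
  proof
    assume "k = 1"
    then show False using adj[of i] i adj_irrefl by simp
  qed
  moreover have "k \<noteq> 2"
  proof
    assume "k = 2"
    then show False using nb[of i] i by simp
  qed
  ultimately have k3: "3 \<le> k" using i(1) by linarith
  define vs where "vs = map w [i..<i+k]"
  have "distinct vs"
    unfolding vs_def distinct_map
  proof (intro conjI inj_onI)
    fix a b assume ab: "a \<in> set [i..<i+k]" "b \<in> set [i..<i+k]" "w a = w b"
    have False if "x < y" "x \<in> set [i..<i+k]" "y \<in> set [i..<i+k]" "w x = w y" for x y
    proof -
      have "P (y - x)" unfolding P_def using that i by (intro conjI exI[of _ x]) auto
      moreover have "y - x < k" using that by auto
      ultimately show False using minimal by blast
    qed
    then show "a = b" using ab by (metis linorder_neqE_nat)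
  qed simp
  moreover have "successively adj vs"
    unfolding vs_def successively_map
    unfolding successively_conv_nth using adj i by auto
  moreover have "adj (last vs) (hd vs)"
    using adj[of "i + k - 1"] i k3 by (simp add: vs_def last_map hd_map)
  ultimately show False using acyclic[of vs] k3 by (simp add: vs_def)
qed

text \<open>
  Two geodesics from \<open>v\<close> whose endpoints are joined by an edge that belongs to neither of them would
  close up to a walk without backtracking. All the local structure of the tree is drawn from this.
\<close>
lemma no_two_geodesics_meet:
  assumes w: "w 0 = v" "\<And>i. i < m \<Longrightarrow> adj (w i) (w (Suc i))" "\<And>i. i \<le> m
      \<Longrightarrow> tdist v (w i) = i"
    and u: "u 0 = v" "\<And>i. i < n \<Longrightarrow> adj (u i) (u (Suc i))" "\<And>i. i \<le> n
        \<Longrightarrow> tdist v (u i) = i"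
    and meet: "adj (w m) (u n)" "0 < m \<Longrightarrow> w (m - 1) \<noteq> u n" "0 < n
        \<Longrightarrow> w m \<noteq> u (n - 1)"
  shows False
proof -
  \<comment> \<open>Out along \<open>w\<close>, over the edge, and back along \<open>u\<close>.\<close>
  define W where "W = (\<lambda>i. if i \<le> m then w i else u (Suc (m + n) - i))"
  have "W 0 \<noteq> W (Suc (m + n))"
  proof (rule nonbacktracking_walk_not_closed)
    fix i assume i: "i < Suc (m + n)"
    consider "i < m" | "i = m" | "m < i" by linarith
    then show "adj (W i) (W (Suc i))"
    proof cases
      case 3
      then have "Suc (m + n) - i = Suc (m + n - i)" using i by simp
      moreover have "m + n - i < n" using 3 i by simp
      ultimately show ?thesis using 3 adj_sym[OF u(2)] by (simp add: W_def)
    qed (use w(2) meet(1) in \<open>auto simp: W_def\<close>)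
  next
    fix i assume i: "Suc (Suc i) \<le> Suc (m + n)"
    consider "Suc (Suc i) \<le> m" | "Suc i = m" | "i = m" | "m < i" by linarith
    then show "W i \<noteq> W (Suc (Suc i))"
    proof cases
      case 1
      then have "tdist v (W i) = i" "tdist v (W (Suc (Suc i))) = Suc (Suc i)" by (simp_all add: W_def w(3))
      then show ?thesis by auto
    next
      case 2
      then show ?thesis using meet(2) by (auto simp: W_def)
    next
      case 3
      then show ?thesis using meet(3) i by (auto simp: W_def)
    next
      case 4
      then have "tdist v (W i) = Suc (m + n) - i" "tdist v (W (Suc (Suc i))) = Suc (m + n) - Suc (Suc i)"
        using i by (simp_all add: W_def u(3))
      then show ?thesis using i by auto
    qed
  qed simp
  then show False using w(1) u(1) by (simp add: W_def)
qed

lemma dist_adj_neq: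
  assumes "adj x y"
  shows "tdist v x \<noteq> tdist v y"
proof
  assume eq: "tdist v x = tdist v y"
  obtain w where w: "w 0 = v" "w (tdist v x) = x" "\<And>i. i < tdist v x \<Longrightarrow> adj (w i) (w (Suc i))"
    "\<And>i. i \<le> tdist v x \<Longrightarrow> tdist v (w i) = i" using geodesic by blast
  obtain u where u: "u 0 = v" "u (tdist v y) = y" "\<And>i. i < tdist v y \<Longrightarrow> adj (u i) (u (Suc i))"
    "\<And>i. i \<le> tdist v y \<Longrightarrow> tdist v (u i) = i" using geodesic by blast
  show False
  proof (rule no_two_geodesics_meet[OF w(1,3,4) u(1,3,4)])
    show "adj (w (tdist v x)) (u (tdist v y))" using assms w(2) u(2) by simp
    show "w (tdist v x - 1) \<noteq> u (tdist v y)" if "0 < tdist v x"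
      using w(4)[of "tdist v x - 1"] u(2) eq that by auto
    show "w (tdist v x) \<noteq> u (tdist v y - 1)" if "0 < tdist v y"
      using u(4)[of "tdist v y - 1"] w(2) eq that by auto
  qed
qed

lemma unique_parent:
  assumes "adj x y" "adj x y'" "tdist v x = Suc (tdist v y)" "tdist v x = Suc (tdist v y')"
  shows "y = y'"
proof (rule ccontr)
  assume neq: "y \<noteq> y'"
  obtain w where w: "w 0 = v" "w (tdist v y) = y" "\<And>i. i < tdist v y \<Longrightarrow> adj (w i) (w (Suc i))"
    "\<And>i. i \<le> tdist v y \<Longrightarrow> tdist v (w i) = i" using geodesic by blast
  obtain u where u: "u 0 = v" "u (tdist v y') = y'" "\<And>i. i < tdist v y' \<Longrightarrow> adj (u i) (u (Suc i))"
    "\<And>i. i \<le> tdist v y' \<Longrightarrow> tdist v (u i) = i" using geodesic by blast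
  let ?m = "Suc (tdist v y)"
  let ?w = "w(?m := x)"
  show False
  proof (rule no_two_geodesics_meet[of ?w v ?m u "tdist v y'"])
    show "adj (?w i) (?w (Suc i))" if "i < ?m" for i
      using that w(2,3) adj_sym[OF assms(1)] by (cases "i = tdist v y") auto
    show "tdist v (?w i) = i" if "i \<le> ?m" for i
      using that w(4) assms(3) by (cases "i = ?m") auto
    show "adj (?w ?m) (u (tdist v y'))" using u(2) assms(2) by simp
    show "?w (?m - 1) \<noteq> u (tdist v y')" using w(2) u(2) neq by simp
    show "?w ?m \<noteq> u (tdist v y' - 1)" if "0 < tdist v y'"
      using u(4)[of "tdist v y' - 1"] assms(4) that by auto
  qed (use w u in auto)
qed

lemma parent_exists:
  assumes "tdist v x = Suc n"
  shows "\<exists>y. adj x y \<and> tdist v y = n"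
proof -
  obtain w where w: "w 0 = v" "w (tdist v x) = x" "\<And>i. i < tdist v x \<Longrightarrow> adj (w i) (w (Suc i))"
    "\<And>i. i \<le> tdist v x \<Longrightarrow> tdist v (w i) = i" using geodesic by blast
  then show ?thesis using assms w(3)[of n] w(4)[of n] by (intro exI[of _ "w n"]) (auto intro: adj_sym)
qed

lemma card_parents:
  assumes "tdist v x = Suc n"
  shows "card {y. adj x y \<and> tdist v y = n} = 1"
proof -
  obtain y where y: "adj x y" "tdist v y = n" using parent_exists[OF assms] by blast
  have "y' = y" if "adj x y'" "tdist v y' = n" for y'
    by (rule unique_parent[of x y' y v]) (simp_all add: that y assms)
  then have "{y. adj x y \<and> tdist v y = n} = {y}" using y by blast
  then show ?thesis by simp
qed

lemma dist_neighbour_cases: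
  assumes "adj x y"
  shows "tdist v y = Suc (tdist v x) \<or> tdist v x = Suc (tdist v y)"
  using dist_adj_le[OF assms, of v] dist_adj_le[OF adj_sym[OF assms], of v] dist_adj_neq[OF assms, of v] by linarith

lemma card_children:
  "card {y. adj x y \<and> tdist v y = Suc (tdist v x)} = (if x = v then q + 1 else q)"
proof (cases "x = v")
  case True
  then have "{y. adj x y \<and> tdist v y = Suc (tdist v x)} = {y. adj x y}"
    using dist_eq_1_iff[of v] by auto
  then show ?thesis using True degree by simp
next
  case False
  then obtain n where n: "tdist v x = Suc n" using dist_eq_0_iff[of v x] not0_implies_Suc by blast
  have "{y. adj x y} = {y. adj x y \<and> tdist v y = n} \<union> {y. adj x y \<and> tdist v y = Suc (tdist v x)}"
    using dist_neighbour_cases[of x _ v] n by auto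
  moreover have "card ({y. adj x y \<and> tdist v y = n} \<union> {y. adj x y \<and> tdist v y = Suc (tdist v x)})
     = card {y. adj x y \<and> tdist v y = n} + card {y. adj x y \<and> tdist v y = Suc (tdist v x)}"
  proof (rule card_Un_disjoint)
    have False if "tdist v y = n" "tdist v y = Suc (tdist v x)" for y using that n by linarith
    then show "{y. adj x y \<and> tdist v y = n} \<inter> {y. adj x y \<and> tdist v y = Suc (tdist v x)} = {}"
        by blast
  qed (rule finite_subset[OF _ finite_neighbours[of x]], blast)+
  ultimately have "card {y. adj x y} = card {y. adj x y \<and> tdist v y = n}
      + card {y. adj x y \<and> tdist v y = Suc (tdist v x)}"
    by (simp only:)
  then show ?thesis unfolding degree card_parents[OF n] using False by simp
qed

lemma finite_sphere: "finite {y. tdist x y = n}"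
proof (induction n)
  case (Suc n)
  have "{y. tdist x y = Suc n} \<subseteq> (\<Union>z\<in>{y. tdist x y = n}. {y. adj z y})"
  proof
    fix y assume "y \<in> {y. tdist x y = Suc n}"
    then obtain z where "adj y z" "tdist x z = n" using parent_exists by blast
    then show "y \<in> (\<Union>z\<in>{y. tdist x y = n}. {y. adj z y})" using adj_sym by auto
  qed
  then show ?case by (rule finite_subset) (intro finite_UN_I Suc finite_neighbours)
qed simp

section \<open>Sphere operators as polynomials in the Hecke operator\<close>

definition sphere_op :: "nat \<Rightarrow> ('a \<Rightarrow> 'b::real_vector) \<Rightarrow> 'a \<Rightarrow> 'b" where
  "sphere_op r \<phi> x = real q powr (- real r / 2) *\<^sub>R (\<Sum>y | tdist x y = r. \<phi> y)"

text \<open>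
  With the factor \<open>q\<^sup>-\<^sup>1\<^sup>/\<^sup>2\<close> the symbol of this operator is \<open>t + t\<^sup>-\<^sup>1\<close>, \<open>t = q\<^sup>i\<^sup>z\<close>.
\<close>
definition hecke_op :: "('a \<Rightarrow> 'b::real_vector) \<Rightarrow> 'a \<Rightarrow> 'b" where
  "hecke_op \<phi> x = real q powr (- 1 / 2) *\<^sub>R (\<Sum>y | adj x y. \<phi> y)"

lemma sphere_op_1: "sphere_op (Suc 0) = hecke_op"
  using dist_eq_1_iff by (intro ext) (simp add: sphere_op_def hecke_op_def)

lemma q_pos: "0 < real q" "1 < real q" "1 \<le> real q"
  using q_ge_2 by auto

lemma sphere_op_0 [simp]: "sphere_op 0 \<phi> = \<phi>"
  by (rule ext) (use q_pos in \<open>simp add: sphere_op_def\<close>)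

lemma sphere_op_add: "sphere_op r (\<lambda>x. \<phi> x + \<psi> x)
    = (\<lambda>x. sphere_op r \<phi> x + sphere_op r \<psi> x)"
  by (rule ext) (simp add: sphere_op_def sum.distrib scaleR_right_distrib)

lemma sphere_op_diff: "sphere_op r (\<lambda>x. \<phi> x - \<psi> x)
    = (\<lambda>x. sphere_op r \<phi> x - sphere_op r \<psi> x)"
  by (rule ext) (simp add: sphere_op_def sum_subtractf scaleR_right_diff_distrib)

lemma sphere_op_scaleR: "sphere_op r (\<lambda>x. c *\<^sub>R \<phi> x)
    = (\<lambda>x. c *\<^sub>R sphere_op r \<phi> x)"
  by (rule ext) (simp add: sphere_op_def scaleR_right.sum[symmetric])

lemma sphere_op_mono:
  fixes \<phi> \<psi> :: "'a \<Rightarrow> real"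
  assumes "\<And>y. tdist x y = r \<Longrightarrow> \<phi> y \<le> \<psi> y"
  shows "sphere_op r \<phi> x \<le> sphere_op r \<psi> x"
  unfolding sphere_op_def using assms by (intro scaleR_left_mono sum_mono) auto

lemma norm_sphere_op_le: "norm (sphere_op r \<phi> x) \<le> sphere_op r (\<lambda>y. norm (\<phi> y)) x"
  for \<phi> :: "'a \<Rightarrow> 'b::real_normed_vector"
  unfolding sphere_op_def by (simp add: sum_norm_le mult_left_mono)

text \<open>
  A step from the sphere of radius \<open>n + 1\<close> leads to the spheres of radius \<open>n + 2\<close> and \<open>n\<close>. A vertex of
  the former is reached from its one parent, a vertex of the latter from its \<open>q\<close> children, or \<open>q + 1\<close>
  of them if it is the centre.
\<close>
lemma sum_sphere_hecke:
  fixes \<phi> :: "'a \<Rightarrow> 'b::real_vector"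
  shows "(\<Sum>y | tdist x y = Suc n. \<Sum>z | adj y z. \<phi> z) = (\<Sum>z | tdist x z = Suc (Suc n). \<phi> z) +
     (if n = 0 then real q + 1 else real q) *\<^sub>R (\<Sum>z | tdist x z = n. \<phi> z)"
proof -
  let ?S = "\<lambda>n. {y. tdist x y = n}"
  have fin: "finite (?S n)" for n by (rule finite_sphere)
  let ?A = "{(y, z). tdist x y = Suc n \<and> adj y z}"
  have comm: "adj y z \<longleftrightarrow> adj z y" for y z using adj_sym by blast
  have key: "tdist x z = Suc (Suc n) \<or> tdist x z = n" if "adj z y" "tdist x y = Suc n" for y z
    using dist_neighbour_cases[OF that(1), of x] that(2) by auto
  have disj: "?A = {(y, z). tdist x z = Suc (Suc n) \<and> adj z y \<and> tdist x y = Suc n} \<union>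
     {(y, z). tdist x z = n \<and> adj z y \<and> tdist x y = Suc n}" (is "_ = ?B \<union> ?C")
  proof (rule set_eqI)
    fix p :: "'a \<times> 'a"
    obtain y z where p: "p = (y, z)" by fastforce
    show "p \<in> ?A \<longleftrightarrow> p \<in> ?B \<union> ?C"
      using key[of z y] comm[of y z] unfolding p by auto
  qed
  have A: "(\<Sum>y\<in>?S (Suc n). \<Sum>z | adj y z. \<phi> z) = (\<Sum>(y, z)\<in>?A. \<phi> z)"
    by (subst sum.Sigma[OF fin]) (auto simp: finite_neighbours intro!: sum.cong)
  have "finite ?A"
    using finite_SigmaI[OF fin finite_neighbours, of "Suc n"] by (rule rev_finite_subset) auto
  then have "finite (?B \<union> ?C)" unfolding disj .
  then have fBC: "finite ?B" "finite ?C" unfolding finite_Un by blast+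
  have "(\<Sum>(y, z)\<in>?A. \<phi> z) = (\<Sum>(y, z)\<in>?B. \<phi> z) + (\<Sum>(y, z)\<in>?C. \<phi> z)"
    unfolding disj
  proof (rule sum.union_disjoint[OF fBC])
    show "?B \<inter> ?C = {}" by (simp add: disjoint_iff)
  qed
  moreover have "(\<Sum>(y, z)\<in>?B. \<phi> z)
      = (\<Sum>z\<in>?S (Suc (Suc n)). \<Sum>y | adj z y \<and> tdist x y = Suc n. \<phi> z)"
    by (subst sum.Sigma[OF fin])
       (auto intro!: sum.reindex_bij_witness[of _ prod.swap prod.swap] finite_subset[OF _ finite_neighbours])
  then have "(\<Sum>(y, z)\<in>?B. \<phi> z) = (\<Sum>z\<in>?S (Suc (Suc n)). \<phi> z)"
    using card_parents[of x _ "Suc n"] by (simp add: sum_constant_scaleR)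
  moreover have "(\<Sum>(y, z)\<in>?C. \<phi> z)
      = (\<Sum>z\<in>?S n. \<Sum>y | adj z y \<and> tdist x y = Suc n. \<phi> z)"
    by (subst sum.Sigma[OF fin])
       (auto intro!: sum.reindex_bij_witness[of _ prod.swap prod.swap] finite_subset[OF _ finite_neighbours])
  moreover have "card {y. adj z y \<and> tdist x y = Suc n} = (if n = 0 then q + 1 else q)" if "tdist x z = n" for z
    using card_children[of z x] that dist_eq_0_iff[of x z] by (cases "z = x") auto
  then have "(\<Sum>z\<in>?S n. \<Sum>y | adj z y \<and> tdist x y = Suc n. \<phi> z)
      = (\<Sum>z\<in>?S n. (if n = 0 then real q + 1 else real q) *\<^sub>R \<phi> z)"
    by (intro sum.cong refl) (simp add: sum_constant_scaleR)
  ultimately show ?thesis using A by (simp add: scaleR_right.sum)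
qed

lemma hecke_op_linear:
  "hecke_op (\<lambda>x. \<phi> x + \<psi> x) = (\<lambda>x. hecke_op \<phi> x + hecke_op \<psi> x)"
  "hecke_op (\<lambda>x. \<phi> x - \<psi> x) = (\<lambda>x. hecke_op \<phi> x - hecke_op \<psi> x)"
  "hecke_op (\<lambda>x. c *\<^sub>R \<phi> x) = (\<lambda>x. c *\<^sub>R hecke_op \<phi> x)"
  unfolding sphere_op_1[symmetric] by (rule sphere_op_add sphere_op_diff sphere_op_scaleR)+

lemma sphere_op_hecke:
  "sphere_op (Suc n) (hecke_op \<phi>) x
      = sphere_op (Suc (Suc n)) \<phi> x + (if n = 0 then 1 + 1 / real q else 1) *\<^sub>R sphere_op n \<phi> x"
proof -
  have e: "- real (Suc n) / 2 + - 1 / 2 = - real (Suc (Suc n)) / 2" by (simp add: field_simps)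
  have "sphere_op (Suc n) (hecke_op \<phi>) x = (real q powr (- real (Suc n) / 2) * real q powr (- 1 / 2)) *\<^sub>R
      (\<Sum>y | tdist x y = Suc n. \<Sum>z | adj y z. \<phi> z)"
    unfolding sphere_op_def hecke_op_def by (simp add: scaleR_right.sum[symmetric])
  also have "\<dots> = real q powr (- real (Suc (Suc n)) / 2) *\<^sub>R
      ((\<Sum>z | tdist x z = Suc (Suc n). \<phi> z) +
     (if n = 0 then real q + 1 else real q) *\<^sub>R (\<Sum>z | tdist x z = n. \<phi> z))"
    unfolding sum_sphere_hecke powr_add[symmetric] e ..
  also have "\<dots> = sphere_op (Suc (Suc n)) \<phi> x
      + (if n = 0 then 1 + 1 / real q else 1) *\<^sub>R sphere_op n \<phi> x"
  proof -
    have "real q powr (- real (Suc (Suc n)) / 2) * real q = real q powr (- real n / 2)"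
      using q_pos powr_add[of "real q" "- real (Suc (Suc n)) / 2" 1] by (simp add: field_simps)
    then have "real q powr (- real (Suc (Suc n)) / 2) = real q powr (- real n / 2) / real q"
      using q_pos by (simp add: field_simps)
    then have "real q powr (- real (Suc (Suc n)) / 2) * (if n = 0 then real q + 1 else real q)
       = (if n = 0 then 1 + 1 / real q else 1) * real q powr (- real n / 2)"
      using q_pos by (simp add: field_simps)
    then show ?thesis by (simp only: sphere_op_def scaleR_right_distrib scaleR_scaleR)
  qed
  finally show ?thesis .
qed

text \<open>
  The Chebyshev polynomials of the second kind, evaluated at half the Hecke operator; the symbol is
  \<open>t\<^sup>n + t\<^sup>n\<^sup>-\<^sup>2 + \<dots> + t\<^sup>-\<^sup>n\<close>.
\<close>
fun chebU_op :: "nat \<Rightarrow> ('a \<Rightarrow> 'b::real_vector) \<Rightarrow> 'a \<Rightarrow> 'b" where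
  "chebU_op 0 \<phi> = \<phi>"
| "chebU_op (Suc 0) \<phi> = hecke_op \<phi>"
| "chebU_op (Suc (Suc n)) \<phi> = (\<lambda>x. chebU_op (Suc n) (hecke_op \<phi>) x - chebU_op n \<phi> x)"

lemma chebU_op_add: "chebU_op n (\<lambda>x. \<phi> x + \<psi> x)
    = (\<lambda>x. chebU_op n \<phi> x + chebU_op n \<psi> x)"
  by (induction n \<phi> arbitrary: \<psi> rule: chebU_op.induct)
     (simp_all only: chebU_op.simps hecke_op_linear add_diff_add)

lemma chebU_op_diff: "chebU_op n (\<lambda>x. \<phi> x - \<psi> x)
    = (\<lambda>x. chebU_op n \<phi> x - chebU_op n \<psi> x)"
  by (induction n \<phi> arbitrary: \<psi> rule: chebU_op.induct)
     (simp_all only: chebU_op.simps hecke_op_linear, simp add: fun_eq_iff algebra_simps)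

lemma chebU_op_scaleR: "chebU_op n (\<lambda>x. c *\<^sub>R \<phi> x) = (\<lambda>x. c *\<^sub>R chebU_op n \<phi> x)"
  by (induction n \<phi> rule: chebU_op.induct)
     (simp_all only: chebU_op.simps hecke_op_linear scaleR_right_diff_distrib)

lemma hecke_chebU_commute: "hecke_op (chebU_op n \<phi>) = chebU_op n (hecke_op \<phi>)"
  by (induction n \<phi> rule: chebU_op.induct) (simp_all only: chebU_op.simps hecke_op_linear)

text \<open>
  The recursion of the Chebyshev operators differs from that of the sphere operators at radius one
  only, and this difference propagates as the factor \<open>1 / q\<close>. The importance of the identity is that
  it exhibits \<open>chebU_op\<close> as an operator with nonnegative kernel.
\<close>
lemma chebU_op_sphere:
  "chebU_op (Suc (Suc n)) \<phi> x = sphere_op (Suc (Suc n)) \<phi> x + (1 / real q) *\<^sub>R chebU_op n \<phi> x"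
proof (induction n arbitrary: \<phi> x rule: less_induct)
  case (less n)
  have two: "chebU_op (Suc (Suc 0)) \<phi> x = sphere_op (Suc (Suc 0)) \<phi> x + (1 / real q) *\<^sub>R \<phi> x"
      for \<phi> :: "'a \<Rightarrow> 'b" and x
    using sphere_op_hecke[of 0 \<phi> x] by (simp add: sphere_op_1 scaleR_left_distrib)
  consider "n = 0" | "n = 1" | k where "n = Suc (Suc k)" by (metis One_nat_def not0_implies_Suc)
  then show ?case
  proof cases
    case 1
    then show ?thesis using two by simp
  next
    case 2
    have "chebU_op (Suc (Suc (Suc 0))) \<phi> x = chebU_op (Suc (Suc 0)) (hecke_op \<phi>) x - hecke_op \<phi> x"
      by simp
    then show ?thesis
      using 2 sphere_op_hecke[of 1 \<phi> x] unfolding two by (simp add: sphere_op_1 del: chebU_op.simps(3))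
  next
    case 3
    have "chebU_op (Suc (Suc n)) \<phi> x
        = chebU_op (Suc (Suc (Suc k))) (hecke_op \<phi>) x - chebU_op (Suc (Suc k)) \<phi> x"
      using 3 by simp
    also have "\<dots> = sphere_op (Suc (Suc (Suc k))) (hecke_op \<phi>) x
        + (1 / real q) *\<^sub>R chebU_op (Suc k) (hecke_op \<phi>) x
       - (sphere_op (Suc (Suc k)) \<phi> x + (1 / real q) *\<^sub>R chebU_op k \<phi> x)"
      using less[of "Suc k" "hecke_op \<phi>" x] less[of k \<phi> x] 3 by (simp del: chebU_op.simps)
    also have "\<dots> = sphere_op (Suc (Suc n)) \<phi> x + (1 / real q) *\<^sub>R chebU_op n \<phi> x"
      unfolding sphere_op_hecke 3 by (simp add: scaleR_right_diff_distrib)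
    finally show ?thesis .
  qed
qed

lemma chebU_op_nonneg:
  fixes \<phi> :: "'a \<Rightarrow> real"
  assumes "\<And>y. 0 \<le> \<phi> y"
  shows "0 \<le> chebU_op n \<phi> x"
proof -
  have s: "0 \<le> sphere_op r \<phi> x" for r x
    unfolding sphere_op_def using assms by (intro scaleR_nonneg_nonneg sum_nonneg) auto
  show ?thesis
  proof (induction n rule: less_induct)
    case (less n)
    consider "n = 0" | "n = 1" | k where "n = Suc (Suc k)" by (metis One_nat_def not0_implies_Suc)
    then show ?case
    proof cases
      case 3
      then have "0 \<le> chebU_op k \<phi> x" using less by simp
      then show ?thesis unfolding 3 chebU_op_sphere using s by simp
    next
      case 2
      then show ?thesis using s[of 1 x] by (simp add: sphere_op_1)
    qed (use assms in simp)
  qed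
qed

text \<open>
  If \<open>W\<close> were an eigenfunction of the Hecke operator with eigenvalue \<open>a + 1/a\<close>, then
  \<open>chebU_op n W = (a\<^sup>n + a\<^sup>n\<^sup>-\<^sup>2 + \<dots> + a\<^sup>-\<^sup>n) W\<close>. For a supersolution the defect \<open>D\<close> is nonnegative, and
  positivity of the Chebyshev operators keeps the error on the right side.
\<close>
lemma chebU_op_supersolution:
  fixes W :: "'a \<Rightarrow> real" and a :: real
  assumes a: "1 \<le> a" and W: "\<And>x. 0 \<le> W x" and LW: "\<And>x. hecke_op W x \<le> (a + 1 / a) * W x"
  shows "chebU_op n W x \<le> real (n + 1) * a ^ n * W x"
proof -
  define D where "D = (\<lambda>x. (a + 1 / a) * W x - hecke_op W x)"
  have D: "0 \<le> D x" for x using LW by (simp add: D_def)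
  \<comment> \<open>The sequence \<open>a\<^sup>n + a\<^sup>n\<^sup>-\<^sup>2 + \<dots> + a\<^sup>-\<^sup>n\<close>, the value of the same polynomial at \<open>a + 1/a\<close>.\<close>
  define ul where "ul = rec_nat 1 (\<lambda>n u. u / a + a ^ Suc n)"
  have ul: "ul 0 = 1" "ul (Suc n) = ul n / a + a ^ Suc n" for n by (simp_all add: ul_def)
  have ul0: "0 \<le> ul n" for n by (induction n) (use a in \<open>auto simp: ul\<close>)
  have ul_le: "ul n \<le> real (n + 1) * a ^ n" for n
  proof (induction n)
    case (Suc n)
    have "ul n / a \<le> ul n" using ul0[of n] a by (simp add: divide_le_eq mult_left_le mult_le_cancel_left1)
    also have "\<dots> \<le> real (n + 1) * a ^ n" by (rule Suc)
    also have "\<dots> \<le> real (n + 1) * a ^ Suc n" using a by (intro mult_left_mono power_increasing) auto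
    finally show ?case by (simp add: ul(2) algebra_simps)
  qed (simp add: ul)
  define R where "R = (\<lambda>n x. ul n * W x - chebU_op n W x)"
  have hW: "hecke_op W = (\<lambda>x. (a + 1 / a) *\<^sub>R W x - D x)" by (simp add: D_def)
  have R_rec: "R (Suc (Suc n)) x = (a + 1 / a) * R (Suc n) x - R n x + chebU_op (Suc n) D x" for n x
  proof -
    have e1: "ul (Suc (Suc n)) = (a + 1 / a) * ul (Suc n) - ul n" using a by (simp add: ul field_simps)
    have e2: "chebU_op (Suc (Suc n)) W x = (a + 1 / a) * chebU_op (Suc n) W x - chebU_op (Suc n) D x - chebU_op n W x"
      unfolding chebU_op.simps(3) hW chebU_op_diff chebU_op_scaleR by simp
    show ?thesis unfolding R_def e1 e2 by (simp add: algebra_simps del: chebU_op.simps)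
  qed
  \<comment> \<open>The recursion has characteristic roots \<open>a\<close> and \<open>1/a\<close>. Hence \<open>R (n+1) - R n / a\<close> satisfies a first
    order recursion with factor \<open>a\<close> and nonnegative source, which gives the second inequality.\<close>
  have "0 \<le> R n x \<and> R n x / a \<le> R (Suc n) x" for n
  proof (induction n)
    case 0
    show ?case using D[of x] a by (simp add: R_def ul D_def algebra_simps)
  next
    case (Suc n)
    have "0 \<le> R n x / a" using Suc a by simp
    then have 1: "0 \<le> R (Suc n) x" using Suc by linarith
    have "a * (R n x / a) \<le> a * R (Suc n) x" using Suc a by (intro mult_left_mono) auto
    then have "R n x \<le> a * R (Suc n) x" using a by simp
    moreover have "0 \<le> chebU_op (Suc n) D x" by (rule chebU_op_nonneg[OF D])
    ultimately have "R (Suc n) x / a \<le> R (Suc (Suc n)) x" unfolding R_rec by (simp add: algebra_simps)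
    then show ?case using 1 by blast
  qed
  then have "chebU_op n W x \<le> ul n * W x" by (simp add: R_def)
  also have "\<dots> \<le> real (n + 1) * a ^ n * W x" by (intro mult_right_mono ul_le W)
  finally show ?thesis .
qed

lemma sphere_op_le_chebU_op:
  fixes W :: "'a \<Rightarrow> real"
  assumes "\<And>x. 0 \<le> W x"
  shows "sphere_op n W x \<le> chebU_op n W x"
proof -
  consider "n = 0" | "n = 1" | k where "n = Suc (Suc k)" by (metis One_nat_def not0_implies_Suc)
  then show ?thesis
    using chebU_op_nonneg[OF assms] q_pos
    by cases (simp_all add: chebU_op_sphere sphere_op_1 del: chebU_op.simps(3))
qed

text \<open>
  Twice the Chebyshev polynomials of the first kind, evaluated at half the Hecke operator; the symbol
  is \<open>t\<^sup>n + t\<^sup>-\<^sup>n\<close>. The value \<open>2\<close> at \<open>n = 0\<close> lets the recurrence hold for all integers when the index is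
  replaced by its absolute value.
\<close>
fun chebT_op :: "nat \<Rightarrow> ('a \<Rightarrow> 'b::real_vector) \<Rightarrow> 'a \<Rightarrow> 'b" where
  "chebT_op 0 \<phi> = (\<lambda>x. 2 *\<^sub>R \<phi> x)"
| "chebT_op (Suc 0) \<phi> = hecke_op \<phi>"
| "chebT_op (Suc (Suc n)) \<phi> = (\<lambda>x. hecke_op (chebT_op (Suc n) \<phi>) x - chebT_op n \<phi> x)"

lemma chebT_op_eq_chebU_op_diff:
  "chebT_op (Suc (Suc n)) \<phi> = (\<lambda>x. chebU_op (Suc (Suc n)) \<phi> x - chebU_op n \<phi> x)"
proof (induction n rule: less_induct)
  case (less n)
  consider "n = 0" | "n = 1" | k where "n = Suc (Suc k)" by (metis One_nat_def not0_implies_Suc)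
  then show ?case
  proof cases
    case 1
    then show ?thesis by (simp add: fun_eq_iff scaleR_2)
  next
    case 2
    then show ?thesis by (simp add: fun_eq_iff scaleR_2 hecke_op_linear)
  next
    case 3
    have "chebT_op (Suc (Suc n)) \<phi> =
        (\<lambda>x. hecke_op (chebT_op (Suc (Suc (Suc k))) \<phi>) x - chebT_op (Suc (Suc k)) \<phi> x)"
      using 3 by simp
    also have "\<dots> = (\<lambda>x. hecke_op
        (\<lambda>x. chebU_op (Suc (Suc (Suc k))) \<phi> x - chebU_op (Suc k) \<phi> x) x
       - (chebU_op (Suc (Suc k)) \<phi> x - chebU_op k \<phi> x))"
      using less[of "Suc k"] less[of k] 3 by (simp del: chebU_op.simps chebT_op.simps)
    also have "\<dots> = (\<lambda>x. chebU_op (Suc (Suc n)) \<phi> x - chebU_op n \<phi> x)"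
      unfolding 3 hecke_op_linear hecke_chebU_commute by (simp add: fun_eq_iff)
    finally show ?thesis .
  qed
qed

lemma hecke_chebT_abs:
  "hecke_op (chebT_op (nat \<bar>n\<bar>) \<phi>)
      = (\<lambda>x. chebT_op (nat \<bar>n + 1\<bar>) \<phi> x + chebT_op (nat \<bar>n - 1\<bar>) \<phi> x)"
proof -
  have pos: "hecke_op (chebT_op k \<phi>)
      = (\<lambda>x. chebT_op (Suc k) \<phi> x + chebT_op (nat \<bar>int k - 1\<bar>) \<phi> x)" for k
    by (cases k) (simp_all add: hecke_op_linear scaleR_2)
  show ?thesis
  proof (cases "0 \<le> n")
    case True
    then have "nat \<bar>n\<bar> = nat n" "nat \<bar>n + 1\<bar> = Suc (nat n)" "int (nat n) = n" by auto
    then show ?thesis using pos[of "nat n"] by (simp only:)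
  next
    case False
    then have "nat \<bar>n\<bar> = nat (- n)" "nat \<bar>n - 1\<bar> = Suc (nat (- n))" "int (nat (- n))
        = - n" "\<bar>- n - 1\<bar> = \<bar>n + 1\<bar>" by auto
    then show ?thesis using pos[of "nat (- n)"] by (simp only: add.commute)
  qed
qed

definition laurent_coeff :: "nat \<Rightarrow> nat \<Rightarrow> real" where
  "laurent_coeff r i = (if i = 0 \<or> i = r then 1 else 1 - 1 / real q)"

text \<open>
  On a family that behaves like \<open>n \<mapsto> t\<^sup>n\<close> under the Hecke operator, polynomials of this operator act
  through their symbols.
\<close>
lemma chebU_op_on_recurrence:
  fixes X :: "int \<Rightarrow> 'a \<Rightarrow> 'b::real_vector"
  assumes X: "\<And>n. hecke_op (X n) = (\<lambda>x. X (n + 1) x + X (n - 1) x)"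
  shows "chebU_op r (X n) x = (\<Sum>i\<le>r. X (n + int r - 2 * int i) x)"
proof (induction r arbitrary: n x rule: less_induct)
  case (less r)
  consider "r = 0" | "r = 1" | k where "r = Suc (Suc k)" by (metis One_nat_def not0_implies_Suc)
  then show ?case
  proof cases
    case 1
    then show ?thesis by simp
  next
    case 2
    then show ?thesis by (simp add: X add.commute)
  next
    case 3
    have "chebU_op r (X n) x = chebU_op (Suc k) (X (n + 1)) x + chebU_op (Suc k) (X (n - 1)) x - chebU_op k (X n) x"
      unfolding 3 chebU_op.simps(3) X chebU_op_add ..
    also have "chebU_op (Suc k) (X (n + 1)) x = (\<Sum>i\<le>Suc k. X (n + int r - 2 * int i) x)"
      using less[of "Suc k" "n + 1" x] 3 by (simp add: algebra_simps)
    also have "chebU_op (Suc k) (X (n - 1)) x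
        = (\<Sum>i\<le>k. X (n + int k - 2 * int i) x) + X (n + int r - 2 * int r) x"
      using less[of "Suc k" "n - 1" x] 3 by (simp add: algebra_simps)
    also have "chebU_op k (X n) x = (\<Sum>i\<le>k. X (n + int k - 2 * int i) x)"
      using less[of k n x] 3 by simp
    finally show ?thesis unfolding 3 by simp
  qed
qed

lemma sphere_op_on_recurrence:
  fixes X :: "int \<Rightarrow> 'a \<Rightarrow> 'b::real_vector"
  assumes X: "\<And>n. hecke_op (X n) = (\<lambda>x. X (n + 1) x + X (n - 1) x)"
  shows "sphere_op r (X n) x = (\<Sum>i\<le>r. laurent_coeff r i *\<^sub>R X (n + int r - 2 * int i) x)"
proof -
  note ch = chebU_op_on_recurrence[of X, OF X]
  consider "r = 0" | "r = 1" | k where "r = Suc (Suc k)" by (metis One_nat_def not0_implies_Suc)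
  then show ?thesis
  proof cases
    case 1
    then show ?thesis by (simp add: laurent_coeff_def)
  next
    case 2
    then show ?thesis using ch[of 1 n x] by (simp add: laurent_coeff_def sphere_op_1)
  next
    case 3
    define Y where "Y = (\<lambda>i. X (n + int r - 2 * int i) x)"
    have idx: "n + int k - 2 * int i = n + int r - 2 * int (Suc i)" for i
      using 3 by simp
    have mid: "(\<Sum>i\<le>k. X (n + int k - 2 * int i) x) = (\<Sum>i\<le>k. Y (Suc i))"
      unfolding idx Y_def ..
    have split: "(\<Sum>i\<le>Suc (Suc k). Z i) = Z 0 + (\<Sum>i\<le>k. Z (Suc i)) + Z (Suc (Suc k))"
        for Z :: "nat \<Rightarrow> 'b"
      by (subst sum.atMost_Suc_shift) (simp add: add.assoc)
    have "sphere_op r (X n) x = chebU_op r (X n) x - (1 / real q) *\<^sub>R chebU_op k (X n) x"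
      unfolding 3 chebU_op_sphere by simp
    also have "\<dots> = (\<Sum>i\<le>r. Y i) - (1 / real q) *\<^sub>R (\<Sum>i\<le>k. Y (Suc i))"
      unfolding ch mid Y_def ..
    also have "\<dots> = Y 0 + (1 - 1 / real q) *\<^sub>R (\<Sum>i\<le>k. Y (Suc i)) + Y r"
    proof -
      have "a + S + b - c *\<^sub>R S = a + (1 - c) *\<^sub>R S + b" for a S b :: 'b and c
        by (simp add: scaleR_left_diff_distrib)
      then show ?thesis unfolding 3 split by this
    qed
    also have "\<dots> = (\<Sum>i\<le>r. laurent_coeff r i *\<^sub>R Y i)"
      unfolding 3 split by (simp add: laurent_coeff_def scaleR_right.sum)
    finally show ?thesis by (simp add: Y_def)
  qed
qed

section \<open>Growth of the sphere operators in the Schwartz seminorms\<close>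

abbreviation "sweight \<equiv> schwartz_weight q adj"

abbreviation "sspace \<equiv> schwartz_space q adj"

abbreviation "snorm \<equiv> schwartz_seminorm q adj"

text \<open>
  The outer radius of the annulus \<open>{q\<^sup>i\<^sup>z | z \<in> strip p}\<close>.
\<close>
abbreviation growth :: "real \<Rightarrow> real" where "growth p \<equiv> real q powr (1/p - 1/2)"

abbreviation decay :: "'a \<Rightarrow> real \<Rightarrow> 'a \<Rightarrow> real" where
  "decay v0 p x \<equiv> real q powr (- (real (tdist v0 x) / p))"

lemma growth_ge_1: "1 \<le> p \<Longrightarrow> p \<le> 2 \<Longrightarrow> 1 \<le> growth p"
  using q_pos by (intro ge_one_powr_ge_zero) (auto simp: field_simps)

lemma growth_pow: "growth p ^ n = real q powr ((1/p - 1/2) * real n)"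
  using q_pos by (simp add: powr_powr[symmetric] powr_realpow)

text \<open>
  The weight of the Schwartz space is superharmonic for the spectral parameter at the edge of the
  strip: away from the root equality holds, and at the root all neighbours lie further out.
\<close>
lemma hecke_op_decay_le:
  assumes p: "1 \<le> p" "p \<le> 2"
  shows "hecke_op (decay v0 p) x \<le> (growth p + 1 / growth p) * decay v0 p x"
proof -
  define c where "c = 1 / p"
  have inv: "1 / growth p = real q powr (1/2 - c)"
    using q_pos by (simp add: c_def powr_minus_divide[symmetric])
  have dec: "decay v0 p y = real q powr (- (real (tdist v0 y) * c))" for y by (simp add: c_def)
  show ?thesis
  proof (cases "x = v0")
    case True
    have "(\<Sum>y | adj v0 y. decay v0 p y) = (\<Sum>y | adj v0 y. real q powr (- c))"
    proof (intro sum.cong refl)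
      fix y assume "y \<in> {y. adj v0 y}"
      then have "tdist v0 y = 1" using dist_eq_1_iff by blast
      then show "decay v0 p y = real q powr (- c)" by (simp add: c_def)
    qed
    then have "hecke_op (decay v0 p) x = real q powr (- 1 / 2) * ((real q + 1) * real q powr (- c))"
      using True degree[of v0] by (simp add: hecke_op_def)
    also have "\<dots> = real q powr (1/2 - c) + real q powr (- 1/2 - c)"
    proof -
      have "real q powr (- 1 / 2) * real q * real q powr (- c) = real q powr (- 1/2 + 1 + - c)"
        using q_pos by (simp only: powr_add powr_one)
      moreover have "real q powr (- 1 / 2) * real q powr (- c) = real q powr (- 1/2 + - c)"
        by (simp only: powr_add)
      ultimately show ?thesis by (simp add: distrib_right distrib_left mult.assoc)
    qed
    also have "real q powr (- 1/2 - c) \<le> real q powr (c - 1/2)"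
      using p q_pos by (intro powr_mono) (auto simp: c_def)
    finally show ?thesis unfolding True inv using q_pos by (simp add: c_def add.commute)
  next
    case False
    then obtain n where n: "tdist v0 x = Suc n" using dist_eq_0_iff[of v0 x] not0_implies_Suc by metis
    have set: "{y. adj x y} = {y. adj x y \<and> tdist v0 y = n} \<union>
        {y. adj x y \<and> tdist v0 y = Suc (tdist v0 x)}"
      using dist_neighbour_cases[of x _ v0] n by fastforce
    have "(\<Sum>y | adj x y. decay v0 p y) = (\<Sum>y | adj x y \<and> tdist v0 y = n. decay v0 p y)
       + (\<Sum>y | adj x y \<and> tdist v0 y = Suc (tdist v0 x). decay v0 p y)"
    proof (subst set, rule sum.union_disjoint)
      have False if "tdist v0 y = n" "tdist v0 y = Suc (tdist v0 x)" for y using that n by linarith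
      then show "{y. adj x y \<and> tdist v0 y = n} \<inter> {y. adj x y \<and> tdist v0 y = Suc (tdist v0 x)} = {}"
          by blast
    qed (rule finite_subset[OF _ finite_neighbours[of x]], blast)+
    also have "(\<Sum>y | adj x y \<and> tdist v0 y = n. decay v0 p y) = real q powr (- (real n * c))"
      using card_parents[OF n] by (simp add: c_def)
    also have "(\<Sum>y | adj x y \<and> tdist v0 y = Suc (tdist v0 x). decay v0 p y)
        = real q * real q powr (- (real (n + 2) * c))"
      using card_children[of x v0] False n by (simp add: c_def)
    finally have "hecke_op (decay v0 p) x
        = real q powr (- 1 / 2) * real q powr (- (real n * c)) + real q powr (- 1 / 2) * real q
            * real q powr (- (real (n + 2) * c))"
      by (simp add: hecke_op_def distrib_left)
    also have "real q powr (- 1 / 2) * real q powr (- (real n * c)) = real q powr (- 1 / 2 + - (real n * c))"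
      by (simp only: powr_add)
    also have "real q powr (- 1 / 2) * real q * real q powr (- (real (n + 2) * c))
        = real q powr (- 1 / 2 + 1 + - (real (n + 2) * c))"
      using q_pos by (simp only: powr_add powr_one)
    also have "- 1 / 2 + - (real n * c) = (c - 1/2) + - (real (Suc n) * c)" by (simp add: algebra_simps)
    also have "- 1 / 2 + 1 + - (real (n + 2) * c) = (1/2 - c) + - (real (Suc n) * c)" by (simp add: algebra_simps)
    finally show ?thesis unfolding inv dec n powr_add by (simp add: c_def distrib_right)
  qed
qed

lemma schwartz_weight_nonneg: "0 \<le> sweight v0 p m \<phi> x"
  by (simp add: schwartz_weight_def)

lemma schwartz_weight_le_iff:
  "sweight v0 p m \<phi> x \<le> N \<longleftrightarrow> (1 + real (tdist v0 x)) ^ m * cmod (\<phi> x)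
      \<le> N * decay v0 p x"
proof -
  have "sweight v0 p m \<phi> x = ((1 + real (tdist v0 x)) ^ m * cmod (\<phi> x)) / decay v0 p x"
    using q_pos by (simp add: schwartz_weight_def powr_minus field_simps)
  moreover have "0 < decay v0 p x" using q_pos by simp
  ultimately show ?thesis by (simp add: pos_divide_le_eq)
qed

lemma schwartz_weight_add_le:
  "sweight v0 p m (\<lambda>x. \<phi> x + \<psi> x) x \<le> sweight v0 p m \<phi> x + sweight v0 p m \<psi> x"
  unfolding schwartz_weight_def distrib_left[symmetric] by (intro mult_left_mono norm_triangle_ineq) auto

lemma schwartz_weight_scale:
  "sweight v0 p m (\<lambda>x. c * \<phi> x) x = cmod c * sweight v0 p m \<phi> x"
  by (simp add: schwartz_weight_def norm_mult)

lemma schwartz_weight_diff_le: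
  "sweight v0 p m (\<lambda>x. \<phi> x - \<psi> x) x \<le> sweight v0 p m \<phi> x + sweight v0 p m \<psi> x"
  using schwartz_weight_add_le[of v0 p m \<phi> "\<lambda>x. - \<psi> x" x] by (simp add: schwartz_weight_def)

text \<open>
  The polynomial factor changes by at most \<open>(1 + r)\<^sup>m\<close> over distance \<open>r\<close>; the exponential factor is
  handled by the supersolution property.
\<close>
lemma sphere_op_weight_le:
  assumes p: "1 \<le> p" "p \<le> 2" and N: "\<And>y. sweight v0 p m \<phi> y \<le> N"
  shows "sweight v0 p m (sphere_op r \<phi>) x \<le> N * (1 + real r) ^ (m + 1) * growth p ^ r"
proof -
  have N0: "0 \<le> N" using N[of v0] schwartz_weight_nonneg order_trans by blast
  let ?t = "\<lambda>x. 1 + real (tdist v0 x)"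
  have "?t x ^ m * cmod (sphere_op r \<phi> x) \<le> ?t x ^ m * sphere_op r (\<lambda>y. cmod (\<phi> y)) x"
    by (intro mult_left_mono norm_sphere_op_le) auto
  also have "\<dots> = sphere_op r (\<lambda>y. ?t x ^ m *\<^sub>R cmod (\<phi> y)) x"
    unfolding sphere_op_scaleR by simp
  also have "\<dots> \<le> sphere_op r (\<lambda>y. (N * (1 + real r) ^ m) *\<^sub>R decay v0 p y) x"
  proof (rule sphere_op_mono)
    fix y assume y: "tdist x y = r"
    have "tdist v0 x \<le> tdist v0 y + r" using dist_triangle[of v0 x y] dist_sym[of x y] y by simp
    then have "real (tdist v0 x) \<le> real (tdist v0 y) + real r" by linarith
    moreover have "(1 + real r) * ?t y = 1 + real r + real (tdist v0 y) + real r * real (tdist v0 y)"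
      by (simp add: algebra_simps)
    moreover have "0 \<le> real r * real (tdist v0 y)" by simp
    ultimately have "?t x \<le> (1 + real r) * ?t y" by linarith
    then have "?t x ^ m \<le> ((1 + real r) * ?t y) ^ m" by (intro power_mono) auto
    then have "?t x ^ m * cmod (\<phi> y) \<le> (1 + real r) ^ m * (?t y ^ m * cmod (\<phi> y))"
      using mult_right_mono[of _ _ "cmod (\<phi> y)"] by (fastforce simp: power_mult_distrib mult.assoc)
    also have "\<dots> \<le> (1 + real r) ^ m * (N * decay v0 p y)"
      using N[of y] unfolding schwartz_weight_le_iff by (intro mult_left_mono) auto
    finally show "?t x ^ m *\<^sub>R cmod (\<phi> y) \<le> (N * (1 + real r) ^ m) *\<^sub>R decay v0 p y"
        by (simp add: mult_ac)
  qed
  also have "\<dots> = (N * (1 + real r) ^ m) * sphere_op r (decay v0 p) x"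
    unfolding sphere_op_scaleR by simp
  also have "\<dots> \<le> (N * (1 + real r) ^ m) * (real (r + 1) * growth p ^ r * decay v0 p x)"
  proof (intro mult_left_mono)
    have "sphere_op r (decay v0 p) x \<le> chebU_op r (decay v0 p) x"
      by (rule sphere_op_le_chebU_op) simp
    also have "\<dots> \<le> real (r + 1) * growth p ^ r * decay v0 p x"
      by (rule chebU_op_supersolution[OF growth_ge_1[OF p] _ hecke_op_decay_le[OF p]]) simp
    finally show "sphere_op r (decay v0 p) x \<le> real (r + 1) * growth p ^ r * decay v0 p x" .
  qed (use N0 in simp)
  finally show ?thesis unfolding schwartz_weight_le_iff by (simp add: mult_ac add.commute)
qed

lemma chebU_op_weight_le:
  assumes p: "1 \<le> p" "p \<le> 2" and N: "\<And>y. sweight v0 p m \<phi> y \<le> N"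
  shows "sweight v0 p m (chebU_op r \<phi>) x \<le> N * (1 + real r) ^ (m + 2) * growth p ^ r"
proof (induction r arbitrary: x rule: less_induct)
  case (less r)
  note a = growth_ge_1[OF p]
  have N0: "0 \<le> N" using N[of v0] schwartz_weight_nonneg order_trans by blast
  have step: "N * (1 + real r) ^ (m + 1) * growth p ^ r \<le> N * (1 + real r) ^ (m + 2) * growth p ^ r"
    using N0 by (intro mult_right_mono mult_left_mono power_increasing) auto
  consider "r = 0" | "r = 1" | k where "r = Suc (Suc k)" by (metis One_nat_def not0_implies_Suc)
  then show ?case
  proof cases
    case 1
    then show ?thesis using N by simp
  next
    case 2
    then show ?thesis using sphere_op_weight_le[OF p N, of 1 x] step by (simp add: sphere_op_1)
  next
    case 3
    define s where "s = 1 + real r"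
    have s: "2 \<le> s" using 3 by (simp add: s_def)
    have "sweight v0 p m (chebU_op r \<phi>) x
      \<le> sweight v0 p m (sphere_op r \<phi>) x
          + sweight v0 p m (\<lambda>x. (1 / real q) *\<^sub>R chebU_op k \<phi> x) x"
      unfolding 3 chebU_op_sphere[abs_def] by (rule schwartz_weight_add_le)
    also have "\<dots> \<le> N * s ^ (m + 1) * growth p ^ r + 1 / 2 * (N * s ^ (m + 2) * growth p ^ r)"
    proof (rule add_mono)
      show "sweight v0 p m (sphere_op r \<phi>) x \<le> N * s ^ (m + 1) * growth p ^ r"
        unfolding s_def by (rule sphere_op_weight_le[OF p N])
      have "sweight v0 p m (\<lambda>x. (1 / real q) *\<^sub>R chebU_op k \<phi> x) x
         = (1 / real q) * sweight v0 p m (chebU_op k \<phi>) x"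
        by (simp add: schwartz_weight_def)
      also have "\<dots> \<le> 1 / 2 * (N * (1 + real k) ^ (m + 2) * growth p ^ k)"
        using less[of k x] 3 q_ge_2 schwartz_weight_nonneg by (intro mult_mono frac_le) auto
      also have "\<dots> \<le> 1 / 2 * (N * s ^ (m + 2) * growth p ^ r)"
        using 3 a N0 by (intro mult_left_mono mult_mono power_mono power_increasing) (auto simp: s_def)
      finally show "sweight v0 p m (\<lambda>x. (1 / real q) *\<^sub>R chebU_op k \<phi> x) x
          \<le> 1 / 2 * (N * s ^ (m + 2) * growth p ^ r)" .
    qed
    also have "N * s ^ (m + 1) * growth p ^ r \<le> 1 / 2 * (N * s ^ (m + 2) * growth p ^ r)"
    proof -
      have "(N * s ^ (m + 1) * growth p ^ r) * 2 \<le> (N * s ^ (m + 1) * growth p ^ r) * s"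
        using s N0 by (intro mult_left_mono) auto
      then show ?thesis by (simp add: mult_ac)
    qed
    finally show ?thesis by (simp add: s_def)
  qed
qed

lemma chebT_op_weight_le:
  assumes p: "1 \<le> p" "p \<le> 2" and N: "\<And>y. sweight v0 p m \<phi> y \<le> N"
  shows "sweight v0 p m (chebT_op r \<phi>) x \<le> 2 * N * (1 + real r) ^ (m + 2) * growth p ^ r"
proof -
  note a = growth_ge_1[OF p]
  note U = chebU_op_weight_le[OF p N]
  have N0: "0 \<le> N" using N[of v0] schwartz_weight_nonneg order_trans by blast
  consider "r = 0" | "r = 1" | k where "r = Suc (Suc k)" by (metis One_nat_def not0_implies_Suc)
  then show ?thesis
  proof cases
    case 1
    then show ?thesis using N[of x] by (simp add: schwartz_weight_def mult_ac)
  next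
    case 2
    have "0 \<le> N * (1 + real r) ^ (m + 2) * growth p ^ r" using N0 by simp
    then show ?thesis using U[of 1 x] 2 by simp
  next
    case 3
    have "sweight v0 p m (chebT_op r \<phi>) x
       \<le> sweight v0 p m (chebU_op r \<phi>) x + sweight v0 p m (chebU_op k \<phi>) x"
      unfolding 3 chebT_op_eq_chebU_op_diff by (rule schwartz_weight_diff_le)
    also have "\<dots> \<le> N * (1 + real r) ^ (m + 2) * growth p ^ r + N * (1 + real k) ^ (m + 2) * growth p ^ k"
      by (intro add_mono U)
    also have "N * (1 + real k) ^ (m + 2) * growth p ^ k \<le> N * (1 + real r) ^ (m + 2) * growth p ^ r"
      using 3 a N0 by (intro mult_left_mono mult_mono power_mono power_increasing) auto
    finally show ?thesis by simp
  qed
qed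

lemma schwartz_weight_le_seminorm:
  "\<phi> \<in> sspace v0 p \<Longrightarrow> sweight v0 p m \<phi> x \<le> snorm v0 p m \<phi>"
  unfolding schwartz_seminorm_def schwartz_space_def by (auto intro: cSUP_upper)

lemma schwartz_seminorm_le:
  "(\<And>x. sweight v0 p m \<phi> x \<le> N) \<Longrightarrow> snorm v0 p m \<phi> \<le> N"
  unfolding schwartz_seminorm_def by (rule cSUP_least) auto

lemma schwartz_spaceI:
  "(\<And>m. \<exists>N. \<forall>x. sweight v0 p m \<phi> x \<le> N) \<Longrightarrow> \<phi> \<in> sspace v0 p"
  unfolding schwartz_space_def bdd_above_def by auto

lemma schwartz_spaceD:
  assumes "\<phi> \<in> sspace v0 p"
  obtains N where "0 \<le> N" "\<And>x. sweight v0 p m \<phi> x \<le> N"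
  using schwartz_weight_le_seminorm[OF assms] order_trans[OF schwartz_weight_nonneg] by metis

lemma schwartz_space_add_scale:
  assumes "\<phi> \<in> sspace v0 p" "\<psi> \<in> sspace v0 p"
  shows "(\<lambda>x. a * \<phi> x + b * \<psi> x) \<in> sspace v0 p"
proof (rule schwartz_spaceI)
  fix m
  obtain N1 where N1: "\<And>x. sweight v0 p m \<phi> x \<le> N1" using schwartz_spaceD[OF assms(1)] by metis
  obtain N2 where N2: "\<And>x. sweight v0 p m \<psi> x \<le> N2" using schwartz_spaceD[OF assms(2)] by metis
  have "sweight v0 p m (\<lambda>x. a * \<phi> x + b * \<psi> x) x \<le> cmod a * N1 + cmod b * N2" for x
    using schwartz_weight_add_le[of v0 p m "\<lambda>x. a * \<phi> x" "\<lambda>x. b * \<psi> x" x]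
      mult_left_mono[OF N1 norm_ge_zero, of a x] mult_left_mono[OF N2 norm_ge_zero, of b x]
    unfolding schwartz_weight_scale by linarith
  then show "\<exists>N. \<forall>x. sweight v0 p m (\<lambda>x. a * \<phi> x + b * \<psi> x) x \<le> N" by blast
qed

lemma sphere_op_schwartz:
  assumes "1 \<le> p" "p \<le> 2" "\<phi> \<in> sspace v0 p"
  shows "sphere_op r \<phi> \<in> sspace v0 p"
proof (rule schwartz_spaceI)
  fix m
  obtain N where "\<And>x. sweight v0 p m \<phi> x \<le> N" using schwartz_spaceD[OF assms(3)] by metis
  from sphere_op_weight_le[OF assms(1,2) this]
  show "\<exists>N. \<forall>x. sweight v0 p m (sphere_op r \<phi>) x \<le> N" by blast
qed

lemma chebT_op_schwartz:
  assumes "1 \<le> p" "p \<le> 2" "\<phi> \<in> sspace v0 p"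
  shows "chebT_op r \<phi> \<in> sspace v0 p"
proof (rule schwartz_spaceI)
  fix m
  obtain N where "\<And>x. sweight v0 p m \<phi> x \<le> N" using schwartz_spaceD[OF assms(3)] by metis
  from chebT_op_weight_le[OF assms(1,2) this]
  show "\<exists>N. \<forall>x. sweight v0 p m (chebT_op r \<phi>) x \<le> N" by blast
qed

section \<open>Convolution with a radial Schwartz kernel\<close>

abbreviation strip_exponent :: "real \<Rightarrow> real" where
  "strip_exponent p \<equiv> (1/p - 1/2) * ln (real q)"

lemma strip_exponent_nonneg: "1 \<le> p \<Longrightarrow> p \<le> 2 \<Longrightarrow> 0 \<le> strip_exponent p"
  using q_pos by (intro mult_nonneg_nonneg) (auto simp: field_simps)

lemma growth_pow_eq_exp: "growth p ^ n = exp (strip_exponent p * real n)"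
  unfolding growth_pow using q_pos by (simp add: powr_def mult_ac)

text \<open>
  The case of constant functions in the recursion for sphere sums.
\<close>
lemma card_sphere: "real (card {y. tdist x y = Suc n}) = (real q + 1) * real q ^ n"
proof (induction n rule: less_induct)
  case (less n)
  have rec: "(real q + 1) * real (card {y. tdist x y = Suc k}) = real (card {y. tdist x y = Suc (Suc k)}) +
     (if k = 0 then real q + 1 else real q) * real (card {y. tdist x y = k})" for k
    using sum_sphere_hecke[of "\<lambda>_. 1 :: real" x k] degree by (cases "k = 0") (simp_all add: algebra_simps)
  have 1: "real (card {y. tdist x y = Suc 0}) = real q + 1"
    using degree[of x] dist_eq_1_iff[of x] by simp
  consider "n = 0" | "n = 1" | k where "n = Suc (Suc k)" by (metis One_nat_def not0_implies_Suc)
  then show ?case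
  proof cases
    case 1
    then show ?thesis using \<open>real (card {y. tdist x y = Suc 0}) = real q + 1\<close> by simp
  next
    case 2
    then show ?thesis using rec[of 0] 1 by (simp add: algebra_simps)
  next
    case 3
    have "real (card {y. tdist x y = Suc (Suc (Suc k))})
        = (real q + 1) * ((real q + 1) * real q ^ Suc k) - real q * ((real q + 1) * real q ^ k)"
      using rec[of "Suc k"] less[of "Suc k"] less[of k] 3 by simp
    then show ?thesis using 3 by (simp add: algebra_simps)
  qed
qed

lemma sphere_nonempty: "\<exists>y. tdist x y = n"
proof (cases n)
  case 0
  then show ?thesis by (intro exI[of _ x]) simp
next
  case (Suc m)
  have "0 < real (card {y. tdist x y = n})" unfolding Suc card_sphere using q_pos by simp
  then have "{y. tdist x y = n} \<noteq> {}" by (metis card.empty of_nat_0 less_irrefl)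
  then show ?thesis by blast
qed

lemma radial_value_dist: "radial adj v0 k \<Longrightarrow> radial_value adj v0 k (tdist v0 x) = k x"
  unfolding radial_value_def radial_def by (rule the_equality) (blast, metis)

text \<open>
  The coefficients of the kernel with respect to the normalised sphere operators.
\<close>
definition kernel_coeff :: "'a \<Rightarrow> ('a \<Rightarrow> complex) \<Rightarrow> nat \<Rightarrow> complex" where
  "kernel_coeff v0 k r = of_real (real q powr (real r / 2)) * radial_value adj v0 k r"

lemma kernel_coeff_decay:
  assumes k: "radial adj v0 k" "k \<in> sspace v0 p"
  shows "\<exists>C. \<forall>r. norm (kernel_coeff v0 k r)
      \<le> C * exp (- strip_exponent p * real r) / (1 + real r) ^ m"
proof -
  obtain N where N: "\<And>x. sweight v0 p m k x \<le> N" using schwartz_spaceD[OF k(2)] by metis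
  have "norm (kernel_coeff v0 k r) \<le> N * exp (- strip_exponent p * real r) / (1 + real r) ^ m" for r
  proof -
    obtain x where x: "tdist v0 x = r" using sphere_nonempty by blast
    have "(1 + real r) ^ m * cmod (k x) \<le> N * real q powr (- (real r / p))"
      using N[of x] x unfolding schwartz_weight_le_iff by simp
    then have "real q powr (real r / 2) * ((1 + real r) ^ m * cmod (k x))
        \<le> real q powr (real r / 2) * (N * real q powr (- (real r / p)))"
      by (intro mult_left_mono) auto
    also have "\<dots> = N * real q powr (real r / 2 + - (real r / p))" by (simp only: powr_add mult_ac)
    also have "real r / 2 + - (real r / p) = - (1/p - 1/2) * real r" by (simp add: algebra_simps)
    also have "real q powr (- (1/p - 1/2) * real r) = exp (- strip_exponent p * real r)"
      using q_pos by (simp add: powr_def algebra_simps)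
    finally have "(1 + real r) ^ m * norm (kernel_coeff v0 k r) \<le> N * exp (- strip_exponent p * real r)"
      using radial_value_dist[OF k(1), of x] x by (simp add: kernel_coeff_def norm_mult mult_ac)
    moreover have "0 < (1 + real r) ^ m" by simp
    ultimately show ?thesis by (simp add: pos_le_divide_eq mult.commute)
  qed
  then show ?thesis by blast
qed

lemma kernel_coeff_growth_summable:
  assumes k: "radial adj v0 k" "k \<in> sspace v0 p"
  shows "(\<lambda>r. norm (kernel_coeff v0 k r) * (N * (1 + real r) ^ m * growth p ^ r)) summable_on UNIV"
proof -
  obtain C where C: "\<And>r. norm (kernel_coeff v0 k r)
      \<le> C * exp (- strip_exponent p * real r) / (1 + real r) ^ (m + 2)"
    using kernel_coeff_decay[OF k] by blast
  have "(\<lambda>r::nat. C * (1 / (1 + real r)^2)) summable_on UNIV"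
    by (intro summable_on_cmult_right summable_on_nat_inverse_square)
  then have "(\<lambda>r. norm (kernel_coeff v0 k r) * ((1 + real r) ^ m * growth p ^ r)) summable_on UNIV"
  proof (rule summable_on_comparison_test)
    fix r :: nat
    define s where "s = 1 + real r"
    have s: "0 < s" by (simp add: s_def)
    have "norm (kernel_coeff v0 k r) * (s ^ m * growth p ^ r)
        \<le> (C * exp (- strip_exponent p * real r) / s ^ (m + 2)) * (s ^ m * growth p ^ r)"
      using C[of r] s by (intro mult_right_mono) (auto simp: s_def)
    also have "\<dots> = C * (1 / s^2)"
      unfolding growth_pow_eq_exp using s by (simp add: exp_minus power_add divide_simps power2_eq_square)
    finally show "norm (kernel_coeff v0 k r) * ((1 + real r) ^ m * growth p ^ r) \<le> C * (1 / (1 + real r)^2)"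
      by (simp add: s_def)
  qed simp
  then have "(\<lambda>r. N * (norm (kernel_coeff v0 k r) * ((1 + real r) ^ m * growth p ^ r))) summable_on UNIV"
    by (rule summable_on_cmult_right)
  then show ?thesis by (simp add: mult_ac)
qed

lemma convolution_has_sum:
  assumes p: "1 \<le> p" "p \<le> 2" and k: "radial adj v0 k" "k \<in> sspace v0 p"
    and \<phi>: "\<phi> \<in> sspace v0 p"
  shows "((\<lambda>r. kernel_coeff v0 k r * sphere_op r \<phi> x) has_sum convolution adj v0 \<phi> k x) UNIV"
proof -
  let ?b = "kernel_coeff v0 k"
  let ?S = "\<lambda>r. {y. tdist x y = r}"
  define F where "F = (\<lambda>(r, y). \<phi> y * radial_value adj v0 k r)"
  have b: "?b r * (real q powr (- real r / 2) *\<^sub>R z) = radial_value adj v0 k r * z" for r and z :: complex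
  proof -
    have "of_real (real q powr (real r / 2)) * of_real (real q powr (- real r / 2)) = (1 :: complex)"
      unfolding of_real_mult[symmetric] powr_add[symmetric] using q_pos by simp
    then show ?thesis unfolding kernel_coeff_def scaleR_conv_of_real
      by (metis (no_types, opaque_lifting) mult.assoc mult.commute mult_1)
  qed
  have inner: "((\<lambda>y. F (r, y)) has_sum ?b r * sphere_op r \<phi> x) (?S r)" for r
    unfolding sphere_op_def b
    by (rule has_sum_finiteI) (simp_all add: finite_sphere F_def sum_distrib_left mult.commute)
  obtain N where N: "0 \<le> N" "\<And>y. sweight v0 p 0 \<phi> y \<le> N" using schwartz_spaceD[OF \<phi>] by metis
  let ?\<phi> = "\<lambda>y. complex_of_real (cmod (\<phi> y))"
  have N': "sweight v0 p 0 ?\<phi> y \<le> N" for y using N(2)[of y] by (simp add: schwartz_weight_def)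
  have abs: "sphere_op r ?\<phi> x = of_real (sphere_op r (\<lambda>y. cmod (\<phi> y)) x)" for r
    by (simp add: sphere_op_def scaleR_conv_of_real)
  have "(\<lambda>z. norm (F z)) summable_on Sigma UNIV ?S"
  proof (rule summable_on_SigmaI)
    fix r
    have "norm (radial_value adj v0 k r) = norm (?b r) * real q powr (- real r / 2)"
      using b[of r 1] by (metis mult.right_neutral norm_mult norm_scaleR norm_one abs_of_nonneg powr_ge_zero)
    then have "(\<Sum>y\<in>?S r. norm (F (r, y))) = norm (?b r) * sphere_op r (\<lambda>y. cmod (\<phi> y)) x"
      by (simp add: F_def norm_mult sum_distrib_right[symmetric] sphere_op_def mult_ac)
    then show "((\<lambda>y. norm (F (r, y))) has_sum norm (?b r) * sphere_op r (\<lambda>y. cmod (\<phi> y)) x)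
        (?S r)"
      by (intro has_sum_finiteI) (simp_all add: finite_sphere)
  next
    show "(\<lambda>r. norm (?b r) * sphere_op r (\<lambda>y. cmod (\<phi> y)) x) summable_on UNIV"
    proof (rule summable_on_comparison_test[OF kernel_coeff_growth_summable[OF k, of "N * decay v0 p x" 1]])
      fix r
      have pos: "0 \<le> sphere_op r (\<lambda>y. cmod (\<phi> y)) x"
          by (auto simp: sphere_op_def intro!: mult_nonneg_nonneg sum_nonneg)
      have "sweight v0 p 0 (sphere_op r ?\<phi>) x \<le> N * (1 + real r) ^ (0 + 1) * growth p ^ r"
        by (rule sphere_op_weight_le[OF p N'])
      then have "sphere_op r (\<lambda>y. cmod (\<phi> y)) x \<le> N * (1 + real r) * growth p ^ r * decay v0 p x"
        using pos unfolding schwartz_weight_le_iff abs by simp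
      then show "norm (?b r) * sphere_op r (\<lambda>y. cmod (\<phi> y)) x
          \<le> norm (?b r) * (N * decay v0 p x * (1 + real r) ^ 1 * growth p ^ r)"
        by (intro mult_left_mono) (simp_all add: mult_ac)
      show "0 \<le> norm (?b r) * sphere_op r (\<lambda>y. cmod (\<phi> y)) x" using pos by simp
    qed
  qed simp
  then have F: "(F has_sum infsum F (Sigma UNIV ?S)) (Sigma UNIV ?S)"
    by (rule has_sum_infsum[OF Infinite_Sum.abs_summable_summable])
  have bij: "bij_betw (\<lambda>y. (tdist x y, y)) UNIV (Sigma UNIV ?S)"
    by (rule bij_betwI[of _ _ _ snd]) auto
  have "((\<lambda>y. F (tdist x y, y)) has_sum infsum F (Sigma UNIV ?S)) UNIV"
    using has_sum_reindex_bij_betw[OF bij, of F] F by blast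
  then have "infsum F (Sigma UNIV ?S) = convolution adj v0 \<phi> k x"
    unfolding convolution_def F_def by (simp add: infsumI)
  then show ?thesis using has_sum_Sigma'[OF F inner] by simp
qed

lemma linear_functional_sum:
  assumes lin: "\<And>\<phi> \<psi> a b. \<phi> \<in> S \<Longrightarrow> \<psi> \<in> S
      \<Longrightarrow> T (\<lambda>x. a * \<phi> x + b * \<psi> x) = a * T \<phi> + b * (T \<psi> :: complex)"
    and S: "\<And>\<phi> \<psi> a b. \<phi> \<in> S \<Longrightarrow> \<psi> \<in> S
        \<Longrightarrow> (\<lambda>x. a * \<phi> x + b * \<psi> x) \<in> S"
    and f: "\<And>i. i \<in> I \<Longrightarrow> f i \<in> S" and ne: "\<phi>0 \<in> S" and I: "finite I"
  shows "(\<lambda>x::'c. \<Sum>i\<in>I. c i * f i x) \<in> S \<and> T (\<lambda>x. \<Sum>i\<in>I. c i * f i x)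
      = (\<Sum>i\<in>I. c i * T (f i))"
  using I f
proof (induction I rule: finite_induct)
  case empty
  show ?case using lin[OF ne ne, of 0 0] S[OF ne ne, of 0 0] by simp
next
  case (insert i I)
  then have IH: "(\<lambda>x. \<Sum>i\<in>I. c i * f i x) \<in> S" "T (\<lambda>x. \<Sum>i\<in>I. c i * f i x)
      = (\<Sum>i\<in>I. c i * T (f i))" "f i \<in> S"
    by auto
  show ?case using lin[OF IH(3,1), of "c i" 1] S[OF IH(3,1), of "c i" 1] insert.hyps IH(2) by simp
qed

text \<open>
  The expansion of a convolution into sphere operators converges in every Schwartz seminorm, since
  the rapidly decreasing coefficients compensate the growth of the operators. So a functional that is
  bounded by one seminorm may be applied term by term.
\<close>
lemma functional_of_convolution_has_sum:
  assumes p: "1 \<le> p" "p \<le> 2" and k: "radial adj v0 k" "k \<in> sspace v0 p"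
    and \<phi>: "\<phi> \<in> sspace v0 p" and conv: "convolution adj v0 \<phi> k \<in> sspace v0 p"
    and lin: "\<And>\<phi> \<psi> a b. \<phi> \<in> sspace v0 p
        \<Longrightarrow> \<psi> \<in> sspace v0 p \<Longrightarrow>
      T (\<lambda>x. a * \<phi> x + b * \<psi> x) = a * T \<phi> + b * T \<psi>"
    and bound: "\<And>\<phi>. \<phi> \<in> sspace v0 p
        \<Longrightarrow> cmod (T \<phi>) \<le> M * snorm v0 p m \<phi>"
    and M: "0 \<le> M"
  shows "((\<lambda>r. kernel_coeff v0 k r * T (sphere_op r \<phi>)) has_sum T (convolution adj v0 \<phi> k)) UNIV"
proof -
  let ?b = "kernel_coeff v0 k" and ?S = "sspace v0 p"
  obtain N where N: "0 \<le> N" "\<And>y. sweight v0 p m \<phi> y \<le> N" using schwartz_spaceD[OF \<phi>] by metis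
  define B where "B = (\<lambda>r. norm (?b r) * (N * (1 + real r) ^ (m + 1) * growth p ^ r))"
  have B: "B summable_on UNIV" unfolding B_def by (rule kernel_coeff_growth_summable[OF k])
  have B_bound: "sweight v0 p m (\<lambda>x. ?b r * sphere_op r \<phi> x) x \<le> B r" for r x
    unfolding schwartz_weight_scale B_def by (intro mult_left_mono sphere_op_weight_le p N(2)) auto
  have "((\<lambda>L. (\<Sum>r\<in>L. ?b r * T (sphere_op r \<phi>)) - T (convolution adj v0 \<phi> k))
      \<longlongrightarrow> 0) (finite_subsets_at_top UNIV)"
  proof (rule Lim_null_comparison)
    have "(sum B \<longlongrightarrow> infsum B UNIV) (finite_subsets_at_top UNIV)"
      using has_sum_infsum[OF B] unfolding has_sum_def .
    from tendsto_mult_left[OF tendsto_diff[OF tendsto_const this, of "infsum B UNIV"], of M]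
    show "((\<lambda>L. M * (infsum B UNIV - sum B L)) \<longlongrightarrow> 0) (finite_subsets_at_top UNIV)" by simp
    have "norm ((\<Sum>r\<in>L. ?b r * T (sphere_op r \<phi>)) - T (convolution adj v0 \<phi> k))
        \<le> M * (infsum B UNIV - sum B L)"
      if L: "finite L" for L
    proof -
      define \<psi> where "\<psi> = (\<lambda>x. \<Sum>r\<in>L. ?b r * sphere_op r \<phi> x)"
      have \<psi>: "\<psi> \<in> ?S" "T \<psi> = (\<Sum>r\<in>L. ?b r * T (sphere_op r \<phi>))"
      proof -
        have "(\<lambda>x. \<Sum>r\<in>L. ?b r * sphere_op r \<phi> x) \<in> ?S \<and>
          T (\<lambda>x. \<Sum>r\<in>L. ?b r * sphere_op r \<phi> x) = (\<Sum>r\<in>L. ?b r * T (sphere_op r \<phi>))"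
          by (rule linear_functional_sum[where S = ?S, OF lin _ _ \<phi> L])
             (simp_all add: schwartz_space_add_scale sphere_op_schwartz[OF p \<phi>])
        then show "\<psi> \<in> ?S" "T \<psi> = (\<Sum>r\<in>L. ?b r * T (sphere_op r \<phi>))"
            by (simp_all add: \<psi>_def)
      qed
      have "sweight v0 p m (\<lambda>x. 1 * \<psi> x + (- 1) * convolution adj v0 \<phi> k x) x
          \<le> infsum B UNIV - sum B L" for x
      proof -
        define W where "W = (1 + real (tdist v0 x)) ^ m * real q powr (real (tdist v0 x) / p)"
        have W: "0 \<le> W" by (simp add: W_def)
        have "((\<lambda>r. ?b r * sphere_op r \<phi> x) has_sum (convolution adj v0 \<phi> k x - \<psi> x))
            (UNIV - L)"
          using convolution_has_sum[OF p k \<phi>, of x] L unfolding \<psi>_def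
              by (intro has_sum_Diff has_sum_finite) auto
        then have "((\<lambda>r. of_real W * (?b r * sphere_op r \<phi> x))
            has_sum of_real W * (convolution adj v0 \<phi> k x - \<psi> x)) (UNIV - L)"
          by (rule has_sum_cmult_right)
        moreover have "(B has_sum (infsum B UNIV - sum B L)) (UNIV - L)"
          using L by (intro has_sum_Diff has_sum_finite has_sum_infsum B) auto
        moreover have "norm (of_real W * (?b r * sphere_op r \<phi> x)) \<le> B r" for r
          using B_bound[of r x] W unfolding schwartz_weight_def W_def[symmetric] by (simp add: norm_mult)
        ultimately have "norm (of_real W * (convolution adj v0 \<phi> k x - \<psi> x)) \<le> infsum B UNIV - sum B L"
          by (rule norm_infsum_le)
        then show ?thesis
          using W by (simp add: schwartz_weight_def W_def[symmetric] norm_mult norm_minus_commute)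
      qed
      then have "M * snorm v0 p m (\<lambda>x. 1 * \<psi> x + (- 1) * convolution adj v0 \<phi> k x)
          \<le> M * (infsum B UNIV - sum B L)"
        by (intro mult_left_mono schwartz_seminorm_le M)
      moreover have "cmod (T (\<lambda>x. 1 * \<psi> x + (- 1) * convolution adj v0 \<phi> k x))
          \<le> M * snorm v0 p m (\<lambda>x. 1 * \<psi> x + (- 1) * convolution adj v0 \<phi> k x)"
        by (rule bound[OF schwartz_space_add_scale[OF \<psi>(1) conv]])
      moreover have "T (\<lambda>x. 1 * \<psi> x + (- 1) * convolution adj v0 \<phi> k x)
          = (\<Sum>r\<in>L. ?b r * T (sphere_op r \<phi>)) - T (convolution adj v0 \<phi> k)"
        using lin[OF \<psi>(1) conv, of 1 "- 1"] \<psi>(2) by simp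
      ultimately show ?thesis by simp
    qed
    then show "\<forall>\<^sub>F L in finite_subsets_at_top UNIV. norm
        ((\<Sum>r\<in>L. ?b r * T (sphere_op r \<phi>)) - T (convolution adj v0 \<phi> k))
            \<le> M * (infsum B UNIV - sum B L)"
      by (intro eventually_finite_subsets_at_top_weakI) auto
  qed
  then show ?thesis unfolding has_sum_def by (rule LIM_zero_cancel)
qed

section \<open>Spherical functions as Laurent polynomials\<close>

lemma geodesic_path_props:
  shows "successively adj (geodesic_path adj v x)" (is ?A)
    and "length (geodesic_path adj v x) = tdist v x + 1" (is ?B)
    and "hd (geodesic_path adj v x) = v" (is ?C)
    and "last (geodesic_path adj v x) = x" (is ?D)
    and geodesic_path_dist: "i \<le> tdist v x \<Longrightarrow> tdist v (geodesic_path adj v x ! i) = i"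
proof -
  define P where "P = (\<lambda>vs. successively adj vs \<and> length vs = tdist v x + 1 \<and> hd vs = v
      \<and> last vs = x)"
  have dist_nth: "tdist v (vs ! i) = i" if vs: "P vs" and i: "i \<le> tdist v x" for vs i
  proof -
    have len: "length vs = tdist v x + 1"
        and adj: "\<And>j. Suc j < length vs \<Longrightarrow> adj (vs ! j) (vs ! Suc j)"
      using vs by (auto simp: P_def successively_conv_nth)
    have ne: "vs \<noteq> []" using len by auto
    have v: "vs ! 0 = v" using vs hd_conv_nth[OF ne] by (simp add: P_def)
    have x: "vs ! tdist v x = x" using vs last_conv_nth[OF ne] len by (simp add: P_def)
    have up: "tdist v (vs ! j) \<le> j" if "j \<le> tdist v x" for j
      using that
    proof (induction j)
      case (Suc j)
      then show ?case using dist_adj_le[OF adj[of j], of v] len by simp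
    qed (simp add: v)
    have "tdist v x \<le> tdist v (vs ! i) + (tdist v x - i)"
      using i
    proof (induction "tdist v x - i" arbitrary: i)
      case 0
      then show ?case using x by simp
    next
      case (Suc n)
      then have "tdist v x \<le> tdist v (vs ! Suc i) + (tdist v x - Suc i)" by simp
      moreover have "tdist v (vs ! Suc i) \<le> Suc (tdist v (vs ! i))"
        using Suc.hyps(2) len by (intro dist_adj_le adj) simp
      ultimately show ?case using Suc.hyps(2) by simp
    qed
    then show ?thesis using up[OF i] i by linarith
  qed
  obtain w where w: "w 0 = v" "w (tdist v x) = x" "\<And>i. i < tdist v x \<Longrightarrow> adj (w i) (w (Suc i))"
    "\<And>i. i \<le> tdist v x \<Longrightarrow> tdist v (w i) = i" using geodesic by blast
  define u where "u = map w [0..<tdist v x + 1]"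
  have u: "length u = tdist v x + 1" "\<And>i. i \<le> tdist v x \<Longrightarrow> u ! i = w i"
    by (simp_all add: u_def del: upt_Suc)
  have u_ne: "u \<noteq> []" using u(1) by auto
  have Pw: "P u"
    unfolding P_def successively_conv_nth hd_conv_nth[OF u_ne] last_conv_nth[OF u_ne] using u w by simp
  have unique: "vs = us" if "P vs" "P us" for vs us
  proof (rule nth_equalityI)
    have len: "length vs = tdist v x + 1" "length us = tdist v x + 1" using that by (auto simp: P_def)
    then show "length vs = length us" by simp
    have "vs ! (tdist v x - j) = us ! (tdist v x - j)" if "j \<le> tdist v x" for j
      using that
    proof (induction j)
      case 0
      have "vs \<noteq> []" "us \<noteq> []" using len by auto
      then show ?case using \<open>P vs\<close> \<open>P us\<close> len last_conv_nth[of vs] last_conv_nth[of us]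
          by (simp add: P_def)
    next
      case (Suc j)
      define i where "i = tdist v x - Suc j"
      have i: "tdist v x - j = Suc i" "Suc i \<le> tdist v x" using Suc.prems by (auto simp: i_def)
      have eq: "vs ! Suc i = us ! Suc i" using Suc i by simp
      have "adj (vs ! i) (vs ! Suc i)" "adj (us ! i) (us ! Suc i)"
        using \<open>P vs\<close> \<open>P us\<close> i len by (auto simp: P_def successively_conv_nth)
      then have "adj (vs ! Suc i) (vs ! i)" "adj (vs ! Suc i) (us ! i)" using adj_sym eq by auto
      moreover have "tdist v (vs ! Suc i) = Suc (tdist v (vs ! i))" "tdist v (vs ! Suc i) = Suc (tdist v (us ! i))"
        using dist_nth[OF \<open>P vs\<close>] dist_nth[OF \<open>P us\<close>] i by simp_all
      ultimately have "vs ! i = us ! i" by (rule unique_parent)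
      then show ?case by (simp add: i_def)
    qed
    note * = this
    fix i assume "i < length vs"
    then show "vs ! i = us ! i" using *[of "tdist v x - i"] len by simp
  qed
  have "P (geodesic_path adj v x)"
    unfolding geodesic_path_def P_def[symmetric] using theI'[of P] Pw unique by blast
  then show ?A ?B ?C ?D "i \<le> tdist v x \<Longrightarrow> tdist v (geodesic_path adj v x ! i) = i"
    using dist_nth by (auto simp: P_def)
qed

lemma boundary_dist:
  assumes "\<omega> \<in> boundary adj v0"
  shows "tdist v0 (\<omega> n) = n"
proof -
  have "\<omega> 0 = v0" "tdist (\<omega> 0) (\<omega> n) = n - 0" using assms unfolding boundary_def by blast+
  then show ?thesis by simp
qed

lemma boundary_adj:
  assumes "\<omega> \<in> boundary adj v0"
  shows "adj (\<omega> n) (\<omega> (Suc n))"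
proof -
  have "n \<le> Suc n \<longrightarrow> tdist (\<omega> n) (\<omega> (Suc n)) = Suc n - n" using assms
      unfolding boundary_def by blast
  then have "tdist (\<omega> n) (\<omega> (Suc n)) = 1" by simp
  then show ?thesis using dist_eq_1_iff by blast
qed

text \<open>
  A ray and a geodesic from the root share an initial segment and nothing else, because parents are
  unique. So the confluence reaches level \<open>i\<close> iff both agree there.
\<close>
lemma confluence_ge_iff:
  assumes \<omega>: "\<omega> \<in> boundary adj v0" and i: "i \<le> tdist v0 x"
  shows "i \<le> tdist v0 (confluence adj v0 x \<omega>) \<longleftrightarrow> \<omega> i
      = geodesic_path adj v0 x ! i"
    and "tdist v0 (confluence adj v0 x \<omega>) \<le> tdist v0 x"
proof -
  define vs where "vs = geodesic_path adj v0 x"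
  define n where "n = tdist v0 x"
  have len: "length vs = n + 1" and adj: "\<And>j. j < n \<Longrightarrow> adj (vs ! j) (vs ! Suc j)"
      and v: "vs ! 0 = v0"
  proof -
    show len: "length vs = n + 1" unfolding vs_def n_def by (rule geodesic_path_props(2))
    show "adj (vs ! j) (vs ! Suc j)" if "j < n" for j
      using geodesic_path_props(1)[of v0 x] that len unfolding vs_def[symmetric] successively_conv_nth by simp
    have "vs \<noteq> []" using len by auto
    then show "vs ! 0 = v0" using geodesic_path_props(3)[of v0 x] hd_conv_nth[of vs] by (simp add: vs_def)
  qed
  have d: "tdist v0 (vs ! j) = j" if "j \<le> n" for j using geodesic_path_dist that by (simp add: vs_def n_def)
  have down: "\<omega> j = vs ! j" if "\<omega> (Suc j) = vs ! Suc j" "j < n" for j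
  proof (rule unique_parent[of "\<omega> (Suc j)" _ _ v0])
    show "adj (\<omega> (Suc j)) (\<omega> j)" using boundary_adj[OF \<omega>] adj_sym by blast
    show "adj (\<omega> (Suc j)) (vs ! j)" using adj[OF that(2)] adj_sym that(1) by simp
    show "tdist v0 (\<omega> (Suc j)) = Suc (tdist v0 (\<omega> j))" using boundary_dist[OF \<omega>] by simp
    show "tdist v0 (\<omega> (Suc j)) = Suc (tdist v0 (vs ! j))" using boundary_dist[OF \<omega>] d that by simp
  qed
  have mono: "\<omega> j = vs ! j" if "\<omega> k = vs ! k" "j \<le> k" "k \<le> n" for j k
    using that(2,1,3) by (induction rule: inc_induct) (auto intro: down)
  define J where "J = Max {j. j \<le> n \<and> \<omega> j = vs ! j}"
  have J0: "\<omega> 0 = vs ! 0" using \<omega> v by (simp add: boundary_def)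
  have "J \<in> {j. j \<le> n \<and> \<omega> j = vs ! j}" unfolding J_def by (rule Max_in) (use J0 in auto)
  then have J: "J \<le> n" "\<omega> J = vs ! J" by auto
  have iff: "\<omega> j = vs ! j \<longleftrightarrow> j \<le> J" if "j \<le> n" for j
  proof
    assume "\<omega> j = vs ! j"
    then show "j \<le> J" unfolding J_def using that by (intro Max_ge) auto
  qed (use mono J in blast)
  have range: "vs ! j \<in> range \<omega> \<longleftrightarrow> j \<le> J" if j: "j \<le> n" for j
  proof
    assume "vs ! j \<in> range \<omega>"
    then obtain k where k: "vs ! j = \<omega> k" by blast
    then have "k = j" using d[OF j] boundary_dist[OF \<omega>] by metis
    then show "j \<le> J" using k iff[OF j] by simp
  next
    assume "j \<le> J"
    then show "vs ! j \<in> range \<omega>" using iff[OF j] by (metis rangeI)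
  qed
  have "filter (\<lambda>u. u \<in> range \<omega>) (take (Suc J) vs) = take (Suc J) vs"
    using range J(1) len by (auto simp: filter_id_conv in_set_conv_nth)
  moreover have "filter (\<lambda>u. u \<in> range \<omega>) (drop (Suc J) vs) = []"
    unfolding filter_empty_conv
  proof
    fix u assume "u \<in> set (drop (Suc J) vs)"
    then obtain j where j: "j < length vs - Suc J" "u = vs ! (Suc J + j)" by (auto simp: in_set_conv_nth)
    then show "u \<notin> range \<omega>" using range[of "Suc J + j"] len by simp
  qed
  ultimately have "filter (\<lambda>u. u \<in> range \<omega>) vs = take (Suc J) vs"
    by (metis append.right_neutral append_take_drop_id filter_append)
  moreover have "take (Suc J) vs \<noteq> []" using len by auto
  ultimately have "confluence adj v0 x \<omega> = vs ! J"
    using J(1) len by (simp add: confluence_def vs_def[symmetric] last_conv_nth)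
  then have c: "tdist v0 (confluence adj v0 x \<omega>) = J" using d J(1) by simp
  show "i \<le> tdist v0 (confluence adj v0 x \<omega>) \<longleftrightarrow> \<omega> i = geodesic_path adj v0 x ! i"
    unfolding c using iff i by (simp add: vs_def n_def)
  show "tdist v0 (confluence adj v0 x \<omega>) \<le> tdist v0 x" unfolding c using J(1) by (simp add: n_def)
qed

lemma boundary_cylinder_eq: "boundary_cylinder adj v0 x = {\<omega> \<in> boundary adj v0. \<omega> (tdist v0 x) = x}"
proof -
  have last: "geodesic_path adj v0 x ! tdist v0 x = x"
    using geodesic_path_props(2,4)[of v0 x] last_conv_nth[of "geodesic_path adj v0 x"] by force
  have "tdist v0 (confluence adj v0 x \<omega>) = tdist v0 x \<longleftrightarrow> \<omega> (tdist v0 x) = x"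
      if "\<omega> \<in> boundary adj v0" for \<omega>
    using confluence_ge_iff[OF that, of "tdist v0 x" x] last by fastforce
  then show ?thesis unfolding boundary_cylinder_def by blast
qed


lemma boundary_cylinder_sets:
  assumes "is_boundary_measure q adj v0 \<nu>"
  shows "boundary_cylinder adj v0 x \<in> sets \<nu>"
proof -
  have "openin (boundary_topology adj v0) (boundary_cylinder adj v0 x)"
    unfolding boundary_topology_def by (rule topology_generated_by_Basis) simp
  then have "boundary_cylinder adj v0 x \<in> sigma_sets (boundary adj v0) {U. openin (boundary_topology adj v0) U}"
    by (intro sigma_sets.Basic) simp
  then show ?thesis using assms by (simp add: is_boundary_measure_def)
qed

text \<open>
  Abel summation, used to pass from the measures of the nested events \<open>{i \<le> \<bar>c\<bar>}\<close> to those of the disjoint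
  events \<open>{i = \<bar>c\<bar>}\<close>.
\<close>
lemma sum_by_parts:
  fixes h m :: "nat \<Rightarrow> 'c::comm_ring_1"
  shows "h 0 + (\<Sum>i\<le>N. (h (Suc i) - h i) * m i)
      = h 0 * (1 - m 0) + (\<Sum>i<N. h (Suc i) * (m i - m (Suc i))) + h (Suc N) * m N"
  by (induction N) (simp_all add: algebra_simps)

text \<open>
  The Poisson kernel depends on the boundary point only through the level \<open>\<bar>c\<bar>\<close> of the confluence, and
  \<open>{i \<le> \<bar>c\<bar>}\<close> is the cylinder of the vertex of level \<open>i\<close> on the geodesic to \<open>x\<close>. Telescoping in \<open>i\<close>
  expresses the integrand through indicators of these cylinders.
\<close>
lemma spherical_function_sum:
  assumes \<nu>: "is_boundary_measure q adj v0 \<nu>" and n: "tdist v0 x = n"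
    and h: "h = (\<lambda>i. complex_of_real (real q powi (2 * int i - int n)) powr (1/2 + \<i> * z))"
  shows "spherical_function q adj v0 \<nu> z x
      = h 0 + (\<Sum>i<n. (h (Suc i) - h i) * of_real (1 / ((real q + 1) * real q ^ i)))"
proof -
  interpret prob_space \<nu> using \<nu> by (simp add: is_boundary_measure_def)
  have space: "space \<nu> = boundary adj v0" using \<nu> by (simp add: is_boundary_measure_def)
  define vs where "vs = geodesic_path adj v0 x"
  define cyl where "cyl = (\<lambda>i. boundary_cylinder adj v0 (vs ! i))"
  have d: "tdist v0 (vs ! i) = i" if "i \<le> n" for i using geodesic_path_dist that by (simp add: vs_def n)
  have cyl_sets: "cyl i \<in> sets \<nu>" for i unfolding cyl_def by (rule boundary_cylinder_sets[OF \<nu>])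
  have cyl_measure: "measure \<nu> (cyl (Suc i)) = 1 / ((real q + 1) * real q ^ i)" if "i < n" for i
  proof -
    have "tdist v0 (vs ! Suc i) = Suc i" using d that by simp
    then show ?thesis using \<nu> unfolding is_boundary_measure_def cyl_def
      by (metis One_nat_def diff_Suc_1 le_add1 plus_1_eq_Suc)
  qed
  have cyl_iff: "\<omega> \<in> cyl i \<longleftrightarrow> i \<le> tdist v0 (confluence adj v0 x \<omega>)"
      if "\<omega> \<in> boundary adj v0" "i \<le> n" for \<omega> i
    using confluence_ge_iff(1)[OF that(1), of i x] that d[OF that(2)] n
        by (simp add: cyl_def boundary_cylinder_eq vs_def)
  have "complex_of_real (poisson_kernel q adj v0 x \<omega>) powr (1/2 + \<i> * z)
      = h 0 + (\<Sum>i<n. (h (Suc i) - h i) * indicator (cyl (Suc i)) \<omega>)"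
          if \<omega>: "\<omega> \<in> space \<nu>" for \<omega>
  proof -
    define c where "c = tdist v0 (confluence adj v0 x \<omega>)"
    have \<omega>': "\<omega> \<in> boundary adj v0" using \<omega> space by simp
    have c: "c \<le> n" using confluence_ge_iff(2)[OF \<omega>', of 0 x] by (simp add: c_def n)
    have "(\<Sum>i<n. (h (Suc i) - h i) * indicator (cyl (Suc i)) \<omega>)
        = (\<Sum>i<n. if i < c then h (Suc i) - h i else 0)"
      using cyl_iff[OF \<omega>'] by (intro sum.cong refl) (auto simp: indicator_def c_def Suc_le_eq)
    also have "\<dots> = (\<Sum>i<c. h (Suc i) - h i)"
      using c by (intro sum.mono_neutral_cong_right) auto
    also have "\<dots> = h c - h 0" by (rule sum_lessThan_telescope)
    finally show ?thesis by (simp add: h poisson_kernel_def c_def n)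
  qed
  then have "spherical_function q adj v0 \<nu> z x
      = (\<integral>\<omega>. h 0 + (\<Sum>i<n. (h (Suc i) - h i) * indicator (cyl (Suc i)) \<omega>)
          \<partial>\<nu>)"
    unfolding spherical_function_def by (intro Bochner_Integration.integral_cong refl)
  also have "\<dots> = h 0 + (\<Sum>i<n. (h (Suc i) - h i) * of_real (measure \<nu> (cyl (Suc i))))"
  proof -
    have "has_bochner_integral \<nu> (\<lambda>\<omega>. h 0) (h 0)"
        by (simp add: has_bochner_integral_iff prob_space)
    moreover have "has_bochner_integral \<nu>
        (\<lambda>\<omega>. \<Sum>i<n. indicator (cyl (Suc i)) \<omega> *\<^sub>R (h (Suc i) - h i))
      (\<Sum>i<n. measure \<nu> (cyl (Suc i)) *\<^sub>R (h (Suc i) - h i))"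
      by (intro has_bochner_integral_sum has_bochner_integral_indicator cyl_sets) (simp add: less_top[symmetric])
    ultimately have "has_bochner_integral \<nu>
        (\<lambda>\<omega>. h 0 + (\<Sum>i<n. indicator (cyl (Suc i)) \<omega> *\<^sub>R (h (Suc i) - h i)))
      (h 0 + (\<Sum>i<n. measure \<nu> (cyl (Suc i)) *\<^sub>R (h (Suc i) - h i)))"
      by (rule has_bochner_integral_add)
    from has_bochner_integral_integral_eq[OF this] show ?thesis
      by (simp only: scaleR_conv_of_real of_real_indicator mult.commute)
  qed
  also have "\<dots> = h 0 + (\<Sum>i<n. (h (Suc i) - h i) * of_real (1 / ((real q + 1) * real q ^ i)))"
    using cyl_measure by simp
  finally show ?thesis .
qed

lemma poisson_power:
  "complex_of_real (real q powi k) powr (1/2 + \<i> * z)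
      = of_real (real q powr (real_of_int k / 2)) * exp (of_int k * (\<i> * z * of_real (ln (real q))))"
proof -
  have k: "real q powi k = real q powr (real_of_int k)" using q_pos by (simp add: powr_real_of_int')
  have pos: "0 < real q powi k" using q_pos by simp
  have "complex_of_real r powr w = exp (w * of_real (ln r))" if "0 < r" for r w
    using that by (simp add: powr_def Ln_of_real)
  from this[OF pos]
  have "complex_of_real (real q powi k) powr (1/2 + \<i> * z)
      = exp ((1/2 + \<i> * z) * of_real (ln (real q powi k)))" .
  also have "ln (real q powi k) = real_of_int k * ln (real q)" unfolding k using q_pos by (simp add: ln_powr)
  also have "exp ((1/2 + \<i> * z) * of_real (real_of_int k * ln (real q)))
    = exp (of_real (real_of_int k / 2 * ln (real q))) * exp (of_int k * (\<i> * z * of_real (ln (real q))))"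
    unfolding mult_exp_exp by (simp add: algebra_simps)
  also have "exp (of_real (real_of_int k / 2 * ln (real q))) = complex_of_real (real q powr (real_of_int k / 2))"
  proof -
    have "real q powr (real_of_int k / 2) = exp (real_of_int k / 2 * ln (real q))" using q_pos by (simp add: powr_def)
    then show ?thesis by (simp only: exp_of_real)
  qed
  finally show ?thesis .
qed

text \<open>
  Multiplied by the size of the sphere and normalised, the spherical function is the symbol of the
  sphere operator: the powers of \<open>q\<close> in the measure of a cylinder and in the Poisson kernel cancel.
\<close>
lemma spherical_function_laurent:
  assumes \<nu>: "is_boundary_measure q adj v0 \<nu>" and n: "tdist v0 x = n"
  shows "of_real (real q powr (- real n / 2) * real (card {y. tdist v0 y = n}))
      * spherical_function q adj v0 \<nu> z x
    = (\<Sum>i\<le>n. of_real (laurent_coeff n i)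
        * exp (of_int (int n - 2 * int i) * (\<i> * z * of_real (ln (real q)))))"
proof -
  define s where "s = \<i> * z * of_real (ln (real q))"
  define h where "h = (\<lambda>i. complex_of_real (real q powi (2 * int i - int n)) powr (1/2 + \<i> * z))"
  define G where "G = (\<lambda>i. exp (of_int (2 * int i - int n) * s))"
  have hG: "h i = of_real (real q powr (real i - real n / 2)) * G i" for i
    unfolding h_def poisson_power G_def s_def by (simp add: diff_divide_distrib)
  note \<phi> = spherical_function_sum[OF \<nu> n h_def]
  have rev: "(\<Sum>i\<le>n. of_real (laurent_coeff n i) * exp (of_int (int n - 2 * int i) * s))
      = (\<Sum>i\<le>n. of_real (laurent_coeff n i) * G i)"
    by (rule sum.reindex_bij_witness[of _ "\<lambda>i. n - i" "\<lambda>i. n - i"])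
        (auto simp: G_def laurent_coeff_def of_nat_diff algebra_simps)
  have "of_real (real q powr (- real n / 2) * real (card {y. tdist v0 y = n})) * spherical_function q adj v0 \<nu> z x
      = (\<Sum>i\<le>n. of_real (laurent_coeff n i) * G i)"
  proof (cases n)
    case 0
    then show ?thesis using \<phi> q_pos by (simp add: h_def G_def laurent_coeff_def)
  next
    case (Suc N)
    define m where "m = (\<lambda>i. 1 / ((real q + 1) * real q ^ i))"
    define P where "P = real q powr (- real n / 2) * ((real q + 1) * real q ^ N)"
    have \<phi>': "spherical_function q adj v0 \<nu> z x
        = h 0 * (1 - of_real (m 0)) + (\<Sum>i<N. h (Suc i) * (of_real (m i) - of_real (m (Suc i)))) + h (Suc N)
            * of_real (m N)"
    proof -
      have "1 / ((real q + 1) * real q ^ i) = m i" for i by (simp add: m_def)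
      then show ?thesis
        unfolding \<phi> Suc lessThan_Suc_atMost by (simp only: sum_by_parts[where m = "\<lambda>i. of_real (m i)"])
    qed
    have qN: "real q powr (- real n / 2) * real q powr (real i - real n / 2) = real q powr (real i - real n)" for i
      by (simp add: powr_add[symmetric])
    have pow: "real q powr (real i - real n) * real q ^ n = real q ^ i" for i
      using q_pos by (simp add: powr_diff powr_realpow)
    have q1: "real q + 1 \<noteq> 0" using q_pos by linarith
    have c0: "P * (1 - m 0) * real q powr (real 0 - real n / 2) = 1"
    proof -
      have "P * (1 - m 0) * real q powr (real 0 - real n / 2)
          = (real q powr (- real n / 2) * real q powr (real 0 - real n / 2))
              * (real q ^ N * ((real q + 1) * (1 - m 0)))"
        by (simp add: P_def)
      also have "(real q + 1) * (1 - m 0) = real q" using q1 by (simp add: m_def field_simps)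
      finally show ?thesis unfolding qN using pow[of 0] Suc by (simp add: mult_ac)
    qed
    have c1: "P * (m i - m (Suc i)) * real q powr (real (Suc i) - real n / 2) = 1 - 1 / real q" if i: "i < N" for i
    proof -
      have "P * (m i - m (Suc i)) * real q powr (real (Suc i) - real n / 2)
          = real q powr (real (Suc i) - real n) * (real q ^ N * ((real q + 1) * (m i - m (Suc i))))"
        unfolding qN[symmetric] by (simp add: P_def)
      also have "(real q + 1) * (m i - m (Suc i)) = (1 - 1 / real q) / real q ^ i"
      proof -
        have "(real q + 1) * m i = 1 / real q ^ i" for i using q1 by (simp add: m_def)
        then show ?thesis unfolding right_diff_distrib by (simp add: diff_divide_distrib)
      qed
      also have "real q powr (real (Suc i) - real n) = real q ^ Suc i / real q ^ n"
        using pow[of "Suc i"] q_pos by (simp add: field_simps)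
      also have "real q ^ Suc i / real q ^ n * (real q ^ N * ((1 - 1 / real q) / real q ^ i)) = 1 - 1 / real q"
        using q_pos Suc by (simp add: field_simps)
      finally show ?thesis .
    qed
    have c2: "P * m N * real q powr (real (Suc N) - real n / 2) = 1"
    proof -
      have "P * m N = real q powr (- real n / 2)" using q1 q_pos by (simp add: P_def m_def)
      then show ?thesis using qN[of "Suc N"] Suc q_pos by simp
    qed
    have "of_real P * spherical_function q adj v0 \<nu> z x =
       of_real (P * (1 - m 0) * real q powr (real 0 - real n / 2)) * G 0
       + (\<Sum>i<N. of_real (P * (m i - m (Suc i)) * real q powr (real (Suc i) - real n / 2)) * G (Suc i))
       + of_real (P * m N * real q powr (real (Suc N) - real n / 2)) * G (Suc N)"
      unfolding \<phi>' hG by (simp only: distrib_left sum_distrib_left of_real_mult of_real_diff of_real_1 mult_ac)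
    also have "\<dots> = G 0 + (\<Sum>i<N. of_real (1 - 1 / real q) * G (Suc i)) + G (Suc N)"
      unfolding c0 c2 using c1 by simp
    also have "\<dots> = (\<Sum>i\<le>n. of_real (laurent_coeff n i) * G i)"
    proof -
      have "(\<Sum>i\<le>n. of_real (laurent_coeff n i) * G i) = of_real (laurent_coeff n 0) * G 0
         + (\<Sum>i<N. of_real (laurent_coeff n (Suc i)) * G (Suc i)) + of_real (laurent_coeff n n) * G n"
        unfolding Suc lessThan_Suc_atMost[symmetric] sum.lessThan_Suc_shift[of _ "Suc N"] by (simp add: add.assoc)
      moreover have "laurent_coeff n (Suc i) = 1 - 1 / real q" if "i < N" for i
        using that Suc by (simp add: laurent_coeff_def)
      ultimately show ?thesis using Suc by (simp add: laurent_coeff_def)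
    qed
    finally show ?thesis using card_sphere[of v0 N] Suc by (simp add: P_def)
  qed
  then show ?thesis using rev by (simp add: s_def)
qed

section \<open>Bounded orbits of tempered distributions\<close>

abbreviation symbol_coeff :: "'a \<Rightarrow> ('a \<Rightarrow> complex) \<Rightarrow> int \<Rightarrow> complex"
    where
  "symbol_coeff v0 k \<equiv> abel_transform (1 - 1 / real q) (kernel_coeff v0 k)"

lemma beta_bounds: "0 \<le> 1 - 1 / real q" "1 - 1 / real q \<le> 1"
  using q_pos by auto

lemma laurent_coeff_eq: "laurent_coeff r i = (if i = 0 \<or> i = r then 1 else 1 - 1 / real q)"
  by (simp add: laurent_coeff_def)

lemma strip_iff:
  assumes "1 \<le> p" "p \<le> 2"
  shows "z \<in> strip p \<longleftrightarrow> \<i> * z * of_real (ln (real q)) \<in> vstrip (strip_exponent p)"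
proof -
  have "0 < ln (real q)" using q_pos by simp
  moreover have "0 \<le> 1/p - 1/2" using assms by (simp add: field_simps)
  ultimately show ?thesis by (simp add: strip_def vstrip_def abs_mult)
qed

text \<open>
  Summing over spheres turns the spherical transform into the series of symbols of the sphere
  operators, and regrouping by powers of \<open>t = q\<^sup>i\<^sup>z\<close> gives a Laurent series.
\<close>
lemma spherical_transform_eq_laurent:
  assumes p: "1 \<le> p" "p \<le> 2" and \<nu>: "is_boundary_measure q adj v0 \<nu>"
    and k: "radial adj v0 k" "k \<in> sspace v0 p" and z: "z \<in> strip p"
  shows "spherical_transform q adj v0 \<nu> k z = laurent (symbol_coeff v0 k) (\<i> * z * of_real (ln (real q)))"
proof -
  let ?b = "kernel_coeff v0 k" and ?S = "\<lambda>r. {x. tdist v0 x = r}" and ?s = "\<i> * z * of_real (ln (real q))"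
  have s: "?s \<in> vstrip (strip_exponent p)" using strip_iff[OF p] z by simp
  define g where "g = (\<lambda>l::int. exp (of_int l * ?s))"
  define c where "c = (\<lambda>r. \<Sum>i\<le>r. of_real (if i = 0 \<or> i = r then 1 else 1 - 1 / real q)
      * g (int r - 2 * int i))"
  define F where "F = (\<lambda>(r::nat, x). k x * spherical_function q adj v0 \<nu> z x)"
  have val: "F (r, x) = ?b r * c r / of_nat (card (?S r))" if x: "tdist v0 x = r" for r x
  proof -
    have ne: "real (card (?S r)) \<noteq> 0"
      using x finite_sphere[of v0 r] card_0_eq[of "?S r"] by (auto simp del: card_0_eq)
    have "of_real (real q powr (- real r / 2) * real (card (?S r))) * spherical_function q adj v0 \<nu> z x = c r"
      unfolding spherical_function_laurent[OF \<nu> x] c_def g_def laurent_coeff_eq ..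
    then have "?b r * c r = (of_real (real q powr (real r / 2)) * of_real (real q powr (- real r / 2)))
        * of_nat (card (?S r)) * (k x * spherical_function q adj v0 \<nu> z x)"
      using radial_value_dist[OF k(1), of x] x by (simp add: kernel_coeff_def mult_ac)
    also have "of_real (real q powr (real r / 2)) * of_real (real q powr (- real r / 2)) = (1 :: complex)"
      unfolding of_real_mult[symmetric] powr_add[symmetric] using q_pos by simp
    finally show ?thesis using ne by (simp add: F_def)
  qed
  have card: "of_nat (card (?S r)) * (y / of_nat (card (?S r))) = (y :: 'z :: field_char_0)" for r y
    using sphere_nonempty[of v0 r] finite_sphere[of v0 r] by (auto simp: card_eq_0_iff)
  have inner: "((\<lambda>x. F (r, x)) has_sum ?b r * c r) (?S r)" for r
  proof (rule has_sum_finiteI[OF finite_sphere])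
    have "(\<Sum>x\<in>?S r. F (r, x)) = (\<Sum>x\<in>?S r. ?b r * c r / of_nat (card (?S r)))"
      by (intro sum.cong refl val) simp
    then show "?b r * c r = (\<Sum>x\<in>?S r. F (r, x))" unfolding sum_constant card by simp
  qed
  have "(\<lambda>y. norm (F y)) summable_on Sigma UNIV ?S"
  proof (rule summable_on_SigmaI)
    fix r
    show "((\<lambda>x. norm (F (r, x))) has_sum norm (?b r * c r)) (?S r)"
    proof (rule has_sum_finiteI[OF finite_sphere])
      have "(\<Sum>x\<in>?S r. norm (F (r, x))) = (\<Sum>x\<in>?S r. norm (?b r * c r) / of_nat (card (?S r)))"
        by (intro sum.cong refl) (simp add: val norm_divide)
      then show "norm (?b r * c r) = (\<Sum>x\<in>?S r. norm (F (r, x)))" unfolding sum_constant card by simp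
    qed
  next
    show "(\<lambda>r. norm (?b r * c r)) summable_on UNIV"
    proof (rule summable_on_comparison_test[OF kernel_coeff_growth_summable[OF k, of 1 1]])
      fix r
      have "norm (c r) \<le> (\<Sum>i\<le>r. growth p ^ r)"
        unfolding c_def
      proof (rule sum_norm_le)
        fix i assume i: "i \<in> {..r}"
        have "norm (g (int r - 2 * int i)) \<le> exp (strip_exponent p * iabs (int r - 2 * int i))"
          unfolding g_def by (rule norm_exp_of_int_le[OF s])
        also have "\<dots> \<le> growth p ^ r"
          unfolding growth_pow_eq_exp using i strip_exponent_nonneg[OF p] by (auto intro!: mult_left_mono)
        finally have "norm (g (int r - 2 * int i)) \<le> growth p ^ r" .
        then have "\<bar>if i = 0 \<or> i = r then 1 else 1 - 1 / real q\<bar> * norm (g (int r - 2 * int i))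
            \<le> 1 * growth p ^ r"
          using beta_bounds by (intro mult_mono) auto
        then show "norm (of_real (if i = 0 \<or> i = r then 1 else 1 - 1 / real q) * g (int r - 2 * int i))
            \<le> growth p ^ r"
          by (simp only: norm_mult norm_of_real mult_1)
      qed
      then have "norm (c r) \<le> 1 * (1 + real r) ^ 1 * growth p ^ r" by (simp add: distrib_right)
      then show "norm (?b r * c r) \<le> norm (?b r) * (1 * (1 + real r) ^ 1 * growth p ^ r)"
        unfolding norm_mult by (intro mult_left_mono) auto
    qed simp
  qed simp
  then have F: "(F has_sum infsum F (Sigma UNIV ?S)) (Sigma UNIV ?S)"
    by (rule has_sum_infsum[OF Infinite_Sum.abs_summable_summable])
  have bij: "bij_betw (\<lambda>x. (tdist v0 x, x)) UNIV (Sigma UNIV ?S)"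
    by (rule bij_betwI[of _ _ _ snd]) auto
  have "((\<lambda>x. F (tdist v0 x, x)) has_sum infsum F (Sigma UNIV ?S)) UNIV"
    using has_sum_reindex_bij_betw[OF bij, of F] F by blast
  then have "infsum F (Sigma UNIV ?S) = spherical_transform q adj v0 \<nu> k z"
    unfolding spherical_transform_def F_def by (simp add: infsumI)
  then have bc: "((\<lambda>r. ?b r * c r) has_sum spherical_transform q adj v0 \<nu> k z) UNIV"
    using has_sum_Sigma'[OF F inner] by simp
  have "((\<lambda>l. symbol_coeff v0 k l * g l) has_sum spherical_transform q adj v0 \<nu> k z) UNIV"
  proof (rule abel_transform_pairing[OF beta_bounds strip_exponent_nonneg[OF p] kernel_coeff_decay[OF k]])
    show "norm (g l) \<le> 1 * pexp 0 (strip_exponent p) l" for l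
      using norm_exp_of_int_le[OF s, of l] by (simp add: g_def)
    show "((\<lambda>r. ?b r * (\<Sum>i\<le>r. of_real (if i = 0 \<or> i = r then 1 else 1 - 1 / real q)
        * g (int r - 2 * int i)))
      has_sum spherical_transform q adj v0 \<nu> k z) UNIV" using bc unfolding c_def .
  qed
  then show ?thesis unfolding laurent_def g_def by (simp add: infsumI)
qed

lemma strip_image:
  assumes p: "1 \<le> p" "p \<le> 2"
  shows "(\<lambda>z. \<i> * z * of_real (ln (real q))) ` strip p = vstrip (strip_exponent p)"
proof (intro equalityI subsetI)
  fix s assume s: "s \<in> vstrip (strip_exponent p)"
  have ln: "complex_of_real (ln (real q)) \<noteq> 0" using q_pos by simp
  define z where "z = - \<i> * s / of_real (ln (real q))"
  have "\<i> * z * of_real (ln (real q)) = s" using ln by (simp add: z_def)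
  then show "s \<in> (\<lambda>z. \<i> * z * of_real (ln (real q))) ` strip p" using strip_iff[OF p, of z] s
      by (metis image_eqI)
qed (use strip_iff[OF p] in auto)

text \<open>
  The kernel is its own convolution with the point mass at the root.
\<close>
lemma kernel_in_schwartz_space:
  assumes k: "radial adj v0 k"
    and \<Lambda>: "\<And>\<phi>. \<phi> \<in> sspace v0 p
        \<Longrightarrow> convolution adj v0 \<phi> k \<in> sspace v0 p"
  shows "k \<in> sspace v0 p"
proof -
  define \<delta> where "\<delta> = (\<lambda>x. if x = v0 then 1 else 0 :: complex)"
  have "sweight v0 p m \<delta> x \<le> 1" for m x
    using q_pos by (simp add: schwartz_weight_def \<delta>_def)
  then have "\<delta> \<in> sspace v0 p" by (intro schwartz_spaceI) blast
  then have "convolution adj v0 \<delta> k \<in> sspace v0 p" by (rule \<Lambda>)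
  moreover have "convolution adj v0 \<delta> k x = k x" for x
  proof -
    have "((\<lambda>y. \<delta> y * radial_value adj v0 k (tdist x y)) has_sum k x) UNIV"
      using has_sum_finite_neutralI[of "{v0}" UNIV "\<lambda>y. \<delta> y * radial_value adj v0 k (tdist x y)" "k x"]
        radial_value_dist[OF k, of x] dist_sym[of x v0] by (simp add: \<delta>_def)
    then show ?thesis by (simp add: convolution_def infsumI)
  qed
  ultimately show ?thesis by (metis ext)
qed

text \<open>
  The Chebyshev operators turn the orbit of distributions into an array of numbers to which
  \<open>weighted_orbit_finite_spectrum\<close> applies. The symbol, divided by \<open>A\<close>, has values in the closed unit
  disc and meets its boundary within \<open>E\<close>.
\<close>
theorem bounded_distribution_orbit_expansion:
  fixes T :: "int \<Rightarrow> ('a \<Rightarrow> complex) \<Rightarrow> complex"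
  assumes p: "1 \<le> p" "p \<le> 2" and k: "radial adj v0 k" "k \<in> sspace v0 p"
    and conv: "\<And>\<phi>. \<phi> \<in> sspace v0 p \<Longrightarrow> convolution adj v0 \<phi> k \<in> sspace v0 p"
    and lin: "\<And>n \<phi> \<psi> a b. \<phi> \<in> sspace v0 p
        \<Longrightarrow> \<psi> \<in> sspace v0 p \<Longrightarrow>
      T n (\<lambda>x. a * \<phi> x + b * \<psi> x) = a * T n \<phi> + b * T n \<psi>"
    and bound: "\<And>n \<phi>. \<phi> \<in> sspace v0 p
        \<Longrightarrow> cmod (T n \<phi>) \<le> M * snorm v0 p m \<phi>"
    and M: "0 \<le> M" and A: "A \<noteq> 0"
    and rec: "\<And>n \<phi>. \<phi> \<in> sspace v0 p
        \<Longrightarrow> T n (convolution adj v0 \<phi> k) = A * T (n + 1) \<phi>"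
    and disc: "\<And>s. s \<in> vstrip (strip_exponent p)
        \<Longrightarrow> cmod (laurent (symbol_coeff v0 k) s) \<le> cmod A"
    and E: "finite E" "E \<subseteq> sphere 0 1"
      "\<And>s. s \<in> vstrip (strip_exponent p) \<Longrightarrow> cmod (laurent (symbol_coeff v0 k) s) = cmod A
          \<Longrightarrow> laurent (symbol_coeff v0 k) s / A \<in> E"
    and \<phi>: "\<phi> \<in> sspace v0 p"
  shows "\<exists>c. \<forall>n. T (int n) \<phi> = (\<Sum>e\<in>E. c e * e ^ n)"
proof -
  let ?d = "strip_exponent p" and ?S = "sspace v0 p" and ?f = "symbol_coeff v0 k"
  note d = strip_exponent_nonneg[OF p]
  define X where "X = (\<lambda>l::int. chebT_op (nat \<bar>l\<bar>) \<phi>)"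
  define \<tau> where "\<tau> = (\<lambda>n l. T n (X l))"
  have X: "X l \<in> ?S" for l unfolding X_def by (rule chebT_op_schwartz[OF p \<phi>])
  have f: "rapid ?d ?f" by (rule rapid_abel_transform[OF beta_bounds d kernel_coeff_decay[OF k]])
  obtain N where N: "0 \<le> N" "\<And>x. sweight v0 p m \<phi> x \<le> N" using schwartz_spaceD[OF \<phi>] by metis
  define G where "G = (\<lambda>l::int. pexp (m + 2) ?d l)"
  have growth: "norm (\<tau> n l) \<le> (M * (2 * N)) * G l" for n l
  proof -
    have "snorm v0 p m (X l) \<le> 2 * N * (1 + real (nat \<bar>l\<bar>)) ^ (m + 2) * growth p ^ nat \<bar>l\<bar>"
      unfolding X_def by (intro schwartz_seminorm_le chebT_op_weight_le p N(2))
    also have "\<dots> = 2 * N * G l" by (simp add: G_def growth_pow_eq_exp)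
    finally have "M * snorm v0 p m (X l) \<le> M * (2 * N * G l)" by (intro mult_left_mono M)
    then show ?thesis using bound[OF X, of n l] by (simp add: \<tau>_def mult.assoc)
  qed
  have sphere: "T n (sphere_op r (X l))
      = (\<Sum>i\<le>r. of_real (if i = 0 \<or> i = r then 1 else 1 - 1 / real q)
          * \<tau> n (l + (int r - 2 * int i)))" for n r l
  proof -
    have "hecke_op (X j) = (\<lambda>x. X (j + 1) x + X (j - 1) x)" for j unfolding X_def by (rule hecke_chebT_abs)
    then have "sphere_op r (X l) = (\<lambda>x. \<Sum>i\<le>r. of_real (laurent_coeff r i)
        * X (l + int r - 2 * int i) x)"
      using sphere_op_on_recurrence[of X] by (intro ext) (simp add: scaleR_conv_of_real)
    moreover have "T n (\<lambda>x. \<Sum>i\<in>{..r}. of_real (laurent_coeff r i) * X (l + int r - 2 * int i) x)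
        = (\<Sum>i\<in>{..r}. of_real (laurent_coeff r i) * T n (X (l + int r - 2 * int i)))"
      by (rule linear_functional_sum[where S = ?S and T = "T n", OF lin _ _ \<phi>, THEN conjunct2])
          (simp_all add: schwartz_space_add_scale X)
    ultimately show ?thesis by (simp add: \<tau>_def laurent_coeff_eq add_diff_eq)
  qed
  have step: "((\<lambda>j. ?f j / A * \<tau> n (l + j)) has_sum \<tau> (n + 1) l) UNIV" for n l
  proof -
    \<comment> \<open>Expand the kernel into sphere operators, and these into powers of \<open>t\<close>.\<close>
    have conv_sum: "((\<lambda>r. kernel_coeff v0 k r * T n (sphere_op r (X l))) has_sum A * \<tau> (n + 1) l) UNIV"
    proof -
      have "((\<lambda>r. kernel_coeff v0 k r * T n (sphere_op r (X l))) has_sum T n (convolution adj v0 (X l) k))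
          UNIV"
        by (rule functional_of_convolution_has_sum[OF p k X conv[OF X] lin bound M])
      then show ?thesis unfolding rec[OF X] \<tau>_def .
    qed
    have "((\<lambda>j. ?f j * \<tau> n (l + j)) has_sum A * \<tau> (n + 1) l) UNIV"
    proof (rule abel_transform_pairing[OF beta_bounds d kernel_coeff_decay[OF k], where g
        = "\<lambda>j. \<tau> n (l + j)"])
      fix j
      have "norm (\<tau> n (l + j)) \<le> (M * (2 * N)) * G (l + j)" by (rule growth)
      also have "\<dots> \<le> (M * (2 * N)) * (G l * G j)"
        using growth_add_le[OF d, of l j "m + 2"] M N(1) unfolding G_def by (intro mult_left_mono) auto
      finally show "norm (\<tau> n (l + j)) \<le> (M * (2 * N) * G l) * pexp (m + 2) ?d j"
        by (simp add: G_def mult.assoc)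
    next
      show "((\<lambda>r. kernel_coeff v0 k r
          * (\<Sum>i\<le>r. of_real (if i = 0 \<or> i = r then 1 else 1 - 1 / real q)
              * \<tau> n (l + (int r - 2 * int i)))) has_sum A * \<tau> (n + 1) l) UNIV"
        using conv_sum unfolding sphere .
    qed
    from has_sum_cmult_right[OF this, of "1 / A"] show ?thesis using A by (simp add: mult_ac)
  qed
  have img: "laurent (\<lambda>l. ?f l / A) s = laurent ?f s / A" if "s \<in> vstrip ?d" for s
    by (rule laurent_divide[OF f that])
  have "\<exists>c. \<forall>n. \<tau> (int n) 0 = (\<Sum>e\<in>E. c e * e ^ n)"
  proof (rule weighted_orbit_finite_spectrum[where \<tau> = \<tau> and f = "\<lambda>l. ?f l / A" and N = "m + 2"
      and C = "M * (2 * N)",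
        OF rapid_divide[OF f] d _ step])
    show "norm (\<tau> n l) \<le> (M * (2 * N)) * pexp (m + 2) ?d l" for n l
      using growth unfolding G_def .
    show "laurent (\<lambda>l. ?f l / A) ` vstrip ?d \<subseteq> cball 0 1"
      using img disc A by (auto simp: norm_divide divide_le_eq)
    show "laurent (\<lambda>l. ?f l / A) ` vstrip ?d \<inter> sphere 0 1 \<subseteq> E"
      using img E(3) A by (auto simp: norm_divide)
  qed (use E in auto)
  then obtain c where c: "\<And>n. \<tau> (int n) 0 = (\<Sum>e\<in>E. c e * e ^ n)" by blast
  \<comment> \<open>The Chebyshev operator of index \<open>0\<close> is twice the identity.\<close>
  have "\<tau> n 0 = 2 * T n \<phi>" for n
    using lin[OF \<phi> \<phi>, of n 1 1] by (simp add: \<tau>_def X_def scaleR_2)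
  then have "T (int n) \<phi> = (\<Sum>e\<in>E. (c e / 2) * e ^ n)" for n
    using c[of n] by (simp add: sum_divide_distrib[symmetric] sum_distrib_right[symmetric] field_simps)
  then show ?thesis by (intro exI[of _ "\<lambda>e. c e / 2"]) simp
qed

lemma tempered_distribution_finite_sum:
  assumes "finite I" "\<And>i. i \<in> I \<Longrightarrow> T i \<in> tempered_distributions q adj v0 p"
  shows "(\<lambda>\<phi>\<in>sspace v0 p. \<Sum>i\<in>I. c i * T i \<phi>) \<in> tempered_distributions q adj v0 p"
proof -
  let ?S = "sspace v0 p"
  let ?U = "\<lambda>\<phi>\<in>?S. \<Sum>i\<in>I. c i * T i \<phi>"
  have "?U (\<lambda>x. a * \<phi> x + b * \<psi> x) = a * ?U \<phi> + b * ?U \<psi>"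
      if "\<phi> \<in> ?S" "\<psi> \<in> ?S" for \<phi> \<psi> a b
  proof -
    have "T i (\<lambda>x. a * \<phi> x + b * \<psi> x) = a * T i \<phi> + b * T i \<psi>" if "i \<in> I" for i
      using assms(2)[OF that] \<open>\<phi> \<in> ?S\<close> \<open>\<psi> \<in> ?S\<close>
          unfolding tempered_distributions_def by blast
    then show ?thesis
      using that schwartz_space_add_scale[OF that] by (simp add: sum_distrib_left sum.distrib algebra_simps)
  qed
  moreover have "continuous_map (schwartz_topology q adj v0 p) euclidean ?U"
  proof (rule continuous_map_eq)
    show "continuous_map (schwartz_topology q adj v0 p) euclidean (\<lambda>\<phi>. \<Sum>i\<in>I. c i * T i \<phi>)"
    proof (rule continuous_map_sum[OF assms(1)])
      fix i assume "i \<in> I"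
      then have "continuous_map (schwartz_topology q adj v0 p) euclidean (T i)"
        using assms(2) by (simp add: tempered_distributions_def)
      moreover have "continuous_map euclidean euclidean (\<lambda>z. c i * z)"
        by (simp add: continuous_intros)
      ultimately show "continuous_map (schwartz_topology q adj v0 p) euclidean (\<lambda>\<phi>. c i * T i \<phi>)"
        using continuous_map_compose[of _ _ "T i" _ "\<lambda>z. c i * z"] by (simp add: o_def)
    qed
    fix \<phi> assume "\<phi> \<in> topspace (schwartz_topology q adj v0 p)"
    then have "\<phi> \<in> ?S" by (auto simp: schwartz_topology_def)
    then show "(\<Sum>i\<in>I. c i * T i \<phi>) = ?U \<phi>" by simp
  qed
  ultimately show ?thesis unfolding tempered_distributions_def by simp
qed

end

section \<open>Eigendistributions and the proof of the theorem\<close>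

text \<open>
  The single terms of a sum of geometric sequences with distinct ratios are fixed linear combinations
  of the values of the sequence; the combinations are given by Lagrange polynomials.
\<close>
lemma lagrange_extraction:
  fixes w :: "'i \<Rightarrow> complex"
  assumes "finite I" "inj_on w I"
  obtains a :: "'i \<Rightarrow> nat \<Rightarrow> complex" and D :: "'i \<Rightarrow> nat" where
    "\<And>c i. i \<in> I \<Longrightarrow> (\<Sum>k\<le>D i. a i k * (\<Sum>j\<in>I. c j * w j ^ k)) = c i"
proof -
  define L where "L = (\<lambda>i. \<Prod>j\<in>I - {i}. smult (1 / (w i - w j)) [:- w j, 1:])"
  have ev: "poly (smult c [:- a, 1:]) x = c * (x - a)" for c a x :: complex
    by (simp add: algebra_simps)
  have L: "poly (L i) (w j) = of_bool (i = j)" if ij: "i \<in> I" "j \<in> I" for i j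
  proof (cases "i = j")
    case True
    have "poly (smult (1 / (w i - w k)) [:- w k, 1:]) (w i) = 1" if "k \<in> I - {i}" for k
    proof -
      have "w i - w k \<noteq> 0" using that ij(1) assms(2) by (auto simp: inj_on_def)
      then show ?thesis unfolding ev by simp
    qed
    then show ?thesis using True by (simp add: L_def poly_prod del: poly_smult)
  next
    case False
    then have "j \<in> I - {i}" using ij by auto
    moreover have "poly (smult (1 / (w i - w j)) [:- w j, 1:]) (w j) = 0" by simp
    ultimately show ?thesis unfolding L_def poly_prod using False assms(1) by (auto intro: prod_zero)
  qed
  have "(\<Sum>k\<le>degree (L i). coeff (L i) k * (\<Sum>j\<in>I. c j * w j ^ k)) = c i" if i: "i \<in> I" for c i
  proof -
    have "(\<Sum>k\<le>degree (L i). coeff (L i) k * (\<Sum>j\<in>I. c j * w j ^ k))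
        = (\<Sum>j\<in>I. c j * poly (L i) (w j))"
      unfolding poly_altdef sum_distrib_left by (subst sum.swap) (simp add: mult_ac)
    also have "\<dots> = (\<Sum>j\<in>I. if i = j then c j else 0)"
      using L i by (intro sum.cong refl) auto
    finally show ?thesis using i assms(1) by simp
  qed
  then show ?thesis by (rule that[where a = "\<lambda>i. coeff (L i)" and D = "\<lambda>i. degree (L i)"])
qed

theorem theorem4p3:
  fixes q m :: nat and adj :: "'a \<Rightarrow> 'a \<Rightarrow> bool" and v0 :: 'a
    and \<nu> :: "(nat \<Rightarrow> 'a) measure" and p M :: real
    and \<Lambda> :: "('a \<Rightarrow> complex) \<Rightarrow> 'a \<Rightarrow> complex" and \<kappa> :: "complex \<Rightarrow> complex"
    and T :: "int \<Rightarrow> ('a \<Rightarrow> complex) \<Rightarrow> complex" and A :: complex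
  assumes "2 \<le> q" and "homogeneous_tree q adj" and "is_boundary_measure q adj v0 \<nu>"
    and "1 \<le> p" and "p < 2"
    and "multiplier_with_symbol q adj v0 \<nu> p \<Lambda> \<kappa>"
    and "\<exists>z\<in>strip p. \<kappa> z \<noteq> 0"
    and "\<And>k. T k \<in> tempered_distributions q adj v0 p"
    and "A \<noteq> 0"
    and "\<And>k \<phi>. \<phi> \<in> schwartz_space q adj v0 p \<Longrightarrow>
           dual_action q adj v0 p \<Lambda> (T k) \<phi> = A * T (k + 1) \<phi>"
    and "0 < M"
    and "\<And>k \<phi>. \<phi> \<in> schwartz_space q adj v0 p \<Longrightarrow>
           cmod (T k \<phi>) \<le> M * schwartz_seminorm q adj v0 p m \<phi>"
  shows "(\<forall>(j::nat) (B :: nat \<Rightarrow> complex).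
            cmod A = (GREATEST r. r \<in> (\<lambda>z. cmod (\<kappa> z)) ` strip p) \<and>
            inj_on B {1..j} \<and> \<kappa> ` strip p \<inter> {w. cmod w = cmod A} = B ` {1..j} \<longrightarrow>
            (\<exists>!U. U \<in> {1..j} \<rightarrow>\<^sub>E tempered_distributions q adj v0 p \<and>
               (\<forall>\<phi>\<in>schwartz_space q adj v0 p. T 0 \<phi> = (\<Sum>i=1..j. U i \<phi>)) \<and>
               (\<forall>i\<in>{1..j}. \<forall>\<phi>\<in>schwartz_space q adj v0 p.
                  dual_action q adj v0 p \<Lambda> (U i) \<phi> = B i * U i \<phi>))) \<and>
         (cmod A > (GREATEST r. r \<in> (\<lambda>z. cmod (\<kappa> z)) ` strip p) \<longrightarrow>
            (\<forall>\<phi>\<in>schwartz_space q adj v0 p. T 0 \<phi> = 0))"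
proof -
  interpret hom_tree q adj by unfold_locales (fact assms)+
  let ?S = "schwartz_space q adj v0 p"
  have p: "1 \<le> p" "p \<le> 2" using assms by auto
  obtain k where k: "radial adj v0 k"
    and \<Lambda>: "\<And>\<phi>. \<phi> \<in> ?S
        \<Longrightarrow> \<Lambda> \<phi> = convolution adj v0 \<phi> k" "\<And>\<phi>. \<phi> \<in> ?S
            \<Longrightarrow> \<Lambda> \<phi> \<in> ?S"
    and \<kappa>: "\<And>z. z \<in> strip p \<Longrightarrow> \<kappa> z = spherical_transform q adj v0 \<nu> k z"
    using assms(6) unfolding multiplier_with_symbol_def by blast
  have conv: "convolution adj v0 \<phi> k \<in> ?S" if "\<phi> \<in> ?S" for \<phi> using \<Lambda>[OF that] by simp
  have kS: "k \<in> ?S" by (rule kernel_in_schwartz_space[OF k conv])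
  let ?F = "laurent (symbol_coeff v0 k)" and ?V = "vstrip (strip_exponent p)"
  have \<kappa>F: "\<kappa> z = ?F (\<i> * z * of_real (ln (real q)))" if "z \<in> strip p" for z
    using \<kappa>[OF that] spherical_transform_eq_laurent[OF p assms(3) k kS that] by simp
  have image: "\<kappa> ` strip p = ?F ` ?V"
    unfolding strip_image[OF p, symmetric] image_image using \<kappa>F by (intro image_cong refl)
  have lin: "T n (\<lambda>x. a * \<phi> x + b * \<psi> x) = a * T n \<phi> + b * T n \<psi>"
      if "\<phi> \<in> ?S" "\<psi> \<in> ?S" for n \<phi> \<psi> a b
    using assms(8)[of n] that unfolding tempered_distributions_def by blast
  have rec: "T n (\<Lambda> \<phi>) = A * T (n + 1) \<phi>" if "\<phi> \<in> ?S" for n \<phi>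
    using assms(10)[OF that, of n] that by (simp add: dual_action_def)
  have greatest: "(GREATEST r. r \<in> (\<lambda>z. cmod (\<kappa> z)) ` strip p) \<in> cmod ` ?F ` ?V \<and>
    (\<forall>s\<in>?V. cmod (?F s) \<le> (GREATEST r. r \<in> (\<lambda>z. cmod (\<kappa> z)) ` strip p))"
  proof -
    have eq: "(\<lambda>z. cmod (\<kappa> z)) ` strip p = cmod ` ?F ` ?V"
      unfolding image[symmetric] image_image ..
    have "rapid (strip_exponent p) (symbol_coeff v0 k)"
      by (rule rapid_abel_transform[OF beta_bounds strip_exponent_nonneg[OF p] kernel_coeff_decay[OF k kS]])
    then have "compact (cmod ` ?F ` ?V)"
      by (intro compact_continuous_image compact_laurent_image continuous_intros)
    moreover have "cmod ` ?F ` ?V \<noteq> {}" using assms(7) image by blast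
    ultimately obtain r where r: "r \<in> cmod ` ?F ` ?V" "\<And>y. y \<in> cmod ` ?F ` ?V
        \<Longrightarrow> y \<le> r"
      using compact_attains_sup by metis
    have "(GREATEST r. r \<in> cmod ` ?F ` ?V) = r" using r by (rule Greatest_equality)
    then show ?thesis unfolding eq using r by blast
  qed
  have expansion: "\<exists>c. \<forall>n. T (int n) \<phi> = (\<Sum>e\<in>E. c e * e ^ n)"
    if \<phi>: "\<phi> \<in> ?S" and disc: "\<And>s. s \<in> ?V \<Longrightarrow> cmod (?F s) \<le> cmod A"
        and E: "finite E" "E \<subseteq> sphere 0 1"
      "\<And>s. s \<in> ?V \<Longrightarrow> cmod (?F s) = cmod A \<Longrightarrow> ?F s / A \<in> E" for \<phi> E
  proof (rule bounded_distribution_orbit_expansion[OF p k kS conv lin assms(12) less_imp_le[OF assms(11)] assms(9) _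
      disc E \<phi>])
    show "T n (convolution adj v0 \<phi> k) = A * T (n + 1) \<phi>" if "\<phi> \<in> ?S" for n \<phi>
      using rec[OF that] \<Lambda>(1)[OF that] by simp
  qed
  show ?thesis
  proof (intro conjI allI impI ballI)
    fix \<phi> assume big: "(GREATEST r. r \<in> (\<lambda>z. cmod (\<kappa> z)) ` strip p) < cmod A"
        and \<phi>: "\<phi> \<in> ?S"
    have small: "cmod (?F s) < cmod A" if "s \<in> ?V" for s
      using greatest big that by (meson le_less_trans)
    have "\<exists>c. \<forall>n. T (int n) \<phi> = (\<Sum>e\<in>{}. c e * e ^ n)"
    proof (rule expansion[OF \<phi>])
      show "cmod (?F s) \<le> cmod A" if "s \<in> ?V" for s using small[OF that] by simp
      show "?F s / A \<in> {}" if "s \<in> ?V" "cmod (?F s) = cmod A" for s using small[OF that(1)] that(2) by simp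
    qed simp_all
    then have "\<forall>n. T (int n) \<phi> = 0" by simp
    from spec[OF this, of 0] show "T 0 \<phi> = 0" by simp
  next
    fix j :: nat and B :: "nat \<Rightarrow> complex"
    assume "cmod A = (GREATEST r. r \<in> (\<lambda>z. cmod (\<kappa> z)) ` strip p) \<and>
      inj_on B {1..j} \<and> \<kappa> ` strip p \<inter> {w. cmod w = cmod A} = B ` {1..j}"
    then have max: "cmod A = (GREATEST r. r \<in> (\<lambda>z. cmod (\<kappa> z)) ` strip p)"
      and inj: "inj_on B {1..j}" and peak: "?F ` ?V \<inter> {w. cmod w = cmod A} = B ` {1..j}"
      unfolding image by blast+
    define w where "w = (\<lambda>i. B i / A)"
    have inj_w: "inj_on w {1..j}"
    proof (rule inj_onI)
      fix x y assume xy: "x \<in> {1..j}" "y \<in> {1..j}" "w x = w y"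
      then have "B x = B y" using assms(9) by (simp add: w_def)
      then show "x = y" using inj_onD[OF inj] xy(1,2) by blast
    qed
    have Aw: "A * w i = B i" for i using assms(9) by (simp add: w_def)
    have exp_w: "\<exists>c. \<forall>n. T (int n) \<phi> = (\<Sum>i\<in>{1..j}. c i * w i ^ n)"
        if \<phi>: "\<phi> \<in> ?S" for \<phi>
    proof -
      have "\<exists>c. \<forall>n. T (int n) \<phi> = (\<Sum>e\<in>w ` {1..j}. c e * e ^ n)"
      proof (rule expansion[OF \<phi>])
        show "cmod (?F s) \<le> cmod A" if "s \<in> ?V" for s using greatest max that by simp
        have "cmod (B i) = cmod A" if "i \<in> {1..j}" for i using peak that by blast
        then show "w ` {1..j} \<subseteq> sphere 0 1" using assms(9) by (auto simp: w_def norm_divide)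
        show "?F s / A \<in> w ` {1..j}" if "s \<in> ?V" "cmod (?F s) = cmod A" for s
        proof -
          have "?F s \<in> B ` {1..j}" using peak that by blast
          then show ?thesis by (auto simp: w_def)
        qed
      qed simp
      then obtain c where c: "\<And>n. T (int n) \<phi> = (\<Sum>e\<in>w ` {1..j}. c e * e ^ n)" by blast
      have "T (int n) \<phi> = (\<Sum>i\<in>{1..j}. c (w i) * w i ^ n)" for n
        unfolding c sum.reindex[OF inj_w] o_def ..
      then show ?thesis by (intro exI[of _ "\<lambda>i. c (w i)"]) blast
    qed
    obtain a :: "nat \<Rightarrow> nat \<Rightarrow> complex" and D where
      L: "\<And>c i. i \<in> {1..j} \<Longrightarrow> (\<Sum>k\<le>D i. a i k * (\<Sum>l\<in>{1..j}. c l * w l ^ k))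
          = c i"
      using lagrange_extraction[OF _ inj_w] by blast
    \<comment> \<open>The \<open>i\<close>-th Lagrange polynomial for the nodes \<open>w\<close>, applied to \<open>\<Lambda> / A\<close> and \<open>T\<^sub>0\<close>.\<close>
    define U where "U = (\<lambda>i\<in>{1..j}. \<lambda>\<phi>\<in>?S. \<Sum>k\<le>D i. a i k * T (int k) \<phi>)"
    have U: "U i \<phi> = c i" if "i \<in> {1..j}" "\<phi> \<in> ?S" "\<And>n. T (int n) \<phi>
        = (\<Sum>l\<in>{1..j}. c l * w l ^ n)" for i \<phi> c
      unfolding U_def using that L[of i c] by simp
    show "\<exists>!U. U \<in> {1..j} \<rightarrow>\<^sub>E tempered_distributions q adj v0 p \<and>
               (\<forall>\<phi>\<in>?S. T 0 \<phi> = (\<Sum>i=1..j. U i \<phi>)) \<and>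
               (\<forall>i\<in>{1..j}. \<forall>\<phi>\<in>?S. dual_action q adj v0 p \<Lambda> (U i) \<phi>
                   = B i * U i \<phi>)"
    proof (intro ex1I[of _ U] conjI ballI)
      show "U \<in> {1..j} \<rightarrow>\<^sub>E tempered_distributions q adj v0 p"
        unfolding U_def by (auto intro!: tempered_distribution_finite_sum assms(8))
    next
      fix \<phi> assume \<phi>: "\<phi> \<in> ?S"
      obtain c where c: "\<And>n. T (int n) \<phi> = (\<Sum>i\<in>{1..j}. c i * w i ^ n)" using exp_w[OF \<phi>]
          by blast
      have "(\<Sum>i=1..j. U i \<phi>) = (\<Sum>i=1..j. c i)" by (intro sum.cong refl U[OF _ \<phi> c])
      then show "T 0 \<phi> = (\<Sum>i=1..j. U i \<phi>)" using c[of 0] by simp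
    next
      fix i \<phi> assume i: "i \<in> {1..j}" and \<phi>: "\<phi> \<in> ?S"
      obtain c where c: "\<And>n. T (int n) \<phi> = (\<Sum>i\<in>{1..j}. c i * w i ^ n)" using exp_w[OF \<phi>]
          by blast
      have "T (int n) (\<Lambda> \<phi>) = (\<Sum>i\<in>{1..j}. (B i * c i) * w i ^ n)" for n
        using rec[OF \<phi>, of "int n"] c[of "Suc n"]
            by (simp add: sum_distrib_left Aw[symmetric] mult_ac add.commute)
      then have "U i (\<Lambda> \<phi>) = B i * c i" by (rule U[OF i \<Lambda>(2)[OF \<phi>]])
      then show "dual_action q adj v0 p \<Lambda> (U i) \<phi> = B i * U i \<phi>"
        using U[OF i \<phi> c] \<phi> by (simp add: dual_action_def)
    next
      fix U' assume U': "U' \<in> {1..j} \<rightarrow>\<^sub>E tempered_distributions q adj v0 p \<and>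
               (\<forall>\<phi>\<in>?S. T 0 \<phi> = (\<Sum>i=1..j. U' i \<phi>)) \<and>
               (\<forall>i\<in>{1..j}. \<forall>\<phi>\<in>?S. dual_action q adj v0 p \<Lambda> (U' i) \<phi>
                   = B i * U' i \<phi>)"
      \<comment> \<open>A decomposition of \<open>T\<^sub>0\<close> into eigendistributions determines the whole forward orbit, from which
        interpolation recovers it.\<close>
      have orbit: "T (int n) \<phi> = (\<Sum>i\<in>{1..j}. U' i \<phi> * w i ^ n)" if "\<phi> \<in> ?S" for n \<phi>
        using that
      proof (induction n arbitrary: \<phi>)
        case 0
        then show ?case using U' by simp
      next
        case (Suc n)
        have "U' i (\<Lambda> \<phi>) = B i * U' i \<phi>" if "i \<in> {1..j}" for i
          using U' that Suc.prems by (auto simp: dual_action_def)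
        then have "A * T (int (Suc n)) \<phi> = (\<Sum>i\<in>{1..j}. (B i * U' i \<phi>) * w i ^ n)"
          using rec[OF Suc.prems, of "int n"] Suc.IH[OF \<Lambda>(2)[OF Suc.prems]] by (simp add: add.commute)
        also have "\<dots> = A * (\<Sum>i\<in>{1..j}. U' i \<phi> * w i ^ Suc n)"
          by (simp add: sum_distrib_left Aw[symmetric] mult_ac)
        finally show ?case using assms(9) by simp
      qed
      show "U' = U"
      proof (rule PiE_ext[of U' "{1..j}" "\<lambda>_. extensional ?S" U])
        show "U' \<in> {1..j} \<rightarrow>\<^sub>E extensional ?S" using U'
            by (auto simp: tempered_distributions_def PiE_iff)
        show "U \<in> {1..j} \<rightarrow>\<^sub>E extensional ?S" by (auto simp: U_def)
        fix i assume i: "i \<in> {1..j}"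
        then have "U' i \<in> extensional ?S" "U i \<in> extensional ?S"
          using U' by (auto simp: tempered_distributions_def PiE_iff U_def)
        then show "U' i = U i"
          by (rule extensionalityI) (rule U[OF i _ orbit, symmetric])
      qed
    qed
  qed
qed

end
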